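(* Fix $\rho\in[0,1)$ and, for $p>1$, let $P_p$ be the mpCN kernel with $p$ proposals (defined in the context). Assume that $\Phi:\mathcal X\to\mathbb R$ is globally Lipschitz with respect to $\|\cdot\|$ with constant $L_\Phi$, and that the following condition holds: there are $R>0$, $\alpha^*>0$ and a function $r:\mathbb R^+\to\mathbb R^+$ with $r(t)\le(1-\rho^2)t/2$ for all $|t|\ge R$ such that, for at least one $j\in\{1,\dots,p\}$, for all $x\in B(0,R)^c$ and all $z_1,\dots,z_{j-1},z_{j+1},\dots,z_p\in\mathcal X$, $$\inf_{z_j\in B(\rho^2x,\,r(\|x\|))}\alpha_j(x,z_1,\dots,z_j,\dots,z_p)>\alpha^*.$$ Let $V$ be any one of the functions $V(x)=\|x\|^k$ with $k\in\mathbb N$; $V(x)=\exp(v\|x\|)$ with $v>0$; or $V(x)=\exp(v\|x\|^2)$ with $v>0$ sufficiently small. Then there exists $\varepsilon^*=\varepsilon^*(p)\in(0,1)$ so that for any $\varepsilon\in(0,\varepsilon^*(p))$ there are $\lambda=\lambda(p)\in(0,1)$ and $n_1=n_1(p)\in\mathbb N$ such that for all Borel probability measures $\nu_1,\nu_2$ on $\mathcal X$, $$W_{\tilde d_\varepsilon}(\nu_1P_p^n,\nu_2P_p^n)\le\lambda^n\,W_{\tilde d_\varepsilon}(\nu_1,\nu_2)\quad\text{for all } n\ge n_1,$$ where $\tilde d_\varepsilon(x,\tilde x)=\sqrt{d_\varepsilon(x,\tilde x)\,(1+V(x)+V(\tilde x))}$ and $d_\varepsilon(x,\tilde x)=1\wedge\varepsilon^{-1}\|x-\tilde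 x\|$; here the parameters are such that $\varepsilon^*(p)\to0$, $n_1(p)\to\infty$ and $\lambda(p)\to1$ as $p\to\infty$.
   Context: $\mathcal X$ is a separable Hilbert space with norm $\|\cdot\|$; $\mu_0=\mathcal N(0,\mathcal C)$ is the centered Gaussian measure on $\mathcal X$ with covariance operator $\mathcal C$ linear, symmetric, strictly positive-definite and trace-class. $Q(x,\cdot)=\mathcal N(\rho x,(1-\rho^2)\mathcal C)$. $B(a,s)$ is the ball of center $a$ and radius $s$. The acceptance probabilities are $\alpha_j(x_0,x_1,\dots,x_p)=\dfrac{e^{-\Phi(x_j)}}{\sum_{l=0}^pe^{-\Phi(x_l)}}$, $j=0,\dots,p$, and the mpCN kernel is $$P_p(x_0,dy)=\sum_{j=0}^p\int_{\mathcal X^{p+1}}\alpha_j(x_0,\dots,x_p)\,\delta_{x_j}(dy)\prod_{k=1}^pQ(z,dx_k)\,Q(x_0,dz).$$ For a Markov kernel $P$ and a measure $\nu$, $\nu P(A)=\int P(x,A)\,\nu(dx)$, and $P^n$ is the $n$-step kernel. $W_{\tilde d}(\nu_1,\nu_2)=\inf_\pi\int\tilde d(x,y)\,\pi(dx,dy)$, the infimum over all couplings $\pi$ of $\nu_1,\nu_2$. "$v$ sufficiently small" means $0<v\le v_0$ for some $v_0>0$. *)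

theory Defs
  imports "HOL-Probability.Probability"
begin

definition orthonormal_basis :: "'a::real_inner set \<Rightarrow> bool" where
  "orthonormal_basis B \<longleftrightarrow>
     pairwise orthogonal B \<and> (\<forall>e\<in>B. norm e = 1) \<and> closure (span B) = UNIV"

text \<open>For a positive operator the absolute value is the operator itself, so it is trace-class
  iff its diagonal in an orthonormal basis is summable (and then this holds in every such basis).\<close>

definition covariance_operator :: "('a::real_inner \<Rightarrow> 'a) \<Rightarrow> bool" where
  "covariance_operator C \<longleftrightarrow>
     bounded_linear C \<and>
     (\<forall>x y. C x \<bullet> y = x \<bullet> C y) \<and>
     (\<forall>x. x \<noteq> 0 \<longrightarrow> 0 < C x \<bullet> x) \<and>
     (\<exists>B. orthonormal_basis B \<and> (\<lambda>e. C e \<bullet> e) summable_on B)"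

text \<open>The second argument is the variance; variance 0 gives the Dirac mass at the mean.\<close>

definition normal_law :: "real \<Rightarrow> real \<Rightarrow> real measure" where
  "normal_law m s =
     (if s = 0 then return borel m else density lborel (normal_density m (sqrt s)))"

text \<open>\<open>gaussian_measure m C M\<close> says that \<open>M\<close> is the law $\mathcal{N}(m, C)$: every continuous
  linear functional \<open>\<lambda>x. h \<bullet> x\<close> is normally distributed under \<open>M\<close>, with mean \<open>h \<bullet> m\<close>
  and variance \<open>C h \<bullet> h\<close>.\<close>

definition gaussian_measure ::
    "'a::{real_inner, banach, second_countable_topology} \<Rightarrow> ('a \<Rightarrow> 'a) \<Rightarrow> 'a measure \<Rightarrow> bool" where
  "gaussian_measure m C M \<longleftrightarrow>
     prob_space M \<and> sets M = sets borel \<and>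
     (\<forall>h. distr M borel (\<lambda>x. h \<bullet> x) = normal_law (h \<bullet> m) (C h \<bullet> h))"

text \<open>The current state and the \<open>p\<close> proposals are \<open>xs 0\<close> and \<open>xs 1, \<dots>, xs p\<close>; the values of \<open>xs\<close>
  beyond \<open>p\<close> are irrelevant.\<close>

definition accept_prob :: "('a \<Rightarrow> real) \<Rightarrow> nat \<Rightarrow> nat \<Rightarrow> (nat \<Rightarrow> 'a) \<Rightarrow> real" where
  "accept_prob \<Phi> p j xs = exp (- \<Phi> (xs j)) / (\<Sum>l\<le>p. exp (- \<Phi> (xs l)))"

definition mpcn_kernel ::
    "('a::{real_inner, banach, second_countable_topology} \<Rightarrow> 'a measure) \<Rightarrow> ('a \<Rightarrow> real) \<Rightarrow> nat
      \<Rightarrow> 'a \<Rightarrow> 'a measure" where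
  "mpcn_kernel Q \<Phi> p x0 = measure_of UNIV (sets borel)
     (\<lambda>A. \<Sum>j\<le>p. \<integral>\<^sup>+ z. (\<integral>\<^sup>+ xs. ennreal (accept_prob \<Phi> p j (xs(0 := x0))) *
                               emeasure (return borel ((xs(0 := x0)) j)) A
                          \<partial>PiM {1..p} (\<lambda>_. Q z)) \<partial>Q x0)"

text \<open>The action of a kernel on a measure, $\nu P(A) = \int P(x, A)\,\nu(dx)$, is the library's
  \<open>\<nu> \<bind> P\<close>.\<close>

primrec kernel_pow ::
    "('a::topological_space \<Rightarrow> 'a measure) \<Rightarrow> nat \<Rightarrow> 'a \<Rightarrow> 'a measure" where
  "kernel_pow P 0 = return borel"
| "kernel_pow P (Suc n) = (\<lambda>x. kernel_pow P n x \<bind> P)"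

definition couplings ::
    "'a::topological_space measure \<Rightarrow> 'a measure \<Rightarrow> ('a \<times> 'a) measure set" where
  "couplings \<nu>1 \<nu>2 =
     {\<pi>. sets \<pi> = sets (borel \<Otimes>\<^sub>M borel) \<and> distr \<pi> borel fst = \<nu>1 \<and> distr \<pi> borel snd = \<nu>2}"

text \<open>The transport cost may be infinite.\<close>

definition wasserstein ::
    "('a::topological_space \<Rightarrow> 'a \<Rightarrow> real) \<Rightarrow> 'a measure \<Rightarrow> 'a measure \<Rightarrow> ennreal" where
  "wasserstein d \<nu>1 \<nu>2 = (INF \<pi>\<in>couplings \<nu>1 \<nu>2. \<integral>\<^sup>+ xy. ennreal (d (fst xy) (snd xy)) \<partial>\<pi>)"

definition d_eps :: "real \<Rightarrow> 'a::real_normed_vector \<Rightarrow> 'a \<Rightarrow> real" where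
  "d_eps \<epsilon> x y = min 1 (inverse \<epsilon> * norm (x - y))"

definition d_tilde :: "('a \<Rightarrow> real) \<Rightarrow> real \<Rightarrow> 'a::real_normed_vector \<Rightarrow> 'a \<Rightarrow> real" where
  "d_tilde V \<epsilon> x y = sqrt (d_eps \<epsilon> x y * (1 + V x + V y))"

text \<open>The exponent \<open>k\<close> is a positive integer: for \<open>k = 0\<close> the function \<open>V\<close> would be constant and
  give no control at infinity. The bound \<open>v0\<close> quantifies "\<open>v\<close> sufficiently small" in the
  squared-exponential case only.\<close>

definition lyapunov_choice :: "real \<Rightarrow> ('a::real_normed_vector \<Rightarrow> real) \<Rightarrow> bool" where
  "lyapunov_choice v0 V \<longleftrightarrow>
     (\<exists>k::nat. k \<ge> 1 \<and> V = (\<lambda>x. norm x ^ k)) \<or>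
     (\<exists>v>0. V = (\<lambda>x. exp (v * norm x))) \<or>
     (\<exists>v. 0 < v \<and> v \<le> v0 \<and> V = (\<lambda>x. exp (v * (norm x)\<^sup>2)))"

text \<open>The radius function is strictly positive, so the infimum below is over a nonempty
  set (of nonnegative reals) and is a genuine infimum.\<close>

definition acceptance_condition ::
    "real \<Rightarrow> ('a::real_inner \<Rightarrow> real) \<Rightarrow> nat \<Rightarrow> bool" where
  "acceptance_condition \<rho> \<Phi> p \<longleftrightarrow>
     (\<exists>R>0. \<exists>\<alpha>star>0. \<exists>r :: real \<Rightarrow> real.
        (\<forall>t>0. 0 < r t) \<and>
        (\<forall>t>0. R \<le> \<bar>t\<bar> \<longrightarrow> r t \<le> (1 - \<rho>\<^sup>2) * t / 2) \<and>
        (\<exists>j\<in>{1..p}. \<forall>x. x \<notin> ball 0 R \<longrightarrow> (\<forall>z :: nat \<Rightarrow> 'a.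
           \<alpha>star < (INF y\<in>ball (\<rho>\<^sup>2 *\<^sub>R x) (r (norm x)).
                      accept_prob \<Phi> p j (z(0 := x, j := y))))))"

end

theory Submission
  imports Defs
begin

text \<open>
  The acceptance condition looks local, but it is required for arbitrary values of the other proposals.
  Comparing with an arbitrary point \<open>w\<close> in the place of another proposal turns a lower bound
  \<open>\<alpha>\<close> on an acceptance probability into \<open>\<Phi> (\<rho>\<^sup>2 x) \<le> \<Phi> w - ln \<alpha>\<close> for all \<open>w\<close>
  (\<open>acceptance_condition_bounds\<close>). So \<open>\<Phi>\<close> is bounded below, and bounded above along all the centres
  \<open>\<rho>\<^sup>2 x\<close> of the proposals. As \<open>\<Phi>\<close> is Lipschitz, the first proposal is accepted
  with a probability that is at least a strictly positive function of its Gaussian increment alone,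
  whatever the state is (\<open>accept_floor_le\<close>).

  Two copies of the chain, started in \<open>x\<close> and \<open>y\<close>, are coupled by using the same Gaussian noise,
  so that corresponding proposals differ by exactly \<open>\<rho>\<^sup>2 (x - y)\<close>, and by choosing the
  two indices of the accepted proposals by a maximal coupling. The two indices differ with
  probability at most \<open>2 L |x - y|\<close> (\<open>acceptance_excess_le\<close>), and with a probability bounded below
  they agree and are positive, so that the distance shrinks by \<open>\<rho>\<^sup>2\<close>. For
  \<open>g t = 1 - exp (- a t)\<close> with \<open>a\<close> large this gives an expected decrease of \<open>g |x - y|\<close> by
  \<open>exp (- a |x - y|) |x - y|\<close> (\<open>coupled_distance_contracts\<close>): the concavity of \<open>g\<close> pays for the
  event on which the indices differ, in one step and at all distances. Uniform acceptance also
  gives \<open>P V \<le> l V + K\<close> with \<open>l < 1\<close> (\<open>kernel_drift\<close>). By the Cauchy-Schwarz inequality,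
  \<open>sqrt (g |x - y| (1 + \<beta> (V x + V y)))\<close> then contracts in one step, for small \<open>\<beta>\<close>: the distance
  contributes when \<open>V x + V y\<close> is small, the drift when it is large
  (\<open>harris_constants\<close>, \<open>coupled_kernel_contracts\<close>). This function is equivalent to the
  semimetric of the theorem, for every \<open>\<epsilon>\<close>, and the constants of the equivalence are absorbed by
  taking the number of steps large (\<open>wasserstein_contracts\<close>).

  Two facts on Gaussian measures enter. The law \<open>N(\<rho> x, (1 - \<rho>\<^sup>2) C)\<close> is an affine image of
  \<open>N(0, C)\<close>, which is what makes common noise possible; as Gaussian laws are given through their
  one-dimensional projections, this is an instance of \<open>Cramer_Wold\<close>. And \<open>exp (b |x|\<^sup>2)\<close> is integrable for
  small \<open>b\<close> (\<open>gaussian_exp_moment\<close>), which bounds the constant \<open>K\<close> of the drift condition.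
\<close>

section \<open>Laws of linear functionals determine a Borel measure\<close>

text \<open>Phase shifts of the cosine encode both parts of the characteristic function, so that the
  arguments below stay with real integrals.\<close>

lemma char_eq_of_cos:
  assumes "real_distribution M"
  shows "char M t = Complex (\<integral>x. cos (t * x + 0) \<partial>M) (\<integral>x. cos (t * x + (- pi / 2)) \<partial>M)"
proof -
  interpret real_distribution M by fact
  have s: "cos (t * x + (- pi / 2)) = sin (t * x)" for x
    by (simp only: sin_cos_eq cos_minus[symmetric, of "t * x + - pi / 2"]) (simp add: algebra_simps)
  have i: "integrable M (\<lambda>x. iexp (t * x))"
    by (rule integrable_iexp) auto
  have "Re (char M t) = (\<integral>x. cos (t * x) \<partial>M)"
    unfolding char_def using integral_Re[OF i] by (simp add: Re_exp)
  moreover have "Im (char M t) = (\<integral>x. sin (t * x) \<partial>M)"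
    unfolding char_def using integral_Im[OF i] by (simp add: Im_exp)
  ultimately show ?thesis by (simp add: s[simplified] complex_eq_iff)
qed

text \<open>For a nonnegative weight \<open>f\<close>, the normalised measures \<open>f M\<close> and \<open>f N\<close> project to probability
  measures on the line, and these are equal by Levy's uniqueness theorem.\<close>

lemma weighted_projection_eqI:
  fixes M N :: "'a measure" and X :: "'a \<Rightarrow> real" and f :: "'a \<Rightarrow> real"
  assumes fin: "finite_measure M" "finite_measure N" and sets: "sets M = sets N"
    and X[measurable]: "X \<in> borel_measurable M" and f[measurable]: "f \<in> borel_measurable M"
    and f0: "\<And>x. 0 \<le> f x" and fB: "\<And>x. f x \<le> B"
    and eq: "\<And>t r. (\<integral>x. f x * cos (t * X x + r) \<partial>M) = (\<integral>x. f x * cos (t * X x + r) \<partial>N)"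
    and g[measurable]: "A \<in> sets borel"
  shows "(\<integral>x. f x * indicator A (X x) \<partial>M) = (\<integral>x. f x * indicator A (X x) \<partial>N)"
proof -
  have [measurable_cong]: "sets N = sets M" using sets by simp
  have [measurable]: "X \<in> borel_measurable N" "f \<in> borel_measurable N"
    by measurable
  interpret M: finite_measure M by fact
  interpret N: finite_measure N by fact
  define m where "m = (\<integral>x. f x \<partial>M)"
  have mN: "m = (\<integral>x. f x \<partial>N)" using eq[of 0 0] by (simp add: m_def)
  have iM: "integrable M f"
    by (rule M.integrable_const_bound[where B = B]) (use f0 fB in auto)
  have iN: "integrable N f"
    by (rule N.integrable_const_bound[where B = B]) (use f0 fB in auto)
  show ?thesis
  proof (cases "m = 0")
    case True
    then have "AE x in M. f x = 0" "AE x in N. f x = 0"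
      using integral_nonneg_eq_0_iff_AE[OF iM] integral_nonneg_eq_0_iff_AE[OF iN] f0 mN
      by (auto simp: m_def)
    then have "(\<integral>x. f x * indicator A (X x) \<partial>M) = 0" "(\<integral>x. f x * indicator A (X x) \<partial>N) = 0"
      by (auto intro!: integral_eq_zero_AE)
    then show ?thesis by simp
  next
    case False
    then have m: "m > 0" using f0 by (simp add: m_def less_le)
    define P where "P L = distr (density L (\<lambda>x. f x / m)) borel X" for L :: "'a measure"
    have integral_P: "(\<integral>y. h y \<partial>P L) = (\<integral>x. f x * h (X x) \<partial>L) / m"
      if [measurable_cong]: "sets L = sets M" and [measurable]: "h \<in> borel_measurable borel"
      for L and h :: "real \<Rightarrow> real"
      unfolding P_def using f0 m
      by (subst integral_distr, measurable, subst integral_density)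
         (auto simp: field_simps simp flip: integral_divide_zero)
    have dist: "real_distribution (P L)"
      if s[measurable_cong]: "sets L = sets M" and "integrable L f" "(\<integral>x. f x \<partial>L) = m" for L
    proof -
      have "emeasure (density L (\<lambda>x. f x / m)) (space L) = (\<integral>\<^sup>+x. ennreal (f x / m) \<partial>L)"
        by (subst emeasure_density) (auto intro!: nn_integral_cong)
      also have "\<dots> = 1"
        using that m f0 by (subst nn_integral_eq_integral) auto
      finally have "prob_space (density L (\<lambda>x. f x / m))"
        by (auto intro: prob_spaceI)
      then have "prob_space (P L)"
        unfolding P_def by (rule prob_space.prob_space_distr) measurable
      then show ?thesis
        by (simp add: real_distribution_def real_distribution_axioms_def P_def)
    qed
    have dM: "real_distribution (P M)" and dN: "real_distribution (P N)"
      using dist[OF refl iM] dist[OF sets[symmetric] iN] m_def mN by auto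
    have "char (P M) = char (P N)"
    proof
      fix t
      have "(\<integral>y. cos (t * y + r) \<partial>P M) = (\<integral>y. cos (t * y + r) \<partial>P N)" for r
        using eq[of t r] integral_P[OF refl, of "\<lambda>y. cos (t * y + r)"]
          integral_P[OF sets[symmetric], of "\<lambda>y. cos (t * y + r)"] by simp
      then show "char (P M) t = char (P N) t"
        using char_eq_of_cos[OF dM] char_eq_of_cos[OF dN] by metis
    qed
    then have "P M = P N" using Levy_uniqueness dM dN by blast
    then have "(\<integral>y. indicator A y \<partial>P M) = (\<integral>y. indicator A y \<partial>P N :: real)" by simp
    then show ?thesis
      using m integral_P[OF refl, of "indicator A"] integral_P[OF sets[symmetric], of "indicator A"]
      by simp
  qed
qed

definition halfspaces_Int :: "('a::real_inner \<times> real) list \<Rightarrow> 'a set" where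
  "halfspaces_Int l = {x. \<forall>(h, t)\<in>set l. h \<bullet> x \<le> t}"

lemma closed_halfspaces_Int: "closed (halfspaces_Int l)"
proof -
  have "halfspaces_Int l = (\<Inter>(h, t)\<in>set l. {x. h \<bullet> x \<le> t})"
    by (auto simp: halfspaces_Int_def)
  then show ?thesis by (auto intro!: closed_INT closed_halfspace_le)
qed

lemma halfspaces_Int_append: "halfspaces_Int l \<inter> halfspaces_Int l' = halfspaces_Int (l @ l')"
  by (auto simp: halfspaces_Int_def)

text \<open>A closed ball is cut out by the half-spaces normal to the vectors of a countable dense set,
  and an open set is a countable union of closed balls.\<close>

lemma borel_eq_sigma_halfspaces:
  "sets (borel :: 'a::{real_inner, second_countable_topology} measure)
     = sigma_sets UNIV (range halfspaces_Int)"
proof (rule antisym)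
  let ?\<Sigma> = "sigma_sets UNIV (range (halfspaces_Int :: _ \<Rightarrow> 'a set))"
  interpret S: sigma_algebra UNIV ?\<Sigma> by (rule sigma_algebra_sigma_sets) simp
  show "?\<Sigma> \<subseteq> sets borel"
    using closed_halfspaces_Int by (intro sets.sigma_sets_subset') (auto intro: borel_closed)
  obtain D :: "'a set" where D: "countable D" "\<And>X. open X \<Longrightarrow> X \<noteq> {} \<Longrightarrow> \<exists>d\<in>D. d \<in> X"
    using countable_dense_exists by blast
  have half: "{x. h \<bullet> x \<le> t} \<in> ?\<Sigma>" for h :: 'a and t
  proof -
    have "{x. h \<bullet> x \<le> t} = halfspaces_Int [(h, t)]" by (simp add: halfspaces_Int_def)
    then show ?thesis by (simp add: sigma_sets.Basic)
  qed
  have norm_le: "norm y \<le> r" if r: "0 \<le> r" and "\<And>d. d \<in> D \<Longrightarrow> d \<bullet> y \<le> r * norm d" for y :: 'a and r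
  proof (rule ccontr)
    assume "\<not> norm y \<le> r"
    then have "y \<in> {d. r * norm d < d \<bullet> y}"
      using r by (auto simp: dot_square_norm power2_eq_square intro!: mult_strict_right_mono)
    moreover have "open {d. r * norm d < d \<bullet> y}"
      by (intro open_Collect_less continuous_intros)
    ultimately show False using D(2)[of "{d. r * norm d < d \<bullet> y}"] that(2) by force
  qed
  have cball: "cball a r \<in> ?\<Sigma>" if r: "0 \<le> r" for a :: 'a and r
  proof -
    have "cball a r = (\<Inter>d\<in>D. {x. d \<bullet> x \<le> r * norm d + d \<bullet> a})" (is "_ = ?R")
    proof (intro set_eqI iffI)
      fix x assume "x \<in> cball a r"
      then have "norm (x - a) \<le> r" by (simp add: dist_norm norm_minus_commute)
      then have "d \<bullet> (x - a) \<le> norm d * r" for d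
        by (meson mult_left_mono norm_cauchy_schwarz norm_ge_zero order_trans)
      then show "x \<in> ?R" by (simp add: inner_diff_right algebra_simps)
    next
      fix x assume "x \<in> ?R"
      then have "norm (x - a) \<le> r"
        by (intro norm_le r) (auto simp: inner_diff_right algebra_simps)
      then show "x \<in> cball a r" by (simp add: dist_norm norm_minus_commute)
    qed
    moreover have "D \<noteq> {}" using D(2)[of UNIV] by auto
    ultimately show ?thesis using D(1) half by (auto intro!: S.countable_INT'')
  qed
  have "open U \<Longrightarrow> U \<in> ?\<Sigma>" for U :: "'a set"
  proof -
    assume U: "open U"
    define I where "I = {(d, q) \<in> D \<times> \<rat>. 0 \<le> q \<and> cball d q \<subseteq> U}"
    have "U = (\<Union>(d, q)\<in>I. cball d q)"
    proof (intro set_eqI iffI)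
      fix x assume "x \<in> U"
      then obtain e where e: "e > 0" "ball x e \<subseteq> U" using U open_contains_ball by blast
      obtain q where q: "q \<in> \<rat>" "0 < q" "q < e / 2"
        using Rats_dense_in_real[of 0 "e / 2"] e by auto
      obtain d where d: "d \<in> D" "d \<in> ball x q"
        using D(2)[of "ball x q"] q by auto
      have "cball d q \<subseteq> ball x e"
      proof
        fix y assume "y \<in> cball d q"
        then show "y \<in> ball x e"
          using d q dist_triangle[of x y d] by (auto simp: dist_commute)
      qed
      then have "(d, q) \<in> I" "x \<in> cball d q"
        using d q e by (auto simp: I_def dist_commute)
      then show "x \<in> (\<Union>(d, q)\<in>I. cball d q)" by blast
    qed (auto simp: I_def)
    moreover have "countable I"
      using countable_subset[of I "D \<times> \<rat>"] D(1) countable_rat by (auto simp: I_def)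
    then have "(\<Union>(d, q)\<in>I. cball d q) \<in> ?\<Sigma>"
      using cball by (intro S.countable_UN'') (auto simp: I_def)
    ultimately show "U \<in> ?\<Sigma>" by simp
  qed
  then show "sets borel \<subseteq> ?\<Sigma>"
    unfolding borel_def by (subst sets_measure_of) (auto intro!: S.sigma_sets_subset)
qed

text \<open>The sets \<open>halfspaces_Int l\<close> form a generating \<open>\<pi>\<close>-system. Their measures are compared by
  induction on \<open>l\<close>, one half-space at a time. What is carried along is the equality of all integrals of
  \<open>cos (k \<bullet> x + s)\<close> over the set. The next half-space is handled by projecting the positive weight
  \<open>indicator E x * (1 + cos (k \<bullet> x + s))\<close> on its normal: the product formula for cosines reduces the
  characteristic function of this projection to integrals that are known to agree.\<close>

theorem Cramer_Wold:
  fixes M N :: "'a::{real_inner, second_countable_topology} measure"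
  assumes fin: "prob_space M" "prob_space N"
    and sM[measurable_cong]: "sets M = sets borel" and sN[measurable_cong]: "sets N = sets borel"
    and proj: "\<And>h. distr M borel (\<lambda>x. h \<bullet> x) = distr N borel (\<lambda>x. h \<bullet> x)"
  shows "M = N"
proof -
  interpret M: prob_space M by fact
  interpret N: prob_space N by fact
  have [measurable]: "halfspaces_Int l \<in> sets borel" for l :: "('a \<times> real) list"
    by (rule borel_closed[OF closed_halfspaces_Int])
  have cos_eq: "(\<integral>x. indicator (halfspaces_Int l) x * cos (k \<bullet> x + s) \<partial>M)
      = (\<integral>x. indicator (halfspaces_Int l) x * cos (k \<bullet> x + s) \<partial>N)" for l :: "('a \<times> real) list" and k s
  proof (induction l arbitrary: k s)
    case Nil
    have "(\<integral>x. cos (k \<bullet> x + s) \<partial>M) = (\<integral>y. cos (y + s) \<partial>distr M borel (\<lambda>x. k \<bullet> x))"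
      by (subst integral_distr) auto
    also have "\<dots> = (\<integral>x. cos (k \<bullet> x + s) \<partial>N)"
      unfolding proj by (subst integral_distr) auto
    finally show ?case by (simp add: halfspaces_Int_def)
  next
    case (Cons a l)
    obtain h t where a: "a = (h, t)" by (cases a)
    let ?E = "halfspaces_Int l"
    have int: "integrable L (\<lambda>x. indicator ?E x * cos (k \<bullet> x + s))"
      if "L \<in> {M, N}" for L k s
    proof -
      have [measurable_cong]: "sets L = sets borel" and L: "finite_measure L"
        using that sM sN M.finite_measure_axioms N.finite_measure_axioms by auto
      show ?thesis
        by (rule finite_measure.integrable_const_bound[OF L, where B = 1])
           (auto simp: indicator_def)
    qed
    define f where "f = (\<lambda>k s x. indicator ?E x * (1 + cos (k \<bullet> x + s)))"
    have [measurable]: "f k s \<in> borel_measurable borel" for k s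
      unfolding f_def by measurable
    have step: "(\<integral>x. f k s x * indicator {..t} (h \<bullet> x) \<partial>M)
        = (\<integral>x. f k s x * indicator {..t} (h \<bullet> x) \<partial>N)" for k s
    proof (rule weighted_projection_eqI[where B = 2])
      fix u r
      have "f k s x * cos (u * (h \<bullet> x) + r)
          = indicator ?E x * cos ((u *\<^sub>R h) \<bullet> x + r)
            + (indicator ?E x * cos ((k + u *\<^sub>R h) \<bullet> x + (s + r))
            + indicator ?E x * cos ((k - u *\<^sub>R h) \<bullet> x + (s - r))) / 2" for x
      proof -
        have "(k + u *\<^sub>R h) \<bullet> x + (s + r) = (k \<bullet> x + s) + (u * (h \<bullet> x) + r)"
          "(k - u *\<^sub>R h) \<bullet> x + (s - r) = (k \<bullet> x + s) - (u * (h \<bullet> x) + r)"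
          by (auto simp: inner_add_left inner_diff_left)
        then have "cos (k \<bullet> x + s) * cos (u * (h \<bullet> x) + r)
            = (cos ((k + u *\<^sub>R h) \<bullet> x + (s + r)) + cos ((k - u *\<^sub>R h) \<bullet> x + (s - r))) / 2"
          by (simp only: cos_times_cos add.commute)
        then show ?thesis
          by (simp only: f_def inner_scaleR_left ring_distribs mult_1 mult.assoc)
             (simp add: algebra_simps add_divide_distrib)
      qed
      then have "(\<integral>x. f k s x * cos (u * (h \<bullet> x) + r) \<partial>L)
          = (\<integral>x. indicator ?E x * cos ((u *\<^sub>R h) \<bullet> x + r) \<partial>L)
            + ((\<integral>x. indicator ?E x * cos ((k + u *\<^sub>R h) \<bullet> x + (s + r)) \<partial>L)
            + (\<integral>x. indicator ?E x * cos ((k - u *\<^sub>R h) \<bullet> x + (s - r)) \<partial>L)) / 2"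
        if "L \<in> {M, N}" for L
        using int[OF that] by (simp only: Bochner_Integration.integral_add
            integral_divide_zero integrable_divide Bochner_Integration.integrable_add int[OF that])
      then show "(\<integral>x. f k s x * cos (u * (h \<bullet> x) + r) \<partial>M) = (\<integral>x. f k s x * cos (u * (h \<bullet> x) + r) \<partial>N)"
        using Cons.IH[of "u *\<^sub>R h" r] Cons.IH by simp
    next
      fix x
      have "1 + cos (k \<bullet> x + s) \<ge> 0" using cos_ge_minus_one[of "k \<bullet> x + s"] by linarith
      then show "0 \<le> f k s x" by (simp add: f_def)
      show "f k s x \<le> 2" by (auto simp: f_def indicator_def)
    qed (use sM sN in \<open>auto intro: M.finite_measure_axioms N.finite_measure_axioms\<close>)
    \<comment> \<open>The phase \<open>pi / 2\<close> at frequency \<open>0\<close> makes the cosine vanish, so \<open>f 0 (pi / 2)\<close> is the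
      indicator of \<open>E\<close>.\<close>
    have split: "indicator (halfspaces_Int (a # l)) x * cos (k \<bullet> x + s)
        = f k s x * indicator {..t} (h \<bullet> x) - f 0 (pi / 2) x * indicator {..t} (h \<bullet> x)" for x
      by (auto simp: f_def a halfspaces_Int_def indicator_def)
    have intf: "integrable L (\<lambda>x. f k s x * indicator {..t} (h \<bullet> x))" if "L \<in> {M, N}" for L k s
    proof -
      have [measurable_cong]: "sets L = sets borel" and L: "finite_measure L"
        using that sM sN M.finite_measure_axioms N.finite_measure_axioms by auto
      have "\<bar>1 + cos (k \<bullet> x + s)\<bar> \<le> 2" for x
        using cos_ge_minus_one[of "k \<bullet> x + s"] cos_le_one[of "k \<bullet> x + s"] by linarith
      then show ?thesis
        by (intro finite_measure.integrable_const_bound[OF L, where B = 2])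
           (auto simp: f_def indicator_def)
    qed
    show ?case
      unfolding split using step by (simp add: intf)
  qed
  have "emeasure M (halfspaces_Int l) = emeasure N (halfspaces_Int l)" for l
    using cos_eq[of l 0 0] by (simp add: M.emeasure_eq_measure N.emeasure_eq_measure)
  moreover have "Int_stable (range (halfspaces_Int :: _ \<Rightarrow> 'a set))"
    by (auto intro!: Int_stableI simp: halfspaces_Int_append)
  moreover have "halfspaces_Int [] = (UNIV :: 'a set)"
    by (simp add: halfspaces_Int_def)
  ultimately show ?thesis
    by (intro measure_eqI_generator_eq[where \<Omega> = UNIV and E = "range halfspaces_Int"
          and A = "\<lambda>_. halfspaces_Int []"])
       (auto simp: sM sN borel_eq_sigma_halfspaces)
qed

section \<open>Gaussian measures\<close>

lemma normal_law_affine: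
  assumes "0 < s" "0 \<le> v"
  shows "distr (normal_law m v) borel (\<lambda>y. c + s * y) = normal_law (c + s * m) (s\<^sup>2 * v)"
proof (cases "v = 0")
  case True
  then show ?thesis by (simp add: normal_law_def distr_return)
next
  case False
  with assms have v: "0 < v" by simp
  interpret prob_space "density lborel (normal_density m (sqrt v))"
    using v by (intro prob_space_normal_density) simp
  have "distributed (density lborel (normal_density m (sqrt v))) lborel (\<lambda>y. y) (normal_density m (sqrt v))"
    by (simp add: distributed_def distr_id2)
  from distributed_distr_eq_density[OF normal_density_affine[OF this, of s c]]
  have "distr (density lborel (normal_density m (sqrt v))) lborel (\<lambda>y. c + s * y)
      = density lborel (normal_density (c + s * m) (s * sqrt v))"
    using assms v by simp
  then show ?thesis
    using assms v by (simp add: normal_law_def real_sqrt_mult cong: distr_cong)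
qed

lemma gaussian_measure_affine:
  fixes M :: "'a::{real_inner, banach, second_countable_topology} measure"
  assumes "covariance_operator C" "gaussian_measure 0 C M" "0 < s"
  shows "gaussian_measure m (\<lambda>h. s\<^sup>2 *\<^sub>R C h) (distr M borel (\<lambda>x. m + s *\<^sub>R x))"
  unfolding gaussian_measure_def
proof (intro conjI allI)
  from assms(2) interpret prob_space M by (simp add: gaussian_measure_def)
  have [measurable_cong]: "sets M = sets borel"
    and law: "\<And>h. distr M borel (\<lambda>x. h \<bullet> x) = normal_law 0 (C h \<bullet> h)"
    using assms(2) by (auto simp: gaussian_measure_def)
  show "prob_space (distr M borel (\<lambda>x. m + s *\<^sub>R x))"
    by (rule prob_space_distr) measurable
  fix h
  have "0 \<le> C h \<bullet> h"
    using assms(1) by (cases "h = 0") (auto simp: covariance_operator_def less_imp_le)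
  have "distr (distr M borel (\<lambda>x. m + s *\<^sub>R x)) borel ((\<bullet>) h)
      = distr (distr M borel (\<lambda>x. h \<bullet> x)) borel (\<lambda>y. h \<bullet> m + s * y)"
    by (simp add: distr_distr comp_def inner_add_right)
  also have "\<dots> = normal_law (h \<bullet> m) (s\<^sup>2 * (C h \<bullet> h))"
    unfolding law using \<open>0 < s\<close> \<open>0 \<le> C h \<bullet> h\<close> by (simp add: normal_law_affine)
  finally show "distr (distr M borel (\<lambda>x. m + s *\<^sub>R x)) borel ((\<bullet>) h)
      = normal_law (h \<bullet> m) ((s\<^sup>2 *\<^sub>R C h) \<bullet> h)" by simp
qed simp

lemma gaussian_measure_unique:
  "gaussian_measure m C M \<Longrightarrow> gaussian_measure m C N \<Longrightarrow> M = N"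
  by (rule Cramer_Wold) (auto simp: gaussian_measure_def)

text \<open>The balls of radius one half around the basis vectors are disjoint, as their centres are at
  distance \<open>sqrt 2\<close>.\<close>

lemma orthonormal_basis_countable:
  fixes B :: "'a::{real_inner, second_countable_topology} set"
  assumes "orthonormal_basis B"
  shows "countable B"
proof -
  have disj: "ball d (1/2) \<inter> ball e (1/2) = {}" if "d \<in> B" "e \<in> B" "d \<noteq> e" for d e
  proof -
    have "d \<bullet> e = 0" "norm d = 1" "norm e = 1"
      using assms that by (auto simp: orthonormal_basis_def pairwise_def orthogonal_def)
    then have "(dist d e)\<^sup>2 = 2"
      using dot_norm_neg[of d e] by (simp add: dist_norm)
    then have "1 \<le> dist d e"
      using power2_le_imp_le[of 1 "dist d e"] by simp
    then show ?thesis by (intro disjoint_ballI) simp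
  qed
  have "inj_on (\<lambda>e. ball e (1/2)) B"
    using disj by (intro inj_onI) (metis centre_in_ball disjoint_iff half_gt_zero zero_less_one)
  moreover have "countable ((\<lambda>e. ball e (1/2)) ` B)"
    using disj by (intro countable_disjoint_open_subsets) (auto simp: pairwise_def disjnt_def)
  ultimately show ?thesis by (rule countable_image_inj_on[rotated])
qed

lemma norm_diff_orthonormal_sum:
  assumes "finite F" "pairwise orthogonal F" "\<And>e. e \<in> F \<Longrightarrow> norm e = 1"
  shows "(norm (x - (\<Sum>e\<in>F. r e *\<^sub>R e)))\<^sup>2
    = (norm x)\<^sup>2 - (\<Sum>e\<in>F. (e \<bullet> x)\<^sup>2) + (\<Sum>e\<in>F. (r e - e \<bullet> x)\<^sup>2)"
proof -
  have "(norm (\<Sum>e\<in>F. r e *\<^sub>R e))\<^sup>2 = (\<Sum>e\<in>F. (norm (r e *\<^sub>R e))\<^sup>2)"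
    using assms by (intro norm_sum_Pythagorean) (auto simp: pairwise_def orthogonal_def)
  also have "\<dots> = (\<Sum>e\<in>F. (r e)\<^sup>2)"
    using assms by (intro sum.cong) (auto simp: power_mult_distrib)
  finally have "(norm (x - (\<Sum>e\<in>F. r e *\<^sub>R e)))\<^sup>2
      = (norm x)\<^sup>2 - 2 * (\<Sum>e\<in>F. r e * (e \<bullet> x)) + (\<Sum>e\<in>F. (r e)\<^sup>2)"
    using dot_norm_neg[of x "\<Sum>e\<in>F. r e *\<^sub>R e"]
    by (simp add: inner_sum_right inner_commute[of x])
  then show ?thesis
    by (simp add: power2_diff sum.distrib sum_subtractf sum_distrib_left mult.assoc)
qed

text \<open>The orthogonal projection onto the span of \<open>F n\<close> is at least as close to \<open>x\<close> as any other
  point of that span, and the spans exhaust a dense subspace.\<close>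

lemma orthonormal_basis_Parseval:
  assumes B: "orthonormal_basis B" and F: "\<And>n. finite (F n)" "incseq F" "(\<Union>n. F n) = B"
  shows "(\<lambda>n. \<Sum>e\<in>F n. (e \<bullet> x)\<^sup>2) \<longlonglongrightarrow> (norm x)\<^sup>2"
proof (rule LIMSEQ_I)
  fix d :: real assume "0 < d"
  have FB: "F n \<subseteq> B" for n using F by auto
  have id: "(norm (x - (\<Sum>e\<in>F n. r e *\<^sub>R e)))\<^sup>2
    = (norm x)\<^sup>2 - (\<Sum>e\<in>F n. (e \<bullet> x)\<^sup>2) + (\<Sum>e\<in>F n. (r e - e \<bullet> x)\<^sup>2)" for r n
    using B FB F(1)
    by (intro norm_diff_orthonormal_sum) (auto simp: orthonormal_basis_def intro: pairwise_subset)
  have "x \<in> closure (span B)" using B by (simp add: orthonormal_basis_def)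
  then obtain y where y: "y \<in> span B" "dist y x < sqrt d"
    using \<open>0 < d\<close> by (meson closure_approachable real_sqrt_gt_zero)
  from y(1) obtain t r where t: "finite t" "t \<subseteq> B" "y = (\<Sum>a\<in>t. r a *\<^sub>R a)"
    unfolding span_explicit by blast
  have "\<exists>n. t \<subseteq> F n"
    using t(1,2)
  proof induction
    case (insert a t)
    then obtain n m where "t \<subseteq> F n" "a \<in> F m" using F(3) by auto
    moreover have "F n \<subseteq> F (max n m)" "F m \<subseteq> F (max n m)"
      using incseqD[OF F(2)] by auto
    ultimately show ?case by blast
  qed simp
  then obtain N where N: "t \<subseteq> F N" by blast
  have "norm ((\<Sum>e\<in>F n. (e \<bullet> x)\<^sup>2) - (norm x)\<^sup>2) < d" if "n \<ge> N" for n
  proof -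
    have tn: "t \<subseteq> F n" using N that F(2) by (meson incseqD order_trans)
    let ?r = "\<lambda>a. if a \<in> t then r a else 0"
    have "y = (\<Sum>e\<in>F n. ?r e *\<^sub>R e)"
      unfolding t(3) using tn F(1) by (intro sum.mono_neutral_cong_left) auto
    then have "(norm (x - y))\<^sup>2 \<ge> (norm x)\<^sup>2 - (\<Sum>e\<in>F n. (e \<bullet> x)\<^sup>2)"
      using id[where r = ?r and n = n] by (simp add: sum_nonneg)
    moreover have "(norm (x - y))\<^sup>2 < d"
      using power_strict_mono[of "norm (x - y)" "sqrt d" 2] y(2) \<open>0 < d\<close>
      by (simp add: dist_norm norm_minus_commute)
    moreover have "(\<Sum>e\<in>F n. (e \<bullet> x)\<^sup>2) \<le> (norm x)\<^sup>2"
      using id[where r = "\<lambda>e. e \<bullet> x" and n = n]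
        zero_le_power2[of "norm (x - (\<Sum>e\<in>F n. (e \<bullet> x) *\<^sub>R e))"] by simp
    ultimately show ?thesis by simp
  qed
  then show "\<exists>no. \<forall>n\<ge>no. norm ((\<Sum>e\<in>F n. (e \<bullet> x)\<^sup>2) - (norm x)\<^sup>2) < d" by blast
qed

text \<open>Jensen's inequality for weights of total mass at most one, the missing mass being placed at \<open>0\<close>:
  the tangent of \<open>exp\<close> at the mean lies below \<open>exp\<close>.\<close>

lemma exp_sum_le_subconvex:
  fixes w y :: "'i \<Rightarrow> real"
  assumes "\<And>i. i \<in> F \<Longrightarrow> 0 \<le> w i" "sum w F \<le> 1"
  shows "exp (\<Sum>i\<in>F. w i * y i) \<le> (\<Sum>i\<in>F. w i * exp (y i)) + 1"
proof -
  define m where "m = (\<Sum>i\<in>F. w i * y i)"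
  have "exp m * (1 + y i - m) \<le> exp (y i)" for i
    using exp_ge_add_one_self[of "y i - m"] by (simp add: exp_diff field_simps)
  then have "(\<Sum>i\<in>F. w i * (exp m * (1 + y i - m))) \<le> (\<Sum>i\<in>F. w i * exp (y i))"
    using assms by (intro sum_mono mult_left_mono) auto
  moreover have "(\<Sum>i\<in>F. w i * (exp m * (1 + y i - m))) = exp m * (sum w F * (1 - m) + m)"
  proof -
    have "(\<Sum>i\<in>F. w i * (exp m * (1 + y i - m))) = (\<Sum>i\<in>F. exp m * (1 - m) * w i + exp m * (w i * y i))"
      by (simp add: algebra_simps)
    also have "\<dots> = exp m * (1 - m) * sum w F + exp m * m"
      unfolding m_def sum.distrib sum_distrib_left ..
    finally show ?thesis by (simp add: algebra_simps)
  qed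
  moreover have "exp m * (1 - m) \<le> 1"
    using exp_ge_add_one_self[of "- m"] by (simp add: exp_minus field_simps)
  then have "(1 - sum w F) * (exp m * (1 - m)) \<le> (1 - sum w F) * 1"
    using assms by (intro mult_left_mono) auto
  ultimately show ?thesis
    using sum_nonneg[of F w] assms(1) by (simp add: algebra_simps m_def[symmetric])
qed

lemma nn_integral_exp_square_normal_law:
  assumes v: "0 < v"
  shows "(\<integral>\<^sup>+y. ennreal (exp (y\<^sup>2 / (4 * v))) \<partial>normal_law 0 v) = ennreal (sqrt 2)"
proof -
  have eq: "normal_density 0 (sqrt v) y * exp (y\<^sup>2 / (4 * v)) = sqrt 2 * normal_density 0 (sqrt (2 * v)) y" for y
  proof -
    have "- y\<^sup>2 / (2 * v) + y\<^sup>2 / (4 * v) = - y\<^sup>2 / (4 * v)"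
      using v by (simp add: field_simps)
    then have "exp (- y\<^sup>2 / (2 * v)) * exp (y\<^sup>2 / (4 * v)) = exp (- y\<^sup>2 / (4 * v))"
      by (simp flip: exp_add)
    then show ?thesis
      using v by (simp add: normal_density_def real_sqrt_mult field_simps)
  qed
  have "(\<integral>\<^sup>+y. ennreal (exp (y\<^sup>2 / (4 * v))) \<partial>normal_law 0 v)
      = (\<integral>\<^sup>+y. ennreal (sqrt 2 * normal_density 0 (sqrt (2 * v)) y) \<partial>lborel)"
    using v by (simp add: normal_law_def nn_integral_density flip: ennreal_mult' eq)
  also have "\<dots> = ennreal (sqrt 2) * (\<integral>\<^sup>+y. ennreal (normal_density 0 (sqrt (2 * v)) y) \<partial>lborel)"
    by (subst nn_integral_cmult[symmetric]) (auto simp: ennreal_mult)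
  also have "(\<integral>\<^sup>+y. ennreal (normal_density 0 (sqrt (2 * v)) y) \<partial>lborel) = 1"
    using prob_space.emeasure_space_1[OF prob_space_normal_density[of "sqrt (2 * v)" 0]] v
    by (simp add: emeasure_density)
  finally show ?thesis by simp
qed

text \<open>A form of Fernique's theorem with an elementary proof that uses the trace-class property. The
  coordinates \<open>e \<bullet> x\<close> are in general dependent, but \<open>b |x|\<^sup>2\<close> is a subconvex combination, with
  weights proportional to the variances \<open>c e\<close>, of the variables \<open>(e \<bullet> x)\<^sup>2 / (4 c e)\<close>. Their
  exponentials all have the mean \<open>sqrt 2\<close>, so that Jensen's inequality bounds the exponential
  moment of every finite partial sum by the same constant.\<close>

theorem gaussian_exp_moment:
  fixes M :: "'a::{real_inner, banach, second_countable_topology} measure"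
  assumes C: "covariance_operator C" and M: "gaussian_measure 0 C M"
  obtains b where "0 < b" "(\<integral>\<^sup>+x. ennreal (exp (b * (norm x)\<^sup>2)) \<partial>M) < \<infinity>"
proof -
  from M interpret prob_space M by (simp add: gaussian_measure_def)
  have [measurable_cong]: "sets M = sets borel"
    and law: "\<And>h. distr M borel (\<lambda>x. h \<bullet> x) = normal_law 0 (C h \<bullet> h)"
    using M by (auto simp: gaussian_measure_def)
  obtain B where B: "orthonormal_basis B" and summ: "(\<lambda>e. C e \<bullet> e) summable_on B"
    using C by (auto simp: covariance_operator_def)
  define c where "c = (\<lambda>e. C e \<bullet> e)"
  have c: "0 < c e" if "e \<in> B" for e
  proof -
    have "e \<noteq> 0" using that B by (auto simp: orthonormal_basis_def)
    then show ?thesis using C by (auto simp: covariance_operator_def c_def)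
  qed
  define T where "T = 1 + infsum c B"
  have "0 \<le> infsum c B"
    by (rule infsum_nonneg) (use c in force)
  then have T1: "T \<ge> 1" by (simp add: T_def)
  have sum_c: "sum c F \<le> T" if "finite F" "F \<subseteq> B" for F
    using finite_sum_le_infsum[of c B F] that summ c by (auto simp: T_def c_def less_imp_le)
  define b where "b = 1 / (4 * T)"
  define F where "F = (\<lambda>n. {e \<in> B. to_nat_on B e \<le> n})"
  have cnt: "countable B" by (rule orthonormal_basis_countable[OF B])
  have F: "finite (F n)" "F n \<subseteq> B" for n
  proof -
    have "inj_on (to_nat_on B) (F n)" "to_nat_on B ` F n \<subseteq> {..n}"
      using inj_on_to_nat_on[OF cnt] by (auto simp: F_def inj_on_def)
    then show "finite (F n)" by (meson finite_atMost inj_on_finite)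
  qed (auto simp: F_def)
  have lim: "(\<lambda>n. \<Sum>e\<in>F n. (e \<bullet> x)\<^sup>2) \<longlonglongrightarrow> (norm x)\<^sup>2" for x
    by (rule orthonormal_basis_Parseval[OF B]) (auto simp: F incseq_def, auto simp: F_def)
  have exp_moment: "(\<integral>\<^sup>+x. ennreal (exp ((e \<bullet> x)\<^sup>2 / (4 * c e))) \<partial>M) = ennreal (sqrt 2)"
    if "e \<in> B" for e
  proof -
    have "(\<integral>\<^sup>+x. ennreal (exp ((e \<bullet> x)\<^sup>2 / (4 * c e))) \<partial>M)
        = (\<integral>\<^sup>+y. ennreal (exp (y\<^sup>2 / (4 * c e))) \<partial>distr M borel (\<lambda>x. e \<bullet> x))"
      by (subst nn_integral_distr) auto
    then show ?thesis
      unfolding law c_def[symmetric] using nn_integral_exp_square_normal_law[OF c[OF that]]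
      by (simp add: c_def)
  qed
  have partial: "(\<integral>\<^sup>+x. ennreal (exp (b * (\<Sum>e\<in>F n. (e \<bullet> x)\<^sup>2))) \<partial>M) \<le> ennreal (sqrt 2 + 1)" for n
  proof -
    let ?w = "\<lambda>e. c e / T"
    have w0: "0 \<le> ?w e" if "e \<in> F n" for e
      using c[of e] F(2) that T1 by (auto intro!: divide_nonneg_nonneg simp: less_imp_le subset_iff)
    have w1: "sum ?w (F n) \<le> 1"
      using sum_c[OF F] T1 by (simp flip: sum_divide_distrib)
    have "exp (b * (\<Sum>e\<in>F n. (e \<bullet> x)\<^sup>2)) \<le> (\<Sum>e\<in>F n. ?w e * exp ((e \<bullet> x)\<^sup>2 / (4 * c e))) + 1" for x
    proof -
      have "b * (\<Sum>e\<in>F n. (e \<bullet> x)\<^sup>2) = (\<Sum>e\<in>F n. ?w e * ((e \<bullet> x)\<^sup>2 / (4 * c e)))"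
        unfolding sum_distrib_left
      proof (rule sum.cong)
        fix e assume "e \<in> F n"
        then have "c e \<noteq> 0" using c F(2) by (metis less_irrefl subsetD)
        then show "b * (e \<bullet> x)\<^sup>2 = ?w e * ((e \<bullet> x)\<^sup>2 / (4 * c e))"
          by (simp add: b_def field_simps)
      qed simp
      then show ?thesis
        using exp_sum_le_subconvex[of "F n" ?w "\<lambda>e. (e \<bullet> x)\<^sup>2 / (4 * c e)"] w0 w1
        by (simp only:)
    qed
    moreover
    have ens: "(\<Sum>e\<in>F n. ennreal (?w e) * ennreal (g e)) + 1 = ennreal ((\<Sum>e\<in>F n. ?w e * g e) + 1)"
      if "\<And>e. 0 \<le> g e" for g :: "'a \<Rightarrow> real"
    proof -
      have "(\<Sum>e\<in>F n. ennreal (?w e) * ennreal (g e)) = (\<Sum>e\<in>F n. ennreal (?w e * g e))"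
        by (intro sum.cong refl ennreal_mult[symmetric] w0 that)
      also have "\<dots> = ennreal (\<Sum>e\<in>F n. ?w e * g e)"
        by (intro sum_ennreal mult_nonneg_nonneg w0 that)
      finally show ?thesis
        by (simp only: ennreal_plus[OF sum_nonneg[OF mult_nonneg_nonneg[OF w0 that]] zero_le_one] ennreal_1)
    qed
    ultimately have "(\<integral>\<^sup>+x. ennreal (exp (b * (\<Sum>e\<in>F n. (e \<bullet> x)\<^sup>2))) \<partial>M)
        \<le> (\<integral>\<^sup>+x. (\<Sum>e\<in>F n. ennreal (?w e) * ennreal (exp ((e \<bullet> x)\<^sup>2 / (4 * c e)))) + 1 \<partial>M)"
      by (intro nn_integral_mono) (simp only: ens exp_ge_zero ennreal_leI)
    also have "\<dots> = (\<Sum>e\<in>F n. ennreal (?w e) * ennreal (sqrt 2)) + 1"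
      using exp_moment F
      by (subst nn_integral_add) (auto simp: nn_integral_sum nn_integral_cmult emeasure_space_1 subset_iff)
    also have "\<dots> = ennreal (sum ?w (F n) * sqrt 2 + 1)"
      using ens[of "\<lambda>_. sqrt 2"] by (simp add: sum_distrib_right)
    also have "\<dots> \<le> ennreal (sqrt 2 + 1)"
      using w1 mult_right_mono[OF w1, of "sqrt 2"] by (intro ennreal_leI) simp
    finally show ?thesis .
  qed
  have "(\<integral>\<^sup>+x. ennreal (exp (b * (norm x)\<^sup>2)) \<partial>M)
      = (\<integral>\<^sup>+x. liminf (\<lambda>n. ennreal (exp (b * (\<Sum>e\<in>F n. (e \<bullet> x)\<^sup>2)))) \<partial>M)"
    by (intro nn_integral_cong lim_imp_Liminf[symmetric] tendsto_intros lim) auto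
  also have "\<dots> \<le> liminf (\<lambda>n. \<integral>\<^sup>+x. ennreal (exp (b * (\<Sum>e\<in>F n. (e \<bullet> x)\<^sup>2))) \<partial>M)"
    by (rule nn_integral_liminf) measurable
  also have "\<dots> \<le> ennreal (sqrt 2 + 1)"
    by (rule Liminf_le) (use partial in auto)
  also have "\<dots> < \<infinity>" by simp
  finally show ?thesis
    using T1 by (intro that[of b]) (auto simp: b_def)
qed

section \<open>Mixtures, couplings and transport cost\<close>

text \<open>The law of \<open>f i \<omega>\<close> when \<open>\<omega>\<close> has law \<open>\<Omega>\<close> and, given \<open>\<omega>\<close>, the index \<open>i\<close> is chosen with
  probability \<open>w i \<omega>\<close>. Writing it as an image of a density on a product measure reduces
  integration and measurability in parameters to Fubini's theorem.\<close>

definition mixture ::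
    "'o measure \<Rightarrow> 'i set \<Rightarrow> ('i \<Rightarrow> 'o \<Rightarrow> real) \<Rightarrow> ('i \<Rightarrow> 'o \<Rightarrow> 'b) \<Rightarrow> 'b measure \<Rightarrow> 'b measure" where
  "mixture \<Omega> I w f N =
     distr (density (count_space I \<Otimes>\<^sub>M \<Omega>) (\<lambda>(i, \<omega>). ennreal (w i \<omega>))) N (\<lambda>(i, \<omega>). f i \<omega>)"

lemma sets_mixture [simp, measurable_cong]: "sets (mixture \<Omega> I w f N) = sets N"
  and space_mixture [simp]: "space (mixture \<Omega> I w f N) = space N"
  by (simp_all add: mixture_def)

lemma nn_integral_mixture:
  assumes \<Omega>: "sigma_finite_measure \<Omega>" and I: "finite I"
    and w: "\<And>i. i \<in> I \<Longrightarrow> w i \<in> borel_measurable \<Omega>"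
    and f: "\<And>i. i \<in> I \<Longrightarrow> f i \<in> \<Omega> \<rightarrow>\<^sub>M N"
    and g[measurable]: "g \<in> borel_measurable N"
  shows "(\<integral>\<^sup>+y. g y \<partial>mixture \<Omega> I w f N) = (\<integral>\<^sup>+\<omega>. (\<Sum>i\<in>I. ennreal (w i \<omega>) * g (f i \<omega>)) \<partial>\<Omega>)"
proof -
  interpret sigma_finite_measure \<Omega> by fact
  have [measurable]: "(\<lambda>(i, \<omega>). ennreal (w i \<omega>)) \<in> borel_measurable (count_space I \<Otimes>\<^sub>M \<Omega>)"
    "(\<lambda>(i, \<omega>). f i \<omega>) \<in> count_space I \<Otimes>\<^sub>M \<Omega> \<rightarrow>\<^sub>M N"
    using w f by (intro measurable_pair_measure_countable1; simp add: I countable_finite)+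
  have "(\<integral>\<^sup>+y. g y \<partial>mixture \<Omega> I w f N)
      = (\<integral>\<^sup>+x. (case x of (i, \<omega>) \<Rightarrow> ennreal (w i \<omega>)) * g (case x of (i, \<omega>) \<Rightarrow> f i \<omega>) \<partial>(count_space I \<Otimes>\<^sub>M \<Omega>))"
    unfolding mixture_def by (subst nn_integral_distr, measurable, subst nn_integral_density) auto
  also have "\<dots> = (\<integral>\<^sup>+i. \<integral>\<^sup>+\<omega>. ennreal (w i \<omega>) * g (f i \<omega>) \<partial>\<Omega> \<partial>count_space I)"
    by (subst nn_integral_fst[symmetric]) auto
  also have "\<dots> = (\<Sum>i\<in>I. \<integral>\<^sup>+\<omega>. ennreal (w i \<omega>) * g (f i \<omega>) \<partial>\<Omega>)"
    by (rule nn_integral_count_space_finite[OF I])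
  also have "\<dots> = (\<integral>\<^sup>+\<omega>. (\<Sum>i\<in>I. ennreal (w i \<omega>) * g (f i \<omega>)) \<partial>\<Omega>)"
    using w f by (intro nn_integral_sum[symmetric]) (auto intro!: borel_measurable_times_ennreal
        measurable_compose[OF f g] measurable_compose[OF w measurable_ennreal])
  finally show ?thesis .
qed

lemma prob_space_mixture:
  assumes \<Omega>: "prob_space \<Omega>" and I: "finite I"
    and w: "\<And>i. i \<in> I \<Longrightarrow> w i \<in> borel_measurable \<Omega>"
    and f: "\<And>i. i \<in> I \<Longrightarrow> f i \<in> \<Omega> \<rightarrow>\<^sub>M N"
    and w0: "\<And>i \<omega>. i \<in> I \<Longrightarrow> 0 \<le> w i \<omega>" and w1: "\<And>\<omega>. (\<Sum>i\<in>I. w i \<omega>) = 1"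
  shows "prob_space (mixture \<Omega> I w f N)"
proof (rule prob_spaceI)
  interpret prob_space \<Omega> by fact
  have "emeasure (mixture \<Omega> I w f N) (space N) = (\<integral>\<^sup>+y. 1 \<partial>mixture \<Omega> I w f N)"
    by simp
  also have "\<dots> = (\<integral>\<^sup>+\<omega>. (\<Sum>i\<in>I. ennreal (w i \<omega>) * 1) \<partial>\<Omega>)"
    by (intro nn_integral_mixture sigma_finite_measure_axioms I w f) auto
  also have "\<dots> = (\<integral>\<^sup>+\<omega>. 1 \<partial>\<Omega>)"
    using w0 w1 by (intro nn_integral_cong) (simp add: sum_ennreal)
  finally show "emeasure (mixture \<Omega> I w f N) (space (mixture \<Omega> I w f N)) = 1"
    by (simp add: emeasure_space_1)
qed

lemma measurable_mixture:
  assumes \<Omega>: "prob_space \<Omega>" and I: "finite I"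
    and w[measurable]: "\<And>i. i \<in> I \<Longrightarrow> (\<lambda>(x, \<omega>). w x i \<omega>) \<in> borel_measurable (M \<Otimes>\<^sub>M \<Omega>)"
    and f[measurable]: "\<And>i. i \<in> I \<Longrightarrow> (\<lambda>(x, \<omega>). f x i \<omega>) \<in> M \<Otimes>\<^sub>M \<Omega> \<rightarrow>\<^sub>M N"
    and w0: "\<And>x i \<omega>. i \<in> I \<Longrightarrow> 0 \<le> w x i \<omega>" and w1: "\<And>x \<omega>. (\<Sum>i\<in>I. w x i \<omega>) = 1"
  shows "(\<lambda>x. mixture \<Omega> I (w x) (f x) N) \<in> M \<rightarrow>\<^sub>M subprob_algebra N"
proof (rule measurable_subprob_algebra)
  interpret prob_space \<Omega> by fact
  have wm: "w x i \<in> borel_measurable \<Omega>" and fm: "f x i \<in> \<Omega> \<rightarrow>\<^sub>M N" if "x \<in> space M" "i \<in> I" for x i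
    using measurable_Pair2[OF w[OF that(2)] that(1)] measurable_Pair2[OF f[OF that(2)] that(1)]
    by simp_all
  show "subprob_space (mixture \<Omega> I (w x) (f x) N)" if "x \<in> space M" for x
    using that by (intro prob_space_imp_subprob_space prob_space_mixture \<Omega> I wm fm w0 w1)
  fix A assume [measurable]: "A \<in> sets N"
  have "emeasure (mixture \<Omega> I (w x) (f x) N) A
      = (\<integral>\<^sup>+\<omega>. (\<Sum>i\<in>I. ennreal (w x i \<omega>) * indicator A (f x i \<omega>)) \<partial>\<Omega>)" if "x \<in> space M" for x
    using nn_integral_mixture[OF sigma_finite_measure_axioms I wm[OF that] fm[OF that],
        where g = "indicator A"] by simp
  moreover have "(\<lambda>x. \<integral>\<^sup>+\<omega>. (\<Sum>i\<in>I. ennreal (w x i \<omega>) * indicator A (f x i \<omega>)) \<partial>\<Omega>) \<in> borel_measurable M"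
  proof (intro borel_measurable_nn_integral)
    have "(\<lambda>z. \<Sum>i\<in>I. ennreal (w (fst z) i (snd z)) * indicator A (f (fst z) i (snd z)))
        \<in> borel_measurable (M \<Otimes>\<^sub>M \<Omega>)"
    proof (rule borel_measurable_sum)
      fix i assume "i \<in> I"
      then have [measurable]: "(\<lambda>z. w (fst z) i (snd z)) \<in> borel_measurable (M \<Otimes>\<^sub>M \<Omega>)"
        "(\<lambda>z. f (fst z) i (snd z)) \<in> M \<Otimes>\<^sub>M \<Omega> \<rightarrow>\<^sub>M N"
        using w f by (simp_all add: case_prod_beta')
      show "(\<lambda>z. ennreal (w (fst z) i (snd z)) * indicator A (f (fst z) i (snd z)))
          \<in> borel_measurable (M \<Otimes>\<^sub>M \<Omega>)" by measurable
    qed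
    then show "(\<lambda>(x, \<omega>). \<Sum>i\<in>I. ennreal (w x i \<omega>) * indicator A (f x i \<omega>))
        \<in> borel_measurable (M \<Otimes>\<^sub>M \<Omega>)" by (simp add: case_prod_beta')
  qed
  ultimately show "(\<lambda>x. emeasure (mixture \<Omega> I (w x) (f x) N) A) \<in> borel_measurable M"
    by (simp cong: measurable_cong)
qed simp

lemma measurable_kernel_pow:
  assumes P: "P \<in> borel \<rightarrow>\<^sub>M subprob_algebra borel"
  shows "kernel_pow P n \<in> borel \<rightarrow>\<^sub>M subprob_algebra borel"
  by (induction n) (auto intro: measurable_bind2 P)

lemma bind_kernel_pow_Suc:
  assumes P: "P \<in> borel \<rightarrow>\<^sub>M subprob_algebra borel" and \<nu>[measurable_cong]: "sets \<nu> = sets borel"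
  shows "\<nu> \<bind> kernel_pow P (Suc n) = (\<nu> \<bind> kernel_pow P n) \<bind> P"
proof -
  have "kernel_pow P n \<in> \<nu> \<rightarrow>\<^sub>M subprob_algebra borel"
    using measurable_kernel_pow[OF P] by (simp cong: measurable_cong_sets add: \<nu>)
  then show ?thesis by (simp add: bind_assoc[OF _ P])
qed

text \<open>A kernel \<open>K\<close> on pairs whose marginals are the kernel \<open>P\<close> in each coordinate transports a
  coupling to a coupling one step later. Working with one explicit kernel \<open>K\<close> replaces the measurable
  selection of optimal couplings.\<close>

lemma coupling_bind:
  fixes P :: "'a::topological_space \<Rightarrow> 'a measure"
  assumes P: "P \<in> borel \<rightarrow>\<^sub>M subprob_algebra borel"
    and K: "K \<in> borel \<Otimes>\<^sub>M borel \<rightarrow>\<^sub>M subprob_algebra (borel \<Otimes>\<^sub>M borel)"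
    and K1: "\<And>x y. distr (K (x, y)) borel fst = P x"
    and K2: "\<And>x y. distr (K (x, y)) borel snd = P y"
    and \<pi>: "\<pi> \<in> couplings \<nu>1 \<nu>2"
  shows "\<pi> \<bind> K \<in> couplings (\<nu>1 \<bind> P) (\<nu>2 \<bind> P)"
proof -
  have s[measurable_cong]: "sets \<pi> = sets (borel \<Otimes>\<^sub>M borel)"
    and \<nu>: "distr \<pi> borel fst = \<nu>1" "distr \<pi> borel snd = \<nu>2"
    using \<pi> by (auto simp: couplings_def)
  have sp: "space \<pi> = UNIV"
    using sets_eq_imp_space_eq[OF s] by (simp add: space_pair_measure)
  have K': "K \<in> \<pi> \<rightarrow>\<^sub>M subprob_algebra (borel \<Otimes>\<^sub>M borel)"
    using K by (simp cong: measurable_cong_sets add: s)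
  have "distr (\<pi> \<bind> K) borel fst = \<pi> \<bind> (\<lambda>x. P (fst x))"
    using sp K1 by (subst distr_bind[OF K']) (auto intro!: bind_cong simp: split_paired_all)
  moreover have "distr (\<pi> \<bind> K) borel snd = \<pi> \<bind> (\<lambda>x. P (snd x))"
    using sp K2 by (subst distr_bind[OF K']) (auto intro!: bind_cong simp: split_paired_all)
  moreover have "\<nu>1 \<bind> P = \<pi> \<bind> (\<lambda>x. P (fst x))"
    unfolding \<nu>[symmetric] using P sp by (subst bind_distr) auto
  moreover have "\<nu>2 \<bind> P = \<pi> \<bind> (\<lambda>x. P (snd x))"
    unfolding \<nu>[symmetric] using P sp by (subst bind_distr) auto
  moreover have "sets (\<pi> \<bind> K) = sets (borel \<Otimes>\<^sub>M borel)"
    using sp sets_kernel[OF K'] by (intro sets_bind) auto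
  ultimately show ?thesis by (simp add: couplings_def)
qed

lemma coupling_iterate:
  fixes P :: "'a::topological_space \<Rightarrow> 'a measure" and \<gamma> :: ennreal
  assumes P: "P \<in> borel \<rightarrow>\<^sub>M subprob_algebra borel"
    and K: "K \<in> borel \<Otimes>\<^sub>M borel \<rightarrow>\<^sub>M subprob_algebra (borel \<Otimes>\<^sub>M borel)"
    and K1: "\<And>x y. distr (K (x, y)) borel fst = P x"
    and K2: "\<And>x y. distr (K (x, y)) borel snd = P y"
    and H[measurable]: "H \<in> borel_measurable (borel \<Otimes>\<^sub>M borel)"
    and contr: "\<And>x y. (\<integral>\<^sup>+z. H z \<partial>K (x, y)) \<le> \<gamma> * H (x, y)"
    and \<nu>: "sets \<nu>1 = sets borel" "sets \<nu>2 = sets borel" and \<pi>: "\<pi> \<in> couplings \<nu>1 \<nu>2"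
  shows "\<exists>\<pi>'\<in>couplings (\<nu>1 \<bind> kernel_pow P n) (\<nu>2 \<bind> kernel_pow P n).
    (\<integral>\<^sup>+z. H z \<partial>\<pi>') \<le> \<gamma> ^ n * (\<integral>\<^sup>+z. H z \<partial>\<pi>)"
proof (induction n)
  case 0
  show ?case using \<nu> \<pi> by (intro bexI[of _ \<pi>]) (auto simp: bind_return'')
next
  case (Suc n)
  then obtain \<pi>' where \<pi>': "\<pi>' \<in> couplings (\<nu>1 \<bind> kernel_pow P n) (\<nu>2 \<bind> kernel_pow P n)"
    and le: "(\<integral>\<^sup>+z. H z \<partial>\<pi>') \<le> \<gamma> ^ n * (\<integral>\<^sup>+z. H z \<partial>\<pi>)" by blast
  from \<pi>' have s[measurable_cong]: "sets \<pi>' = sets (borel \<Otimes>\<^sub>M borel)" by (simp add: couplings_def)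
  have K': "K \<in> \<pi>' \<rightarrow>\<^sub>M subprob_algebra (borel \<Otimes>\<^sub>M borel)"
    using K by (simp cong: measurable_cong_sets add: s)
  have "(\<integral>\<^sup>+z. H z \<partial>(\<pi>' \<bind> K)) = (\<integral>\<^sup>+x. \<integral>\<^sup>+z. H z \<partial>K x \<partial>\<pi>')"
    by (rule nn_integral_bind[OF H K'])
  also have "\<dots> \<le> (\<integral>\<^sup>+x. \<gamma> * H x \<partial>\<pi>')"
    using contr by (intro nn_integral_mono) (auto simp: split_paired_all)
  also have "\<dots> = \<gamma> * (\<integral>\<^sup>+x. H x \<partial>\<pi>')"
    by (rule nn_integral_cmult) measurable
  also have "\<dots> \<le> \<gamma> * (\<gamma> ^ n * (\<integral>\<^sup>+z. H z \<partial>\<pi>))"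
    by (intro mult_left_mono le) simp
  finally have "(\<integral>\<^sup>+z. H z \<partial>(\<pi>' \<bind> K)) \<le> \<gamma> ^ Suc n * (\<integral>\<^sup>+z. H z \<partial>\<pi>)"
    by (simp add: mult.assoc)
  then show ?case
    using coupling_bind[OF P K K1 K2 \<pi>'] unfolding bind_kernel_pow_Suc[OF P \<nu>(1)]
      bind_kernel_pow_Suc[OF P \<nu>(2)] by blast
qed

lemma wasserstein_leI:
  assumes k: "0 < k"
    and ex: "\<And>\<pi>. \<pi> \<in> couplings \<nu>1 \<nu>2 \<Longrightarrow> \<exists>\<pi>'\<in>couplings \<nu>1' \<nu>2'.
      (\<integral>\<^sup>+z. ennreal (d (fst z) (snd z)) \<partial>\<pi>') \<le> ennreal k * (\<integral>\<^sup>+z. ennreal (d (fst z) (snd z)) \<partial>\<pi>)"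
  shows "wasserstein d \<nu>1' \<nu>2' \<le> ennreal k * wasserstein d \<nu>1 \<nu>2"
proof -
  have inv: "ennreal (1 / k) * ennreal k = 1" "ennreal k * ennreal (1 / k) = 1"
    using k by (simp_all flip: ennreal_mult)
  have "ennreal (1 / k) * wasserstein d \<nu>1' \<nu>2' \<le> (\<integral>\<^sup>+z. ennreal (d (fst z) (snd z)) \<partial>\<pi>)"
    if "\<pi> \<in> couplings \<nu>1 \<nu>2" for \<pi>
  proof -
    from ex[OF that] obtain \<pi>' where "\<pi>' \<in> couplings \<nu>1' \<nu>2'" and
      "(\<integral>\<^sup>+z. ennreal (d (fst z) (snd z)) \<partial>\<pi>') \<le> ennreal k * (\<integral>\<^sup>+z. ennreal (d (fst z) (snd z)) \<partial>\<pi>)"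
      by blast
    then have "wasserstein d \<nu>1' \<nu>2' \<le> ennreal k * (\<integral>\<^sup>+z. ennreal (d (fst z) (snd z)) \<partial>\<pi>)"
      unfolding wasserstein_def by (meson INF_lower2)
    from mult_left_mono[OF this, of "ennreal (1 / k)"] show ?thesis
      by (simp add: inv(1) flip: mult.assoc)
  qed
  then have "ennreal (1 / k) * wasserstein d \<nu>1' \<nu>2' \<le> wasserstein d \<nu>1 \<nu>2"
    unfolding wasserstein_def[of d \<nu>1 \<nu>2] by (rule INF_greatest)
  from mult_left_mono[OF this, of "ennreal k"] show ?thesis
    by (simp add: inv(2) flip: mult.assoc)
qed

section \<open>The kernel as a function of the state and a common noise\<close>

text \<open>The joint law of two indices with laws \<open>a\<close> and \<open>b\<close> that agree as often as possible: the common
  part \<open>min a b\<close> is put on the diagonal, and the excesses are drawn independently. If \<open>a = b\<close>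
  then the denominator is \<open>0\<close>, and so is the quotient.\<close>

definition maximal_coupling :: "'i set \<Rightarrow> ('i \<Rightarrow> real) \<Rightarrow> ('i \<Rightarrow> real) \<Rightarrow> 'i \<times> 'i \<Rightarrow> real" where
  "maximal_coupling I a b = (\<lambda>(i, j). (if i = j then min (a i) (b i) else 0)
     + max 0 (a i - b i) * max 0 (b j - a j) / (\<Sum>k\<in>I. max 0 (a k - b k)))"

context
  fixes I :: "'i set" and a b :: "'i \<Rightarrow> real"
  assumes I: "finite I" and sum_eq: "sum a I = sum b I"
begin

lemma sum_excess_eq: "(\<Sum>k\<in>I. max 0 (b k - a k)) = (\<Sum>k\<in>I. max 0 (a k - b k))"
proof -
  have "(\<Sum>k\<in>I. max 0 (b k - a k)) - (\<Sum>k\<in>I. max 0 (a k - b k)) = (\<Sum>k\<in>I. b k - a k)"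
    unfolding sum_subtractf[symmetric] by (intro sum.cong) (auto simp: max_def)
  then show ?thesis by (simp add: sum_subtractf sum_eq)
qed

lemma sum_min_eq: "(\<Sum>k\<in>I. min (a k) (b k)) = sum a I - (\<Sum>k\<in>I. max 0 (a k - b k))"
  unfolding sum_subtractf[symmetric] by (intro sum.cong) (auto simp: max_def min_def)

lemma maximal_coupling_nonneg:
  assumes "\<And>i. i \<in> I \<Longrightarrow> 0 \<le> a i" "\<And>i. i \<in> I \<Longrightarrow> 0 \<le> b i" "ij \<in> I \<times> I"
  shows "0 \<le> maximal_coupling I a b ij"
  using assms by (auto simp: maximal_coupling_def intro!: add_nonneg_nonneg divide_nonneg_nonneg sum_nonneg)

lemma sum_maximal_coupling_snd:
  assumes i: "i \<in> I"
  shows "(\<Sum>j\<in>I. maximal_coupling I a b (i, j)) = a i"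
proof -
  let ?t = "\<Sum>k\<in>I. max 0 (a k - b k)"
  have "(\<Sum>j\<in>I. maximal_coupling I a b (i, j)) = min (a i) (b i) + max 0 (a i - b i) * ?t / ?t"
    using I i by (simp add: maximal_coupling_def sum.distrib sum_excess_eq
        flip: sum_divide_distrib sum_distrib_left)
  moreover have "max 0 (a i - b i) * ?t / ?t = max 0 (a i - b i)"
  proof (cases "?t = 0")
    case True
    then have "max 0 (a i - b i) = 0"
      using I i sum_nonneg_eq_0_iff[of I "\<lambda>k. max 0 (a k - b k)"] by auto
    then show ?thesis by simp
  qed simp
  ultimately show ?thesis by (simp add: max_def min_def)
qed

lemma sum_maximal_coupling_fst:
  assumes j: "j \<in> I"
  shows "(\<Sum>i\<in>I. maximal_coupling I a b (i, j)) = b j"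
proof -
  let ?t = "\<Sum>k\<in>I. max 0 (a k - b k)"
  have "(\<Sum>i\<in>I. maximal_coupling I a b (i, j)) = min (a j) (b j) + ?t * max 0 (b j - a j) / ?t"
    using I j by (simp add: maximal_coupling_def sum.distrib flip: sum_divide_distrib sum_distrib_right)
  moreover have "?t * max 0 (b j - a j) / ?t = max 0 (b j - a j)"
  proof (cases "?t = 0")
    case True
    then have "(\<Sum>k\<in>I. max 0 (b k - a k)) = 0" by (simp add: sum_excess_eq)
    then have "max 0 (b j - a j) = 0"
      using I j sum_nonneg_eq_0_iff[of I "\<lambda>k. max 0 (b k - a k)"] by auto
    then show ?thesis by simp
  qed simp
  ultimately show ?thesis by (simp add: max_def min_def)
qed

lemma sum_maximal_coupling:
  assumes "sum a I = 1"
  shows "(\<Sum>ij\<in>I \<times> I. maximal_coupling I a b ij) = 1"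
proof -
  have "(\<Sum>ij\<in>I \<times> I. maximal_coupling I a b ij) = (\<Sum>i\<in>I. \<Sum>j\<in>I. maximal_coupling I a b (i, j))"
    by (simp add: sum.cartesian_product case_prod_eta)
  then show ?thesis using assms by (simp add: sum_maximal_coupling_snd)
qed

text \<open>Off the common part only the total mass of the excess matters.\<close>

lemma sum_maximal_coupling_le:
  assumes h: "\<And>i j. h i j \<le> B"
  shows "(\<Sum>(i, j)\<in>I \<times> I. maximal_coupling I a b (i, j) * h i j)
    \<le> (\<Sum>i\<in>I. min (a i) (b i) * h i i) + (\<Sum>k\<in>I. max 0 (a k - b k)) * B"
proof -
  let ?t = "\<Sum>k\<in>I. max 0 (a k - b k)"
  let ?r = "\<lambda>i j. max 0 (a i - b i) * max 0 (b j - a j) / ?t"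
  have t0: "0 \<le> ?t" by (simp add: sum_nonneg)
  have "(\<Sum>(i, j)\<in>I \<times> I. maximal_coupling I a b (i, j) * h i j)
      = (\<Sum>i\<in>I. \<Sum>j\<in>I. (if i = j then min (a i) (b i) * h i i else 0) + ?r i j * h i j)"
    unfolding sum.cartesian_product[symmetric]
    by (intro sum.cong) (auto simp: maximal_coupling_def algebra_simps)
  also have "\<dots> = (\<Sum>i\<in>I. min (a i) (b i) * h i i) + (\<Sum>i\<in>I. \<Sum>j\<in>I. ?r i j * h i j)"
    using I by (simp add: sum.distrib)
  finally have split: "(\<Sum>(i, j)\<in>I \<times> I. maximal_coupling I a b (i, j) * h i j)
      = (\<Sum>i\<in>I. min (a i) (b i) * h i i) + (\<Sum>i\<in>I. \<Sum>j\<in>I. ?r i j * h i j)" .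
  have "(\<Sum>i\<in>I. \<Sum>j\<in>I. ?r i j * h i j) \<le> (\<Sum>i\<in>I. \<Sum>j\<in>I. ?r i j * B)"
    using t0 by (intro sum_mono mult_left_mono h) simp
  also have "(\<Sum>i\<in>I. \<Sum>j\<in>I. ?r i j * B) = ?t * (\<Sum>j\<in>I. max 0 (b j - a j)) / ?t * B"
  proof -
    have "(\<Sum>i\<in>I. \<Sum>j\<in>I. ?r i j * B)
        = (\<Sum>i\<in>I. \<Sum>j\<in>I. max 0 (a i - b i) * max 0 (b j - a j)) * (B / ?t)"
      unfolding sum_distrib_right by simp
    then show ?thesis unfolding sum_product by simp
  qed
  also have "\<dots> = ?t * B" by (simp add: sum_excess_eq)
  finally show ?thesis unfolding split by simp
qed

end

lemma distr_fst_mixture: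
  assumes \<Omega>: "sigma_finite_measure \<Omega>" and I: "finite I"
    and c: "\<And>ij. ij \<in> I \<times> I \<Longrightarrow> c ij \<in> borel_measurable \<Omega>"
    and c0: "\<And>ij \<omega>. ij \<in> I \<times> I \<Longrightarrow> 0 \<le> c ij \<omega>"
    and w: "\<And>i. i \<in> I \<Longrightarrow> w i \<in> borel_measurable \<Omega>"
    and f: "\<And>i. i \<in> I \<Longrightarrow> f i \<in> \<Omega> \<rightarrow>\<^sub>M N" and g: "\<And>i. i \<in> I \<Longrightarrow> g i \<in> \<Omega> \<rightarrow>\<^sub>M N"
    and marg: "\<And>i \<omega>. i \<in> I \<Longrightarrow> (\<Sum>j\<in>I. c (i, j) \<omega>) = w i \<omega>"
  shows "distr (mixture \<Omega> (I \<times> I) c (\<lambda>(i, j) \<omega>. (f i \<omega>, g j \<omega>)) (N \<Otimes>\<^sub>M N)) N fst = mixture \<Omega> I w f N"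
proof (rule measure_eqI)
  fix A assume "A \<in> sets (distr (mixture \<Omega> (I \<times> I) c (\<lambda>(i, j) \<omega>. (f i \<omega>, g j \<omega>)) (N \<Otimes>\<^sub>M N)) N fst)"
  then have A[measurable]: "A \<in> sets N" by simp
  let ?K = "mixture \<Omega> (I \<times> I) c (\<lambda>(i, j) \<omega>. (f i \<omega>, g j \<omega>)) (N \<Otimes>\<^sub>M N)"
  have "emeasure (distr ?K N fst) A = (\<integral>\<^sup>+y. indicator A y \<partial>distr ?K N fst)"
    by simp
  also have "\<dots> = (\<integral>\<^sup>+z. indicator A (fst z) \<partial>?K)"
    by (rule nn_integral_distr) measurable
  also have "\<dots> = (\<integral>\<^sup>+\<omega>. (\<Sum>ij\<in>I \<times> I. ennreal (c ij \<omega>)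
      * indicator A (fst ((\<lambda>(i, j) \<omega>. (f i \<omega>, g j \<omega>)) ij \<omega>))) \<partial>\<Omega>)"
    using I c f g by (intro nn_integral_mixture \<Omega>) (auto intro!: measurable_Pair)
  also have "\<dots> = (\<integral>\<^sup>+\<omega>. (\<Sum>i\<in>I. ennreal (w i \<omega>) * indicator A (f i \<omega>)) \<partial>\<Omega>)"
  proof (intro nn_integral_cong)
    fix \<omega>
    have "(\<Sum>ij\<in>I \<times> I. ennreal (c ij \<omega>) * indicator A (fst ((\<lambda>(i, j) \<omega>. (f i \<omega>, g j \<omega>)) ij \<omega>)))
        = (\<Sum>i\<in>I. \<Sum>j\<in>I. ennreal (c (i, j) \<omega>) * indicator A (f i \<omega>))"
      by (subst sum.cartesian_product) (auto intro!: sum.cong)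
    also have "\<dots> = (\<Sum>i\<in>I. ennreal (w i \<omega>) * indicator A (f i \<omega>))"
      using c0 by (intro sum.cong) (auto simp: sum_distrib_right[symmetric] sum_ennreal marg)
    finally show "(\<Sum>ij\<in>I \<times> I. ennreal (c ij \<omega>) * indicator A (fst ((\<lambda>(i, j) \<omega>. (f i \<omega>, g j \<omega>)) ij \<omega>)))
        = (\<Sum>i\<in>I. ennreal (w i \<omega>) * indicator A (f i \<omega>))" .
  qed
  also have "\<dots> = (\<integral>\<^sup>+y. indicator A y \<partial>mixture \<Omega> I w f N)"
    using I w f by (intro nn_integral_mixture[symmetric] \<Omega>) auto
  finally show "emeasure (distr ?K N fst) A = emeasure (mixture \<Omega> I w f N) A" by simp
qed simp

lemma distr_snd_mixture:
  assumes \<Omega>: "sigma_finite_measure \<Omega>" and I: "finite I"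
    and c: "\<And>ij. ij \<in> I \<times> I \<Longrightarrow> c ij \<in> borel_measurable \<Omega>"
    and c0: "\<And>ij \<omega>. ij \<in> I \<times> I \<Longrightarrow> 0 \<le> c ij \<omega>"
    and w: "\<And>i. i \<in> I \<Longrightarrow> w i \<in> borel_measurable \<Omega>"
    and f: "\<And>i. i \<in> I \<Longrightarrow> f i \<in> \<Omega> \<rightarrow>\<^sub>M N" and g: "\<And>i. i \<in> I \<Longrightarrow> g i \<in> \<Omega> \<rightarrow>\<^sub>M N"
    and marg: "\<And>j \<omega>. j \<in> I \<Longrightarrow> (\<Sum>i\<in>I. c (i, j) \<omega>) = w j \<omega>"
  shows "distr (mixture \<Omega> (I \<times> I) c (\<lambda>(i, j) \<omega>. (f i \<omega>, g j \<omega>)) (N \<Otimes>\<^sub>M N)) N snd = mixture \<Omega> I w g N"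
proof (rule measure_eqI)
  fix A assume "A \<in> sets (distr (mixture \<Omega> (I \<times> I) c (\<lambda>(i, j) \<omega>. (f i \<omega>, g j \<omega>)) (N \<Otimes>\<^sub>M N)) N snd)"
  then have A[measurable]: "A \<in> sets N" by simp
  let ?K = "mixture \<Omega> (I \<times> I) c (\<lambda>(i, j) \<omega>. (f i \<omega>, g j \<omega>)) (N \<Otimes>\<^sub>M N)"
  have "emeasure (distr ?K N snd) A = (\<integral>\<^sup>+y. indicator A y \<partial>distr ?K N snd)"
    by simp
  also have "\<dots> = (\<integral>\<^sup>+z. indicator A (snd z) \<partial>?K)"
    by (rule nn_integral_distr) measurable
  also have "\<dots> = (\<integral>\<^sup>+\<omega>. (\<Sum>ij\<in>I \<times> I. ennreal (c ij \<omega>)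
      * indicator A (snd ((\<lambda>(i, j) \<omega>. (f i \<omega>, g j \<omega>)) ij \<omega>))) \<partial>\<Omega>)"
    using I c f g by (intro nn_integral_mixture \<Omega>) (auto intro!: measurable_Pair)
  also have "\<dots> = (\<integral>\<^sup>+\<omega>. (\<Sum>j\<in>I. ennreal (w j \<omega>) * indicator A (g j \<omega>)) \<partial>\<Omega>)"
  proof (intro nn_integral_cong)
    fix \<omega>
    have "(\<Sum>ij\<in>I \<times> I. ennreal (c ij \<omega>) * indicator A (snd ((\<lambda>(i, j) \<omega>. (f i \<omega>, g j \<omega>)) ij \<omega>)))
        = (\<Sum>j\<in>I. \<Sum>i\<in>I. ennreal (c (i, j) \<omega>) * indicator A (g j \<omega>))"
      by (subst sum.swap, subst sum.cartesian_product) (auto intro!: sum.cong)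
    also have "\<dots> = (\<Sum>j\<in>I. ennreal (w j \<omega>) * indicator A (g j \<omega>))"
      using c0 by (intro sum.cong) (auto simp: sum_distrib_right[symmetric] sum_ennreal marg)
    finally show "(\<Sum>ij\<in>I \<times> I. ennreal (c ij \<omega>) * indicator A (snd ((\<lambda>(i, j) \<omega>. (f i \<omega>, g j \<omega>)) ij \<omega>)))
        = (\<Sum>j\<in>I. ennreal (w j \<omega>) * indicator A (g j \<omega>))" .
  qed
  also have "\<dots> = (\<integral>\<^sup>+y. indicator A y \<partial>mixture \<Omega> I w g N)"
    using I w g by (intro nn_integral_mixture[symmetric] \<Omega>) auto
  finally show "emeasure (distr ?K N snd) A = emeasure (mixture \<Omega> I w g N) A" by simp
qed simp

lemma accept_prob_nonneg: "0 \<le> accept_prob \<Phi> p j xs"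
  by (auto simp: accept_prob_def intro!: divide_nonneg_nonneg sum_nonneg)

lemma sum_accept_prob: "(\<Sum>j\<le>p. accept_prob \<Phi> p j xs) = 1"
proof -
  have "0 < (\<Sum>l\<le>p. exp (- \<Phi> (xs l)))" by (intro sum_pos) auto
  then show ?thesis by (simp add: accept_prob_def flip: sum_divide_distrib)
qed

locale mpcn =
  fixes \<mu> :: "'a::{real_inner, banach, second_countable_topology} measure"
    and \<Phi> :: "'a \<Rightarrow> real" and \<rho> L :: real and p :: nat
  assumes prob_\<mu>: "prob_space \<mu>" and sets_\<mu> [measurable_cong]: "sets \<mu> = sets borel"
    and \<rho>0: "0 \<le> \<rho>" and \<rho>1: "\<rho> < 1" and lip: "L-lipschitz_on UNIV \<Phi>"
begin

sublocale prob_space \<mu> by (rule prob_\<mu>)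

definition "\<sigma> = sqrt (1 - \<rho>\<^sup>2)"

definition noise :: "('a \<times> (nat \<Rightarrow> 'a)) measure" where
  "noise = \<mu> \<Otimes>\<^sub>M (\<Pi>\<^sub>M k\<in>{1..p}. \<mu>)"

definition increment :: "nat \<Rightarrow> 'a \<times> (nat \<Rightarrow> 'a) \<Rightarrow> 'a" where
  "increment i \<omega> = (\<rho> * \<sigma>) *\<^sub>R fst \<omega> + \<sigma> *\<^sub>R snd \<omega> i"

definition proposal :: "'a \<Rightarrow> nat \<Rightarrow> 'a \<times> (nat \<Rightarrow> 'a) \<Rightarrow> 'a" where
  "proposal x i \<omega> = (if i = 0 then x else \<rho>\<^sup>2 *\<^sub>R x + increment i \<omega>)"

definition acceptance :: "'a \<Rightarrow> nat \<Rightarrow> 'a \<times> (nat \<Rightarrow> 'a) \<Rightarrow> real" where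
  "acceptance x i \<omega> = accept_prob \<Phi> p i (\<lambda>l. proposal x l \<omega>)"

lemma measurable_\<Phi> [measurable]: "\<Phi> \<in> borel_measurable borel"
  by (rule borel_measurable_continuous_onI[OF lipschitz_on_continuous_on[OF lip]])

lemma prob_space_PiM_\<mu>: "prob_space (\<Pi>\<^sub>M k\<in>{1..p}. \<mu>)"
  by (intro prob_space_PiM prob_\<mu>)

lemma prob_space_noise: "prob_space noise"
  unfolding noise_def
  by (intro prob_space_pair prob_\<mu> prob_space_PiM_\<mu>)

lemma sigma_finite_noise: "sigma_finite_measure noise"
  using prob_space_noise by (rule prob_space_imp_sigma_finite)

lemma measurable_increment [measurable]:
  assumes "i \<in> {1..p}"
  shows "increment i \<in> borel_measurable noise"
proof -
  have [measurable]: "(\<lambda>\<omega>. snd \<omega> i) \<in> noise \<rightarrow>\<^sub>M borel"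
    unfolding noise_def using assms by measurable
  have [measurable]: "fst \<in> noise \<rightarrow>\<^sub>M borel"
    unfolding noise_def by measurable
  show ?thesis unfolding increment_def by measurable
qed

lemma measurable_proposal_pair:
  assumes "i \<le> p"
  shows "(\<lambda>z. proposal (fst z) i (snd z)) \<in> borel \<Otimes>\<^sub>M noise \<rightarrow>\<^sub>M borel"
proof (cases "i = 0")
  case False
  then have [measurable]: "increment i \<in> borel_measurable noise"
    using assms by (intro measurable_increment) auto
  show ?thesis using False by (simp add: proposal_def)
qed (simp add: proposal_def)

lemma measurable_acceptance_pair:
  assumes "i \<le> p"
  shows "(\<lambda>z. acceptance (fst z) i (snd z)) \<in> borel_measurable (borel \<Otimes>\<^sub>M noise)"
  unfolding acceptance_def accept_prob_def using assms
  by (intro borel_measurable_divide borel_measurable_sum measurable_compose[OF measurable_proposal_pair])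
     auto

lemma measurable_proposal: "i \<le> p \<Longrightarrow> proposal x i \<in> noise \<rightarrow>\<^sub>M borel"
  using measurable_Pair2[OF measurable_proposal_pair, of i x] by simp

lemma measurable_acceptance: "i \<le> p \<Longrightarrow> acceptance x i \<in> borel_measurable noise"
  using measurable_Pair2[OF measurable_acceptance_pair, of i x] by simp

lemma acceptance_nonneg: "0 \<le> acceptance x i \<omega>"
  by (simp add: acceptance_def accept_prob_nonneg)

lemma sum_acceptance: "(\<Sum>i\<le>p. acceptance x i \<omega>) = 1"
  by (simp add: acceptance_def sum_accept_prob)

text \<open>The composition \<open>\<rho> (\<rho> x + \<sigma> \<xi>0) + \<sigma> \<xi> i\<close> of the two Gaussian moves is \<open>\<rho>\<^sup>2 x\<close> plus an increment
  which does not depend on \<open>x\<close>; all randomness of the proposals is moved to a fixed space.\<close>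

lemma mpcn_kernel_eq_mixture:
  assumes Q: "\<And>z. Q z = distr \<mu> borel (\<lambda>\<xi>. \<rho> *\<^sub>R z + \<sigma> *\<^sub>R \<xi>)"
  shows "mpcn_kernel Q \<Phi> p x = mixture noise {..p} (acceptance x) (proposal x) borel"
proof -
  interpret PM: prob_space "\<Pi>\<^sub>M k\<in>{1..p}. \<mu>" by (rule prob_space_PiM_\<mu>)
  let ?mix = "mixture noise {..p} (acceptance x) (proposal x) borel"
  have prob_Q: "prob_space (Q z)" for z
    unfolding Q by (rule prob_space_distr) measurable
  have "(\<Sum>j\<le>p. \<integral>\<^sup>+ z. (\<integral>\<^sup>+ xs. ennreal (accept_prob \<Phi> p j (xs(0 := x))) *
          emeasure (return borel ((xs(0 := x)) j)) A \<partial>PiM {1..p} (\<lambda>_. Q z)) \<partial>Q x) = emeasure ?mix A"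
    if A[measurable]: "A \<in> sets borel" for A
  proof -
    let ?F = "\<lambda>j xs. ennreal (accept_prob \<Phi> p j (xs(0 := x))) * indicator A ((xs(0 := x)) j)"
    let ?prop = "\<lambda>z \<xi> l. if l = 0 then x else \<rho> *\<^sub>R z + \<sigma> *\<^sub>R \<xi> l"
    let ?G = "\<lambda>j z \<xi>. ennreal (accept_prob \<Phi> p j (?prop z \<xi>)) * indicator A (?prop z \<xi> j)"
    have inner: "(\<integral>\<^sup>+xs. ?F j xs \<partial>PiM {1..p} (\<lambda>_. Q z)) = (\<integral>\<^sup>+\<xi>. ?G j z \<xi> \<partial>(\<Pi>\<^sub>M k\<in>{1..p}. \<mu>))"
      if j: "j \<le> p" for j z
    proof -
      have [measurable_cong]: "sets (Q z) = sets borel" by (simp add: Q)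
      let ?f = "\<lambda>\<xi>. \<rho> *\<^sub>R z + \<sigma> *\<^sub>R \<xi>"
      have comp_meas: "(\<lambda>xs. (xs(0 := x)) l) \<in> PiM {1..p} (\<lambda>_. Q z) \<rightarrow>\<^sub>M borel" if "l \<le> p" for l
        using that by (cases "l = 0") auto
      have F[measurable]: "?F j \<in> borel_measurable (PiM {1..p} (\<lambda>_. Q z))"
        unfolding accept_prob_def
        by (intro borel_measurable_times_ennreal measurable_compose[OF _ measurable_ennreal]
              borel_measurable_divide borel_measurable_sum
              measurable_compose[OF comp_meas] j) (auto intro: j)
      have cm: "compose {1..p} ?f \<in> (\<Pi>\<^sub>M k\<in>{1..p}. \<mu>) \<rightarrow>\<^sub>M PiM {1..p} (\<lambda>_. Q z)"
        unfolding compose_def by (rule measurable_restrict) measurable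
      have "PiM {1..p} (\<lambda>_. Q z) = PiM {1..p} (\<lambda>_. distr \<mu> (Q z) ?f)"
        by (rule PiM_cong) (auto simp: Q cong: distr_cong)
      also have "\<dots> = distr (\<Pi>\<^sub>M k\<in>{1..p}. \<mu>) (PiM {1..p} (\<lambda>_. Q z)) (compose {1..p} ?f)"
        by (rule distr_PiM_finite_prob_space'[symmetric]) (auto intro: prob_\<mu> prob_Q)
      finally have "(\<integral>\<^sup>+xs. ?F j xs \<partial>PiM {1..p} (\<lambda>_. Q z))
          = (\<integral>\<^sup>+xs. ?F j xs \<partial>distr (\<Pi>\<^sub>M k\<in>{1..p}. \<mu>) (PiM {1..p} (\<lambda>_. Q z)) (compose {1..p} ?f))"
        by simp
      also have "\<dots> = (\<integral>\<^sup>+\<xi>. ?F j (compose {1..p} ?f \<xi>) \<partial>(\<Pi>\<^sub>M k\<in>{1..p}. \<mu>))"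
        by (rule nn_integral_distr[OF cm]) (use F in \<open>simp only: measurable_distr_eq1\<close>)
      also have "\<dots> = (\<integral>\<^sup>+\<xi>. ?G j z \<xi> \<partial>(\<Pi>\<^sub>M k\<in>{1..p}. \<mu>))"
      proof (rule nn_integral_cong)
        fix \<xi>
        have "((compose {1..p} ?f \<xi>)(0 := x)) l = ?prop z \<xi> l" if "l \<le> p" for l
          using that by (auto simp: compose_def)
        then show "?F j (compose {1..p} ?f \<xi>) = ?G j z \<xi>"
          using j by (simp add: accept_prob_def cong: sum.cong_simp)
      qed
      finally show ?thesis .
    qed
    have G: "(\<lambda>w. ?G j (fst w) (snd w)) \<in> borel_measurable (borel \<Otimes>\<^sub>M (\<Pi>\<^sub>M k\<in>{1..p}. \<mu>))"
      if j: "j \<le> p" for j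
    proof -
      have comp_meas: "(\<lambda>w. ?prop (fst w) (snd w) l) \<in> borel \<Otimes>\<^sub>M (\<Pi>\<^sub>M k\<in>{1..p}. \<mu>) \<rightarrow>\<^sub>M borel" if "l \<le> p" for l
        using that by (cases "l = 0") auto
      show ?thesis
        unfolding accept_prob_def
        by (intro borel_measurable_times_ennreal measurable_compose[OF _ measurable_ennreal]
              borel_measurable_divide borel_measurable_sum
              measurable_compose[OF comp_meas] j) (auto intro: j)
    qed
    have outer: "(\<integral>\<^sup>+z. \<integral>\<^sup>+\<xi>. ?G j z \<xi> \<partial>(\<Pi>\<^sub>M k\<in>{1..p}. \<mu>) \<partial>Q x)
        = (\<integral>\<^sup>+\<omega>. ennreal (acceptance x j \<omega>) * indicator A (proposal x j \<omega>) \<partial>noise)" if j: "j \<le> p" for j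
    proof -
      have Gint: "(\<lambda>z. \<integral>\<^sup>+\<xi>. ?G j z \<xi> \<partial>(\<Pi>\<^sub>M k\<in>{1..p}. \<mu>)) \<in> borel_measurable borel"
        by (rule PM.borel_measurable_nn_integral) (use G[OF j] in \<open>simp only: case_prod_beta'\<close>)
      have "(\<integral>\<^sup>+z. \<integral>\<^sup>+\<xi>. ?G j z \<xi> \<partial>(\<Pi>\<^sub>M k\<in>{1..p}. \<mu>) \<partial>Q x)
          = (\<integral>\<^sup>+\<xi>0. \<integral>\<^sup>+\<xi>. ?G j (\<rho> *\<^sub>R x + \<sigma> *\<^sub>R \<xi>0) \<xi> \<partial>(\<Pi>\<^sub>M k\<in>{1..p}. \<mu>) \<partial>\<mu>)"
        unfolding Q
        by (rule nn_integral_distr) (use Gint in \<open>simp_all only: measurable_distr_eq1, measurable\<close>)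
      also have "\<dots> = (\<integral>\<^sup>+\<omega>. ?G j (\<rho> *\<^sub>R x + \<sigma> *\<^sub>R fst \<omega>) (snd \<omega>) \<partial>noise)"
      proof -
        have "(\<lambda>\<omega>. (\<rho> *\<^sub>R x + \<sigma> *\<^sub>R fst \<omega>, snd \<omega>)) \<in> \<mu> \<Otimes>\<^sub>M (\<Pi>\<^sub>M k\<in>{1..p}. \<mu>)
            \<rightarrow>\<^sub>M borel \<Otimes>\<^sub>M (\<Pi>\<^sub>M k\<in>{1..p}. \<mu>)" by measurable
        from measurable_compose[OF this G[OF j]] show ?thesis
          unfolding noise_def by (subst PM.nn_integral_fst[symmetric]) (simp_all only: fst_conv snd_conv)
      qed
      also have "\<dots> = (\<integral>\<^sup>+\<omega>. ennreal (acceptance x j \<omega>) * indicator A (proposal x j \<omega>) \<partial>noise)"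
      proof (rule nn_integral_cong)
        fix \<omega> :: "'a \<times> (nat \<Rightarrow> 'a)"
        have "?prop (\<rho> *\<^sub>R x + \<sigma> *\<^sub>R fst \<omega>) (snd \<omega>) = (\<lambda>l. proposal x l \<omega>)"
          by (auto simp: proposal_def increment_def fun_eq_iff scaleR_add_right power2_eq_square)
        then show "?G j (\<rho> *\<^sub>R x + \<sigma> *\<^sub>R fst \<omega>) (snd \<omega>)
            = ennreal (acceptance x j \<omega>) * indicator A (proposal x j \<omega>)"
          by (simp add: acceptance_def fun_eq_iff)
      qed
      finally show ?thesis .
    qed
    have "emeasure ?mix A = (\<integral>\<^sup>+y. indicator A y \<partial>?mix)" by simp
    also have "\<dots> = (\<integral>\<^sup>+\<omega>. (\<Sum>j\<le>p. ennreal (acceptance x j \<omega>) * indicator A (proposal x j \<omega>)) \<partial>noise)"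
      by (intro nn_integral_mixture sigma_finite_noise) (auto intro: measurable_acceptance measurable_proposal)
    also have "\<dots> = (\<Sum>j\<le>p. \<integral>\<^sup>+\<omega>. ennreal (acceptance x j \<omega>) * indicator A (proposal x j \<omega>) \<partial>noise)"
      by (rule nn_integral_sum) (auto intro!: borel_measurable_times_ennreal
          measurable_compose[OF measurable_proposal] measurable_compose[OF measurable_acceptance])
    also have "\<dots> = (\<Sum>j\<le>p. \<integral>\<^sup>+z. (\<integral>\<^sup>+xs. ?F j xs \<partial>PiM {1..p} (\<lambda>_. Q z)) \<partial>Q x)"
      using outer inner by simp
    finally show ?thesis by simp
  qed
  then have "mpcn_kernel Q \<Phi> p x = measure_of UNIV (sets borel) (emeasure ?mix)"
    unfolding mpcn_kernel_def
    by (intro measure_of_eq) (auto simp: sets.sigma_sets_eq[of borel, simplified])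
  also have "\<dots> = ?mix"
    using measure_of_of_measure[of ?mix] by simp
  finally show ?thesis .
qed

end

section \<open>Coupling two copies of the chain\<close>

context mpcn
begin

definition kernel :: "'a \<Rightarrow> 'a measure" where
  "kernel x = mixture noise {..p} (acceptance x) (proposal x) borel"

definition coupled_weight :: "'a \<times> 'a \<Rightarrow> nat \<times> nat \<Rightarrow> 'a \<times> (nat \<Rightarrow> 'a) \<Rightarrow> real" where
  "coupled_weight z ij \<omega> = maximal_coupling {..p}
     (\<lambda>i. acceptance (fst z) i \<omega>) (\<lambda>i. acceptance (snd z) i \<omega>) ij"

definition coupled_kernel :: "'a \<times> 'a \<Rightarrow> ('a \<times> 'a) measure" where
  "coupled_kernel z = mixture noise ({..p} \<times> {..p}) (coupled_weight z)
     (\<lambda>(i, j) \<omega>. (proposal (fst z) i \<omega>, proposal (snd z) j \<omega>)) (borel \<Otimes>\<^sub>M borel)"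

lemma measurable_kernel: "kernel \<in> borel \<rightarrow>\<^sub>M subprob_algebra borel"
  unfolding kernel_def
  by (rule measurable_mixture[OF prob_space_noise])
     (auto simp: case_prod_beta' sum_acceptance
        intro: acceptance_nonneg measurable_acceptance_pair measurable_proposal_pair)

lemma coupled_weight_nonneg: "ij \<in> {..p} \<times> {..p} \<Longrightarrow> 0 \<le> coupled_weight z ij \<omega>"
  unfolding coupled_weight_def
  by (intro maximal_coupling_nonneg) (auto simp: acceptance_nonneg sum_acceptance)

lemma sum_coupled_weight: "(\<Sum>ij\<in>{..p} \<times> {..p}. coupled_weight z ij \<omega>) = 1"
  unfolding coupled_weight_def by (intro sum_maximal_coupling) (auto simp: sum_acceptance)

lemma measurable_coupled_weight_pair:
  assumes "ij \<in> {..p} \<times> {..p}"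
  shows "(\<lambda>w. coupled_weight (fst w) ij (snd w)) \<in> borel_measurable ((borel \<Otimes>\<^sub>M borel) \<Otimes>\<^sub>M noise)"
proof -
  have a: "(\<lambda>w. acceptance (fst (fst w)) i (snd w)) \<in> borel_measurable ((borel \<Otimes>\<^sub>M borel) \<Otimes>\<^sub>M noise)"
    "(\<lambda>w. acceptance (snd (fst w)) i (snd w)) \<in> borel_measurable ((borel \<Otimes>\<^sub>M borel) \<Otimes>\<^sub>M noise)"
    if "i \<le> p" for i
    using measurable_compose[OF _ measurable_acceptance_pair[OF that],
        of "\<lambda>w. (fst (fst w), snd w)" "(borel \<Otimes>\<^sub>M borel) \<Otimes>\<^sub>M noise"]
      measurable_compose[OF _ measurable_acceptance_pair[OF that],
        of "\<lambda>w. (snd (fst w), snd w)" "(borel \<Otimes>\<^sub>M borel) \<Otimes>\<^sub>M noise"]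
    by simp_all
  obtain i j where ij: "ij = (i, j)" "i \<le> p" "j \<le> p" using assms by auto
  note [measurable] = a[OF ij(2)] a[OF ij(3)]
  have [measurable]: "(\<lambda>w. \<Sum>k\<le>p. max 0 (acceptance (fst (fst w)) k (snd w) - acceptance (snd (fst w)) k (snd w)))
      \<in> borel_measurable ((borel \<Otimes>\<^sub>M borel) \<Otimes>\<^sub>M noise)"
    using a by (intro borel_measurable_sum borel_measurable_max borel_measurable_diff) auto
  show ?thesis
    unfolding ij(1) coupled_weight_def maximal_coupling_def by simp
qed

lemma measurable_coupled_proposal_pair:
  assumes "ij \<in> {..p} \<times> {..p}"
  shows "(\<lambda>w. (case ij of (i, j) \<Rightarrow> \<lambda>\<omega>. (proposal (fst (fst w)) i \<omega>, proposal (snd (fst w)) j \<omega>)) (snd w))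
    \<in> ((borel \<Otimes>\<^sub>M borel) \<Otimes>\<^sub>M noise) \<rightarrow>\<^sub>M borel \<Otimes>\<^sub>M borel"
proof -
  obtain i j where ij: "ij = (i, j)" "i \<le> p" "j \<le> p" using assms by auto
  show ?thesis
    using measurable_compose[OF _ measurable_proposal_pair[OF ij(2)],
        of "\<lambda>w. (fst (fst w), snd w)" "(borel \<Otimes>\<^sub>M borel) \<Otimes>\<^sub>M noise"]
      measurable_compose[OF _ measurable_proposal_pair[OF ij(3)],
        of "\<lambda>w. (snd (fst w), snd w)" "(borel \<Otimes>\<^sub>M borel) \<Otimes>\<^sub>M noise"]
    by (auto simp: ij(1) intro!: measurable_Pair)
qed

lemma measurable_coupled_weight: "ij \<in> {..p} \<times> {..p} \<Longrightarrow> coupled_weight z ij \<in> borel_measurable noise"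
  using measurable_Pair2[OF measurable_coupled_weight_pair, of ij z]
  by (simp add: space_pair_measure)

lemma measurable_coupled_proposal:
  "ij \<in> {..p} \<times> {..p} \<Longrightarrow> (\<lambda>(i, j) \<omega>. (proposal (fst z) i \<omega>, proposal (snd z) j \<omega>)) ij
    \<in> noise \<rightarrow>\<^sub>M borel \<Otimes>\<^sub>M borel"
  by (auto intro!: measurable_Pair measurable_proposal)

lemma measurable_coupled_kernel:
  "coupled_kernel \<in> borel \<Otimes>\<^sub>M borel \<rightarrow>\<^sub>M subprob_algebra (borel \<Otimes>\<^sub>M borel)"
  unfolding coupled_kernel_def
  using measurable_coupled_weight_pair measurable_coupled_proposal_pair
  by (intro measurable_mixture[OF prob_space_noise])
     (simp_all only: case_prod_beta' coupled_weight_nonneg sum_coupled_weight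
        finite_cartesian_product finite_atMost)

lemma nn_integral_coupled_kernel:
  assumes "g \<in> borel_measurable (borel \<Otimes>\<^sub>M borel)"
  shows "(\<integral>\<^sup>+w. g w \<partial>coupled_kernel z) = (\<integral>\<^sup>+\<omega>. (\<Sum>(i, j)\<in>{..p} \<times> {..p}.
    ennreal (coupled_weight z (i, j) \<omega>) * g (proposal (fst z) i \<omega>, proposal (snd z) j \<omega>)) \<partial>noise)"
proof -
  have "(\<integral>\<^sup>+w. g w \<partial>coupled_kernel z) = (\<integral>\<^sup>+\<omega>. (\<Sum>ij\<in>{..p} \<times> {..p}. ennreal (coupled_weight z ij \<omega>)
      * g ((\<lambda>(i, j) \<omega>. (proposal (fst z) i \<omega>, proposal (snd z) j \<omega>)) ij \<omega>)) \<partial>noise)"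
    unfolding coupled_kernel_def
    by (intro nn_integral_mixture sigma_finite_noise measurable_coupled_weight
          measurable_coupled_proposal assms) auto
  then show ?thesis by (simp add: case_prod_beta')
qed

lemma distr_coupled_kernel:
  "distr (coupled_kernel (x, y)) borel fst = kernel x"
  "distr (coupled_kernel (x, y)) borel snd = kernel y"
proof -
  have "distr (coupled_kernel (x, y)) borel fst
      = distr (mixture noise ({..p} \<times> {..p}) (coupled_weight (x, y))
         (\<lambda>(i, j) \<omega>. (proposal x i \<omega>, proposal y j \<omega>)) (borel \<Otimes>\<^sub>M borel)) borel fst"
    by (simp add: coupled_kernel_def)
  also have "\<dots> = kernel x"
    unfolding kernel_def
    by (intro distr_fst_mixture sigma_finite_noise measurable_coupled_weight coupled_weight_nonneg)
       (auto intro: measurable_acceptance measurable_proposal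
          simp: coupled_weight_def sum_acceptance intro!: sum_maximal_coupling_snd)
  finally show "distr (coupled_kernel (x, y)) borel fst = kernel x" .
  have "distr (coupled_kernel (x, y)) borel snd
      = distr (mixture noise ({..p} \<times> {..p}) (coupled_weight (x, y))
         (\<lambda>(i, j) \<omega>. (proposal x i \<omega>, proposal y j \<omega>)) (borel \<Otimes>\<^sub>M borel)) borel snd"
    by (simp add: coupled_kernel_def)
  also have "\<dots> = kernel y"
    unfolding kernel_def
    by (intro distr_snd_mixture sigma_finite_noise measurable_coupled_weight coupled_weight_nonneg)
       (auto intro: measurable_acceptance measurable_proposal
          simp: coupled_weight_def sum_acceptance intro!: sum_maximal_coupling_fst)
  finally show "distr (coupled_kernel (x, y)) borel snd = kernel y" .
qed

text \<open>Moving the state by \<open>x - y\<close> moves every proposal by at most \<open>|x - y|\<close>, hence changes numerator and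
  denominator of an acceptance probability by factors of at least \<open>exp (- L |x - y|)\<close> each. The
  relative form of this bound avoids a dependence on the number of proposals.\<close>

lemma acceptance_excess_le:
  "(\<Sum>i\<le>p. max 0 (acceptance x i \<omega> - acceptance y i \<omega>)) \<le> 2 * L * norm (x - y)"
proof -
  let ?D = "norm (x - y)"
  let ?X = "\<lambda>i. proposal x i \<omega>" and ?Y = "\<lambda>i. proposal y i \<omega>"
  have L0: "0 \<le> L" using lip by (rule lipschitz_on_nonneg)
  have "\<rho>\<^sup>2 \<le> 1" using \<rho>0 \<rho>1 by (simp add: power_le_one)
  then have "norm (?X l - ?Y l) \<le> ?D" for l
    by (auto simp: proposal_def mult_left_le_one_le simp flip: scaleR_diff_right)
  then have d: "\<bar>\<Phi> (?X l) - \<Phi> (?Y l)\<bar> \<le> L * ?D" for l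
    using lipschitz_onD[OF lip, of "?X l" "?Y l"] L0
    by (simp add: dist_norm) (meson mult_left_mono order_trans)
  have w: "exp (- (L * ?D)) * exp (- \<Phi> (?X i)) \<le> exp (- \<Phi> (?Y i))"
    "exp (- (L * ?D)) * exp (- \<Phi> (?Y i)) \<le> exp (- \<Phi> (?X i))" for i
    using d[of i] by (auto simp flip: exp_add)
  let ?SX = "\<Sum>l\<le>p. exp (- \<Phi> (?X l))" and ?SY = "\<Sum>l\<le>p. exp (- \<Phi> (?Y l))"
  have S: "0 < ?SX" "0 < ?SY" by (auto intro!: sum_pos)
  have SS: "exp (- (L * ?D)) * ?SY \<le> ?SX"
    unfolding sum_distrib_left by (intro sum_mono w)
  have ge: "exp (- (2 * L * ?D)) * acceptance x i \<omega> \<le> acceptance y i \<omega>" for i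
  proof -
    have "exp (- (2 * L * ?D)) = exp (- (L * ?D)) * exp (- (L * ?D))"
      by (simp flip: exp_add)
    then have "exp (- (2 * L * ?D)) * exp (- \<Phi> (?X i)) * ?SY
        = (exp (- (L * ?D)) * exp (- \<Phi> (?X i))) * (exp (- (L * ?D)) * ?SY)" by simp
    also have "\<dots> \<le> exp (- \<Phi> (?Y i)) * ?SX"
      using S by (intro mult_mono w SS) auto
    finally show ?thesis
      using S by (simp add: acceptance_def accept_prob_def field_simps)
  qed
  have "(\<Sum>i\<le>p. max 0 (acceptance x i \<omega> - acceptance y i \<omega>))
      \<le> (\<Sum>i\<le>p. (1 - exp (- (2 * L * ?D))) * acceptance x i \<omega>)"
  proof (intro sum_mono max.boundedI)
    fix i
    show "0 \<le> (1 - exp (- (2 * L * ?D))) * acceptance x i \<omega>"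
      using L0 by (simp add: acceptance_nonneg)
    show "acceptance x i \<omega> - acceptance y i \<omega> \<le> (1 - exp (- (2 * L * ?D))) * acceptance x i \<omega>"
      using ge[of i] by (simp add: algebra_simps)
  qed
  also have "\<dots> = 1 - exp (- (2 * L * ?D))"
    by (simp flip: sum_distrib_left add: sum_acceptance)
  also have "\<dots> \<le> 2 * L * ?D"
    using exp_ge_add_one_self[of "- (2 * L * ?D)"] by linarith
  finally show ?thesis .
qed

end

text \<open>The two bounds on \<open>\<Phi>\<close> are what remains of the acceptance condition.\<close>

locale mpcn_bounded = mpcn +
  fixes lo hi :: real
  assumes p1: "1 \<le> p" and lo: "\<And>x. lo \<le> \<Phi> x" and hi: "\<And>x. \<Phi> (\<rho>\<^sup>2 *\<^sub>R x) \<le> hi"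
begin

definition accept_floor :: "'a \<times> (nat \<Rightarrow> 'a) \<Rightarrow> real" where
  "accept_floor \<omega> = exp (lo - hi - L * norm (increment 1 \<omega>)) / (p + 1)"

definition accept_rate :: real where
  "accept_rate = (\<integral>\<omega>. accept_floor \<omega> \<partial>noise)"

text \<open>The numerator is controlled at the centre \<open>\<rho>\<^sup>2 x\<close> by \<open>hi\<close> and away from it by the
  Lipschitz constant, each of the \<open>p + 1\<close> terms of the denominator by \<open>lo\<close>.\<close>

lemma accept_floor_le: "accept_floor \<omega> \<le> acceptance x 1 \<omega>"
proof -
  let ?X = "\<lambda>i. proposal x i \<omega>"
  have "\<bar>\<Phi> (?X 1) - \<Phi> (\<rho>\<^sup>2 *\<^sub>R x)\<bar> \<le> L * norm (increment 1 \<omega>)"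
    using lipschitz_onD[OF lip, of "?X 1" "\<rho>\<^sup>2 *\<^sub>R x"] by (simp add: proposal_def dist_norm)
  then have num: "exp (- hi - L * norm (increment 1 \<omega>)) \<le> exp (- \<Phi> (?X 1))"
    using hi[of x] by simp
  have den: "(\<Sum>l\<le>p. exp (- \<Phi> (?X l))) \<le> (p + 1) * exp (- lo)"
    using sum_bounded_above[of "{..p}" "\<lambda>l. exp (- \<Phi> (?X l))" "exp (- lo)"] lo
    by (simp add: add.commute)
  have pos: "0 < (\<Sum>l\<le>p. exp (- \<Phi> (?X l)))" by (intro sum_pos) auto
  have "accept_floor \<omega> = exp (- hi - L * norm (increment 1 \<omega>)) / ((p + 1) * exp (- lo))"
  proof -
    have "exp (lo - hi - L * norm (increment 1 \<omega>)) = exp (- hi - L * norm (increment 1 \<omega>)) / exp (- lo)"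
      by (simp flip: exp_diff)
    then show ?thesis by (simp add: accept_floor_def)
  qed
  also have "\<dots> \<le> exp (- \<Phi> (?X 1)) / (\<Sum>l\<le>p. exp (- \<Phi> (?X l)))"
    using num den pos by (intro frac_le) auto
  finally show ?thesis by (simp add: acceptance_def accept_prob_def)
qed

lemma accept_floor_pos: "0 < accept_floor \<omega>"
  by (simp add: accept_floor_def)

lemma acceptance_le_1: "i \<le> p \<Longrightarrow> acceptance x i \<omega> \<le> 1"
  using member_le_sum[of i "{..p}" "\<lambda>i. acceptance x i \<omega>"] sum_acceptance[of x \<omega>]
  by (simp add: acceptance_nonneg)

lemma accept_floor_le_1: "accept_floor \<omega> \<le> 1"
  using accept_floor_le acceptance_le_1[OF p1] order_trans by blast

lemma measurable_accept_floor [measurable]: "accept_floor \<in> borel_measurable noise"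
proof -
  have [measurable]: "increment 1 \<in> borel_measurable noise"
    by (rule measurable_increment) (use p1 in auto)
  show ?thesis unfolding accept_floor_def by measurable
qed

lemma integrable_accept_floor: "integrable noise accept_floor"
proof -
  interpret N: prob_space noise by (rule prob_space_noise)
  show ?thesis
    by (rule N.integrable_const_bound[where B = 1])
       (use accept_floor_pos accept_floor_le_1 in \<open>auto simp: less_imp_le\<close>)
qed

lemma accept_rate_bounds: "0 < accept_rate" "accept_rate \<le> 1"
proof -
  interpret N: prob_space noise by (rule prob_space_noise)
  have "accept_rate \<noteq> 0"
  proof
    assume "accept_rate = 0"
    then have "AE \<omega> in noise. accept_floor \<omega> = 0"
      using integral_nonneg_eq_0_iff_AE[OF integrable_accept_floor] accept_floor_pos
      by (simp add: accept_rate_def less_imp_le)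
    then have "AE \<omega> in noise. False"
      by eventually_elim (use accept_floor_pos in \<open>auto simp: less_le\<close>)
    then show False by simp
  qed
  moreover have "0 \<le> accept_rate"
    unfolding accept_rate_def using accept_floor_pos by (simp add: less_imp_le)
  ultimately show "0 < accept_rate" by simp
  show "accept_rate \<le> 1"
    unfolding accept_rate_def
    using N.integral_le_const[OF integrable_accept_floor, of 1] accept_floor_le_1 by simp
qed

lemma nn_integral_affine_accept_floor:
  assumes "\<And>\<omega>. 0 \<le> u - v * accept_floor \<omega>"
  shows "(\<integral>\<^sup>+\<omega>. ennreal (u - v * accept_floor \<omega>) \<partial>noise) = ennreal (u - v * accept_rate)"
proof -
  interpret N: prob_space noise by (rule prob_space_noise)
  have "(\<integral>\<^sup>+\<omega>. ennreal (u - v * accept_floor \<omega>) \<partial>noise) = ennreal (\<integral>\<omega>. u - v * accept_floor \<omega> \<partial>noise)"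
    using assms by (intro nn_integral_eq_integral) (auto simp: integrable_accept_floor)
  then show ?thesis by (simp add: integrable_accept_floor accept_rate_def N.prob_space)
qed

text \<open>With \<open>E = exp (- a D)\<close> and \<open>D = |x - y|\<close>, unequal indices cost at most
  \<open>1 - g D = E\<close>, with probability at most \<open>2 L D\<close>. Equal positive indices gain
  \<open>g D - g (\<rho>\<^sup>2 D) = E (exp (a (1 - \<rho>\<^sup>2) D) - 1)\<close>, at least \<open>a (1 - \<rho>\<^sup>2) E D\<close>. Cost and gain have the
  common factor \<open>E D\<close>, and the gain wins for large \<open>a\<close>.\<close>

lemma coupled_distance_contracts:
  fixes a :: real
  assumes a: "0 < a"
  defines "g \<equiv> \<lambda>t. 1 - exp (- a * t)"
  shows "(\<integral>\<^sup>+w. ennreal (g (norm (fst w - snd w))) \<partial>coupled_kernel (x, y))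
    \<le> ennreal (g (norm (x - y))
        - exp (- a * norm (x - y)) * norm (x - y) * (a * (1 - \<rho>\<^sup>2) * accept_rate - 2 * L))"
proof -
  let ?D = "norm (x - y)"
  let ?E = "exp (- a * ?D)"
  let ?R = "\<lambda>\<omega>. (g ?D + 2 * L * ?D * ?E) - ?E * ?D * (a * (1 - \<rho>\<^sup>2)) * accept_floor \<omega>"
  let ?h = "\<lambda>\<omega> i j. g (norm (proposal x i \<omega> - proposal y j \<omega>))"
  let ?S = "\<lambda>\<omega>. \<Sum>(i, j)\<in>{..p} \<times> {..p}. coupled_weight (x, y) (i, j) \<omega> * ?h \<omega> i j"
  have g0: "0 \<le> g t" if "0 \<le> t" for t using a that by (simp add: g_def)
  have g1: "g t \<le> 1" for t by (simp add: g_def)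
  have S0: "0 \<le> ?S \<omega>" for \<omega>
    by (intro sum_nonneg) (auto intro!: mult_nonneg_nonneg coupled_weight_nonneg g0)
  have bound: "?S \<omega> \<le> ?R \<omega>" for \<omega>
  proof -
    let ?m = "\<lambda>i. min (acceptance x i \<omega>) (acceptance y i \<omega>)"
    define \<tau> where "\<tau> = (\<Sum>i\<le>p. max 0 (acceptance x i \<omega> - acceptance y i \<omega>))"
    define s where "s = (\<Sum>i\<in>{1..p}. ?m i)"
    have idx: "{..p} = insert 0 {1..p}" by auto
    have "?m 0 + s = (\<Sum>i\<le>p. ?m i)"
      unfolding s_def idx by simp
    also have "\<dots> = 1 - \<tau>"
      using sum_min_eq[of "{..p}" "\<lambda>i. acceptance x i \<omega>" "\<lambda>i. acceptance y i \<omega>"]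
      by (simp add: \<tau>_def sum_acceptance)
    finally have m_sum: "?m 0 + s = 1 - \<tau>" .
    have s_ge: "accept_floor \<omega> \<le> s"
    proof -
      have "accept_floor \<omega> \<le> ?m 1" using accept_floor_le by simp
      also have "\<dots> \<le> s"
        unfolding s_def using p1 by (intro member_le_sum) (auto simp: acceptance_nonneg)
      finally show ?thesis .
    qed
    have "?S \<omega> \<le> (\<Sum>i\<le>p. ?m i * ?h \<omega> i i) + \<tau> * 1"
      unfolding coupled_weight_def \<tau>_def fst_conv snd_conv
      by (intro sum_maximal_coupling_le g1) (auto simp: sum_acceptance)
    also have "(\<Sum>i\<le>p. ?m i * ?h \<omega> i i) = ?m 0 * g ?D + s * g (\<rho>\<^sup>2 * ?D)"
    proof -
      have "(\<Sum>i\<in>{1..p}. ?m i * ?h \<omega> i i) = (\<Sum>i\<in>{1..p}. ?m i * g (\<rho>\<^sup>2 * ?D))"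
        by (intro sum.cong) (auto simp: proposal_def simp flip: scaleR_diff_right)
      then show ?thesis
        unfolding idx s_def sum_distrib_right by (simp add: proposal_def)
    qed
    also have "?m 0 * g ?D + s * g (\<rho>\<^sup>2 * ?D) + \<tau> * 1
        = g ?D + \<tau> * ?E - s * (g ?D - g (\<rho>\<^sup>2 * ?D))"
    proof -
      have m0: "?m 0 = 1 - \<tau> - s" using m_sum by simp
      show ?thesis unfolding m0 g_def by (simp add: algebra_simps)
    qed
    also have "\<dots> \<le> g ?D + 2 * L * ?D * ?E - accept_floor \<omega> * (?E * (a * (1 - \<rho>\<^sup>2) * ?D))"
    proof -
      have "g ?D - g (\<rho>\<^sup>2 * ?D) = ?E * (exp (a * (1 - \<rho>\<^sup>2) * ?D) - 1)"
        by (simp add: g_def algebra_simps flip: exp_add)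
      moreover have "?E * (exp (a * (1 - \<rho>\<^sup>2) * ?D) - 1) \<ge> ?E * (a * (1 - \<rho>\<^sup>2) * ?D)"
        using exp_ge_add_one_self[of "a * (1 - \<rho>\<^sup>2) * ?D"] by (intro mult_left_mono) (linarith, simp)
      ultimately have "?E * (a * (1 - \<rho>\<^sup>2) * ?D) \<le> g ?D - g (\<rho>\<^sup>2 * ?D)" by simp
      then have "accept_floor \<omega> * (?E * (a * (1 - \<rho>\<^sup>2) * ?D)) \<le> s * (g ?D - g (\<rho>\<^sup>2 * ?D))"
        using s_ge accept_floor_pos[of \<omega>] a \<rho>0 \<rho>1
        by (intro mult_mono) (auto simp: power_le_one)
      moreover have "\<tau> * ?E \<le> 2 * L * ?D * ?E"
        unfolding \<tau>_def by (intro mult_right_mono acceptance_excess_le) auto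
      ultimately show ?thesis by linarith
    qed
    finally show ?thesis by (simp add: algebra_simps)
  qed
  have "(\<integral>\<^sup>+w. ennreal (g (norm (fst w - snd w))) \<partial>coupled_kernel (x, y)) = (\<integral>\<^sup>+\<omega>. ennreal (?S \<omega>) \<partial>noise)"
  proof (subst nn_integral_coupled_kernel)
    show "(\<integral>\<^sup>+\<omega>. (\<Sum>(i, j)\<in>{..p} \<times> {..p}. ennreal (coupled_weight (x, y) (i, j) \<omega>)
        * ennreal (g (norm (fst (proposal (fst (x, y)) i \<omega>, proposal (snd (x, y)) j \<omega>)
            - snd (proposal (fst (x, y)) i \<omega>, proposal (snd (x, y)) j \<omega>))))) \<partial>noise)
      = (\<integral>\<^sup>+\<omega>. ennreal (?S \<omega>) \<partial>noise)"
      by (intro nn_integral_cong, subst sum_ennreal[symmetric])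
         (auto simp: case_prod_beta' ennreal_mult coupled_weight_nonneg g0 intro!: sum.cong)
  qed (simp add: g_def)
  also have "\<dots> \<le> (\<integral>\<^sup>+\<omega>. ennreal (?R \<omega>) \<partial>noise)"
    by (intro nn_integral_mono ennreal_leI bound)
  also have "\<dots> = ennreal ((g ?D + 2 * L * ?D * ?E) - ?E * ?D * (a * (1 - \<rho>\<^sup>2)) * accept_rate)"
    using order_trans[OF S0 bound] by (intro nn_integral_affine_accept_floor)
  finally show ?thesis by (simp add: algebra_simps)
qed

end

section \<open>Drift and contraction constants\<close>

lemma ennreal_power2_le_imp_le:
  fixes x :: ennreal
  assumes "x\<^sup>2 \<le> (ennreal B)\<^sup>2" "0 \<le> B"
  shows "x \<le> ennreal B"
proof (cases x)
  case (real r)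
  then have "r\<^sup>2 \<le> B\<^sup>2" using assms by (simp add: ennreal_power)
  then show ?thesis using power2_le_imp_le[of r B] real assms(2) by (simp add: ennreal_leI)
next
  case top
  then show ?thesis using assms by (simp add: ennreal_power top_unique)
qed

lemma nn_integral_sqrt_mult_le:
  fixes f g :: "'b \<Rightarrow> real"
  assumes [measurable]: "f \<in> borel_measurable M" "g \<in> borel_measurable M"
    and f0: "\<And>x. 0 \<le> f x" and g0: "\<And>x. 0 \<le> g x"
    and F: "(\<integral>\<^sup>+x. ennreal (f x) \<partial>M) \<le> ennreal F" and G: "(\<integral>\<^sup>+x. ennreal (g x) \<partial>M) \<le> ennreal G"
    and B: "0 \<le> B" "F * G \<le> B\<^sup>2" "0 \<le> F" "0 \<le> G"
  shows "(\<integral>\<^sup>+x. ennreal (sqrt (f x * g x)) \<partial>M) \<le> ennreal B"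
proof -
  let ?I = "\<integral>\<^sup>+x. ennreal (sqrt (f x * g x)) \<partial>M"
  have "?I\<^sup>2 = (\<integral>\<^sup>+x. ennreal (sqrt (f x)) * ennreal (sqrt (g x)) \<partial>M)\<^sup>2"
    using f0 g0 by (simp add: real_sqrt_mult ennreal_mult)
  also have "\<dots> \<le> (\<integral>\<^sup>+x. ennreal (sqrt (f x)) ^ 2 \<partial>M) * (\<integral>\<^sup>+x. ennreal (sqrt (g x)) ^ 2 \<partial>M)"
    by (rule Cauchy_Schwarz_nn_integral) measurable
  also have "\<dots> = (\<integral>\<^sup>+x. ennreal (f x) \<partial>M) * (\<integral>\<^sup>+x. ennreal (g x) \<partial>M)"
    using f0 g0 by (simp add: ennreal_power)
  also have "\<dots> \<le> ennreal F * ennreal G" by (rule mult_mono[OF F G]) auto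
  also have "\<dots> = ennreal (F * G)" using B by (simp add: ennreal_mult)
  also have "\<dots> \<le> ennreal (B\<^sup>2)" using B by (intro ennreal_leI)
  finally have "?I\<^sup>2 \<le> (ennreal B)\<^sup>2" using B by (simp add: ennreal_power)
  then show ?thesis by (rule ennreal_power2_le_imp_le) (rule B)
qed

text \<open>The balance of the weak Harris theorem. Here \<open>l\<close> and \<open>K\<close> are the constants of the drift condition
  and \<open>W\<close> stands for \<open>V x + V y\<close>. If \<open>W\<close> is below the level \<open>4 K / (1 - l)\<close> then \<open>D\<close> is bounded, the distance
  factor shrinks by \<open>1 - \<eta>\<close>, and \<open>\<beta>\<close> is so small that the other factor grows by \<open>1 + \<eta>\<close> at
  most. Above this level the drift shrinks the second factor while the distance factor does not grow.\<close>

lemma harris_constants: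
  fixes l K a d :: real
  assumes l: "0 \<le> l" "l < 1" and K: "1 \<le> K" and a: "0 < a"
  obtains \<beta> \<gamma> where "0 < \<beta>" "0 < \<gamma>" "\<gamma> < 1"
    "\<And>D W. \<lbrakk>0 \<le> D; 0 \<le> W; W \<le> 4 * K / (1 - l) \<Longrightarrow> D \<le> d\<rbrakk> \<Longrightarrow>
      (1 - exp (- a * D) - exp (- a * D) * D) * (1 + \<beta> * (l * W + 2 * K))
        \<le> \<gamma>\<^sup>2 * ((1 - exp (- a * D)) * (1 + \<beta> * W))"
proof -
  define \<eta> where "\<eta> = min (exp (- a * d) / a) (1 / 2)"
  define \<beta> where "\<beta> = \<eta> / (2 * K)"
  define M where "M = 4 * K / (1 - l)"
  define m where "m = (1 + l) / 2"
  define \<gamma>1 where "\<gamma>1 = 1 - \<eta>\<^sup>2"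
  define \<gamma>2 where "\<gamma>2 = (1 + \<beta> * m * M) / (1 + \<beta> * M)"
  define \<gamma> where "\<gamma> = sqrt (max \<gamma>1 \<gamma>2)"
  have \<eta>: "0 < \<eta>" "\<eta> < 1" using a by (auto simp: \<eta>_def)
  have \<beta>: "0 < \<beta>" using \<eta> K by (simp add: \<beta>_def)
  have \<beta>K: "\<beta> * (2 * K) = \<eta>" using K by (simp add: \<beta>_def)
  have M: "0 < M" using l K by (simp add: M_def)
  have m: "0 < m" "m < 1" "l \<le> m" using l by (auto simp: m_def)
  have \<gamma>1: "0 < \<gamma>1" "\<gamma>1 < 1"
    using \<eta> by (auto simp: \<gamma>1_def power_less_one_iff abs_square_less_1)
  have \<gamma>2: "\<gamma>2 < 1"
    using \<beta> M m by (simp add: \<gamma>2_def add_pos_pos)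
  have \<gamma>sq: "\<gamma>\<^sup>2 = max \<gamma>1 \<gamma>2" using \<gamma>1 by (simp add: \<gamma>_def)
  show thesis
  proof (rule that[OF \<beta>, of \<gamma>])
    show "0 < \<gamma>" "\<gamma> < 1" using \<gamma>1 \<gamma>2 by (auto simp: \<gamma>_def less_max_iff_disj)
    fix D W :: real
    assume D: "0 \<le> D" and W: "0 \<le> W" and lev: "W \<le> 4 * K / (1 - l) \<Longrightarrow> D \<le> d"
    let ?E = "exp (- a * D)"
    have E1: "?E \<le> 1" using a D by simp
    have rhs0: "0 \<le> (1 - ?E) * (1 + \<beta> * W)" using E1 \<beta> W by simp
    show "(1 - ?E - ?E * D) * (1 + \<beta> * (l * W + 2 * K)) \<le> \<gamma>\<^sup>2 * ((1 - ?E) * (1 + \<beta> * W))"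
    proof (cases "W \<le> M")
      case True
      then have "D \<le> d" using lev by (simp add: M_def)
      then have "exp (- a * d) \<le> ?E" using a by simp
      moreover have "1 - ?E \<le> a * D" using exp_ge_add_one_self[of "- a * D"] by simp
      ultimately have "exp (- a * d) * (1 - ?E) \<le> ?E * (a * D)"
        using E1 by (intro mult_mono) auto
      then have "exp (- a * d) / a * (1 - ?E) \<le> ?E * D"
        using a by (simp add: field_simps)
      moreover have "\<eta> * (1 - ?E) \<le> exp (- a * d) / a * (1 - ?E)"
        using E1 by (intro mult_right_mono) (auto simp: \<eta>_def)
      ultimately have "1 - ?E - ?E * D \<le> (1 - \<eta>) * (1 - ?E)" by (simp add: algebra_simps)
      moreover have "1 + \<beta> * (l * W + 2 * K) \<le> (1 + \<eta>) * (1 + \<beta> * W)"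
      proof -
        have "\<beta> * (l * W) \<le> \<beta> * W" using l W \<beta> by (simp add: mult_left_le_one_le)
        moreover have "0 \<le> \<eta> * (\<beta> * W)" using \<eta> \<beta> W by simp
        ultimately show ?thesis using \<beta>K by (simp add: algebra_simps)
      qed
      ultimately have "(1 - ?E - ?E * D) * (1 + \<beta> * (l * W + 2 * K))
          \<le> ((1 - \<eta>) * (1 - ?E)) * ((1 + \<eta>) * (1 + \<beta> * W))"
        using \<eta> E1 \<beta> l W K by (intro mult_mono) auto
      also have "\<dots> = \<gamma>1 * ((1 - ?E) * (1 + \<beta> * W))"
        by (simp add: \<gamma>1_def power2_eq_square algebra_simps)
      also have "\<dots> \<le> \<gamma>\<^sup>2 * ((1 - ?E) * (1 + \<beta> * W))"
        using rhs0 by (intro mult_right_mono) (auto simp: \<gamma>sq)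
      finally show ?thesis .
    next
      case False
      have "2 * K = (1 - l) / 2 * M" using l by (simp add: M_def)
      also have "\<dots> \<le> (1 - l) / 2 * W" using False l by (intro mult_left_mono) auto
      finally have "l * W + 2 * K \<le> m * W" by (simp add: m_def algebra_simps add_divide_distrib)
      then have "1 + \<beta> * (l * W + 2 * K) \<le> 1 + \<beta> * (m * W)" using \<beta> by simp
      also have "\<dots> \<le> \<gamma>2 * (1 + \<beta> * W)"
      proof -
        have "(1 - m) * (\<beta> * M) \<le> (1 - m) * (\<beta> * W)"
          using False m \<beta> by (intro mult_left_mono) auto
        then have "(1 + \<beta> * (m * W)) * (1 + \<beta> * M) \<le> (1 + \<beta> * m * M) * (1 + \<beta> * W)"
          by (simp add: algebra_simps)
        moreover have "0 < 1 + \<beta> * M" using \<beta> M by (simp add: add_pos_pos)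
        ultimately show ?thesis by (simp add: \<gamma>2_def pos_le_divide_eq)
      qed
      finally have 1: "1 + \<beta> * (l * W + 2 * K) \<le> \<gamma>2 * (1 + \<beta> * W)" .
      have "(1 - ?E - ?E * D) * (1 + \<beta> * (l * W + 2 * K)) \<le> (1 - ?E) * (\<gamma>2 * (1 + \<beta> * W))"
        using 1 D E1 \<beta> l W K by (intro mult_mono) auto
      also have "\<dots> = \<gamma>2 * ((1 - ?E) * (1 + \<beta> * W))" by simp
      also have "\<dots> \<le> \<gamma>\<^sup>2 * ((1 - ?E) * (1 + \<beta> * W))"
        using rhs0 by (intro mult_right_mono) (auto simp: \<gamma>sq)
      finally show ?thesis .
    qed
  qed
qed

text \<open>The three families of Lyapunov functions are functions \<open>\<phi>\<close> of the norm, and the drift argument uses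
  them only through the following properties. The factor \<open>(1 + \<rho>\<^sup>2) / 2\<close> is a choice between
  \<open>\<rho>\<^sup>2\<close> and \<open>1\<close>; the increments in \<open>\<phi>_moment\<close> are scaled by the constant that this choice
  produces in \<open>\<phi>_affine_le\<close>.\<close>

locale mpcn_lyapunov = mpcn_bounded +
  fixes \<phi> :: "real \<Rightarrow> real"
  assumes \<phi>_mono: "\<And>s t. 0 \<le> s \<Longrightarrow> s \<le> t \<Longrightarrow> \<phi> s \<le> \<phi> t"
    and \<phi>_nonneg: "\<And>t. 0 \<le> t \<Longrightarrow> 0 \<le> \<phi> t"
    and \<phi>_measurable [measurable]: "\<phi> \<in> borel_measurable borel"
    and \<phi>_shrink: "\<And>t. 0 \<le> t \<Longrightarrow> \<phi> ((1 + \<rho>\<^sup>2) / 2 * t) \<le> (1 + \<rho>\<^sup>2) / 2 * \<phi> t + 1"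
    and \<phi>_levels: "\<And>B. \<exists>R. \<forall>t\<ge>0. \<phi> t \<le> B \<longrightarrow> t \<le> R"
    and \<phi>_moment: "\<And>i. i \<in> {1..p} \<Longrightarrow>
      (\<integral>\<^sup>+\<omega>. ennreal (\<phi> ((1 + \<rho>\<^sup>2) / (1 - \<rho>\<^sup>2) * norm (increment i \<omega>))) \<partial>noise) < \<infinity>"
begin

abbreviation "q \<equiv> (1 + \<rho>\<^sup>2) / 2"

lemma \<rho>sq: "0 \<le> \<rho>\<^sup>2" "\<rho>\<^sup>2 < 1"
  using \<rho>0 \<rho>1 by (auto simp: power_less_one_iff abs_square_less_1)

text \<open>If the increment is small compared to \<open>t\<close> then it is absorbed by enlarging the factor \<open>\<rho>\<^sup>2\<close> to
  \<open>q\<close>; otherwise \<open>t\<close> is bounded by a multiple of the increment.\<close>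

lemma \<phi>_affine_le:
  assumes "0 \<le> t" "0 \<le> n"
  shows "\<phi> (\<rho>\<^sup>2 * t + n) \<le> q * \<phi> t + 1 + \<phi> ((1 + \<rho>\<^sup>2) / (1 - \<rho>\<^sup>2) * n)"
proof (cases "n \<le> (1 - \<rho>\<^sup>2) / 2 * t")
  case True
  then have "\<phi> (\<rho>\<^sup>2 * t + n) \<le> \<phi> (q * t)"
    using assms \<rho>sq by (intro \<phi>_mono) (auto simp: field_simps)
  then show ?thesis
    using \<phi>_shrink[OF assms(1)] \<phi>_nonneg[of "(1 + \<rho>\<^sup>2) / (1 - \<rho>\<^sup>2) * n"] assms \<rho>sq by auto
next
  case False
  then have "(1 - \<rho>\<^sup>2) * t \<le> 2 * n" by (simp add: field_simps)
  then have "\<rho>\<^sup>2 * ((1 - \<rho>\<^sup>2) * t) \<le> \<rho>\<^sup>2 * (2 * n)"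
    using \<rho>sq by (intro mult_left_mono) auto
  then have "\<rho>\<^sup>2 * t + n \<le> (1 + \<rho>\<^sup>2) / (1 - \<rho>\<^sup>2) * n"
    using \<rho>sq by (simp add: field_simps)
  then have "\<phi> (\<rho>\<^sup>2 * t + n) \<le> \<phi> ((1 + \<rho>\<^sup>2) / (1 - \<rho>\<^sup>2) * n)"
    using assms \<rho>sq by (intro \<phi>_mono) auto
  then show ?thesis using \<phi>_nonneg[OF assms(1)] \<rho>sq by (simp add: add_increasing)
qed

definition drift_const :: real where
  "drift_const = 1 + enn2real (\<Sum>i\<in>{1..p}.
     \<integral>\<^sup>+\<omega>. ennreal (\<phi> ((1 + \<rho>\<^sup>2) / (1 - \<rho>\<^sup>2) * norm (increment i \<omega>))) \<partial>noise)"

definition drift_rate :: real where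
  "drift_rate = 1 - (1 - q) * accept_rate"

lemma drift_const_ge: "1 \<le> drift_const"
  by (simp add: drift_const_def)

lemma drift_rate: "0 \<le> drift_rate" "drift_rate < 1"
proof -
  have "0 < 1 - q" "1 - q \<le> 1" using \<rho>sq by auto
  then have "0 < (1 - q) * accept_rate" "(1 - q) * accept_rate \<le> 1 * 1"
    using accept_rate_bounds by (simp, intro mult_mono) auto
  then show "0 \<le> drift_rate" "drift_rate < 1" by (auto simp: drift_rate_def)
qed

text \<open>Rejection leaves \<open>V x\<close> unchanged, while the acceptance of any proposal shrinks it by the factor \<open>q\<close> up to a
  function of the noise; acceptance has probability at least \<open>accept_floor\<close>.\<close>

lemma kernel_drift:
  "(\<integral>\<^sup>+y. ennreal (\<phi> (norm y)) \<partial>kernel x) \<le> ennreal (drift_rate * \<phi> (norm x) + drift_const)"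
proof -
  interpret N: prob_space noise by (rule prob_space_noise)
  let ?b = "(1 + \<rho>\<^sup>2) / (1 - \<rho>\<^sup>2)"
  let ?V = "\<phi> (norm x)"
  let ?J = "\<lambda>i \<omega>. \<phi> (?b * norm (increment i \<omega>))"
  have b0: "0 \<le> ?b" using \<rho>sq by simp
  have J0: "0 \<le> ?J i \<omega>" for i \<omega>
    using b0 by (intro \<phi>_nonneg mult_nonneg_nonneg) auto
  have V0: "0 \<le> ?V" by (simp add: \<phi>_nonneg)
  have idx: "{..p} = insert 0 {1..p}" by auto
  have R0: "0 \<le> ?V - (1 - q) * ?V * accept_floor \<omega>" for \<omega>
  proof -
    have "(1 - q) * accept_floor \<omega> \<le> 1 * 1"
      using accept_floor_le_1 accept_floor_pos[of \<omega>] \<rho>sq by (intro mult_mono) auto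
    then have "((1 - q) * accept_floor \<omega>) * ?V \<le> 1 * ?V" using V0 by (intro mult_right_mono) auto
    then show ?thesis by (simp add: algebra_simps)
  qed
  have Jm: "(\<lambda>\<omega>. ennreal (?J i \<omega>)) \<in> borel_measurable noise" if "i \<in> {1..p}" for i
    using measurable_increment[OF that] by measurable
  have bound: "(\<Sum>i\<le>p. acceptance x i \<omega> * \<phi> (norm (proposal x i \<omega>)))
      \<le> (?V - (1 - q) * ?V * accept_floor \<omega>) + 1 + (\<Sum>i\<in>{1..p}. ?J i \<omega>)" for \<omega>
  proof -
    let ?s = "\<Sum>i\<in>{1..p}. acceptance x i \<omega>"
    have s: "acceptance x 0 \<omega> = 1 - ?s"
      using sum_acceptance[of x \<omega>] unfolding idx by simp
    have "accept_floor \<omega> \<le> acceptance x 1 \<omega>" by (rule accept_floor_le)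
    also have "\<dots> \<le> ?s"
      using p1 by (intro member_le_sum) (auto simp: acceptance_nonneg)
    finally have s_ge: "accept_floor \<omega> \<le> ?s" .
    have s_le: "?s \<le> 1" using s acceptance_nonneg[of x 0 \<omega>] by simp
    have "(\<Sum>i\<in>{1..p}. acceptance x i \<omega> * \<phi> (norm (proposal x i \<omega>)))
        \<le> (\<Sum>i\<in>{1..p}. acceptance x i \<omega> * (q * ?V + 1) + ?J i \<omega>)"
    proof (rule sum_mono)
      fix i assume i: "i \<in> {1..p}"
      have "norm (proposal x i \<omega>) \<le> \<rho>\<^sup>2 * norm x + norm (increment i \<omega>)"
        using i norm_triangle_ineq[of "\<rho>\<^sup>2 *\<^sub>R x" "increment i \<omega>"] by (simp add: proposal_def)
      then have "\<phi> (norm (proposal x i \<omega>)) \<le> \<phi> (\<rho>\<^sup>2 * norm x + norm (increment i \<omega>))"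
        by (intro \<phi>_mono) auto
      also have "\<dots> \<le> q * ?V + 1 + ?J i \<omega>" by (rule \<phi>_affine_le) auto
      finally have "acceptance x i \<omega> * \<phi> (norm (proposal x i \<omega>)) \<le> acceptance x i \<omega> * (q * ?V + 1 + ?J i \<omega>)"
        by (intro mult_left_mono acceptance_nonneg)
      also have "\<dots> = acceptance x i \<omega> * (q * ?V + 1) + acceptance x i \<omega> * ?J i \<omega>"
        by (simp only: distrib_left)
      also have "\<dots> \<le> acceptance x i \<omega> * (q * ?V + 1) + ?J i \<omega>"
        using i acceptance_le_1[of i x \<omega>] J0[of i \<omega>]
        by (intro add_left_mono mult_left_le_one_le acceptance_nonneg) auto
      finally show "acceptance x i \<omega> * \<phi> (norm (proposal x i \<omega>)) \<le> acceptance x i \<omega> * (q * ?V + 1) + ?J i \<omega>" .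
    qed
    also have "\<dots> = ?s * (q * ?V + 1) + (\<Sum>i\<in>{1..p}. ?J i \<omega>)"
      by (simp only: sum.distrib sum_distrib_right)
    finally have 1: "(\<Sum>i\<in>{1..p}. acceptance x i \<omega> * \<phi> (norm (proposal x i \<omega>)))
        \<le> ?s * (q * ?V + 1) + (\<Sum>i\<in>{1..p}. ?J i \<omega>)" .
    have "(\<Sum>i\<le>p. acceptance x i \<omega> * \<phi> (norm (proposal x i \<omega>)))
        = acceptance x 0 \<omega> * ?V + (\<Sum>i\<in>{1..p}. acceptance x i \<omega> * \<phi> (norm (proposal x i \<omega>)))"
      unfolding idx by (simp add: proposal_def)
    also have "\<dots> \<le> (1 - ?s) * ?V + (?s * (q * ?V + 1) + (\<Sum>i\<in>{1..p}. ?J i \<omega>))"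
      unfolding s using 1 by simp
    also have "\<dots> = ?V - ((1 - q) * ?V) * ?s + ?s + (\<Sum>i\<in>{1..p}. ?J i \<omega>)"
      by (simp only: algebra_simps)
    also have "\<dots> \<le> ?V - ((1 - q) * ?V) * accept_floor \<omega> + 1 + (\<Sum>i\<in>{1..p}. ?J i \<omega>)"
      using s_ge s_le V0 \<rho>sq by (intro add_mono diff_mono mult_left_mono mult_nonneg_nonneg) auto
    finally show ?thesis .
  qed
  have "(\<integral>\<^sup>+y. ennreal (\<phi> (norm y)) \<partial>kernel x)
      = (\<integral>\<^sup>+\<omega>. (\<Sum>i\<le>p. ennreal (acceptance x i \<omega>) * ennreal (\<phi> (norm (proposal x i \<omega>)))) \<partial>noise)"
    unfolding kernel_def
    by (rule nn_integral_mixture) (auto intro: measurable_acceptance measurable_proposal sigma_finite_noise)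
  also have "\<dots> = (\<integral>\<^sup>+\<omega>. ennreal (\<Sum>i\<le>p. acceptance x i \<omega> * \<phi> (norm (proposal x i \<omega>))) \<partial>noise)"
    by (intro nn_integral_cong, subst sum_ennreal[symmetric])
       (auto simp: ennreal_mult acceptance_nonneg \<phi>_nonneg intro!: sum.cong)
  also have "\<dots> \<le> (\<integral>\<^sup>+\<omega>. ennreal (?V - (1 - q) * ?V * accept_floor \<omega>) + (1 + (\<Sum>i\<in>{1..p}. ennreal (?J i \<omega>))) \<partial>noise)"
  proof (rule nn_integral_mono)
    fix \<omega>
    have "ennreal (\<Sum>i\<le>p. acceptance x i \<omega> * \<phi> (norm (proposal x i \<omega>)))
        \<le> ennreal ((?V - (1 - q) * ?V * accept_floor \<omega>) + (1 + (\<Sum>i\<in>{1..p}. ?J i \<omega>)))"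
      using bound[of \<omega>] by (intro ennreal_leI) simp
    also have "\<dots> = ennreal (?V - (1 - q) * ?V * accept_floor \<omega>) + ennreal (1 + (\<Sum>i\<in>{1..p}. ?J i \<omega>))"
      by (intro ennreal_plus R0 add_nonneg_nonneg sum_nonneg J0) simp
    also have "ennreal (1 + (\<Sum>i\<in>{1..p}. ?J i \<omega>)) = 1 + (\<Sum>i\<in>{1..p}. ennreal (?J i \<omega>))"
      by (simp only: ennreal_plus[OF zero_le_one sum_nonneg[OF J0]] ennreal_1 sum_ennreal[OF J0])
    finally show "ennreal (\<Sum>i\<le>p. acceptance x i \<omega> * \<phi> (norm (proposal x i \<omega>)))
        \<le> ennreal (?V - (1 - q) * ?V * accept_floor \<omega>) + (1 + (\<Sum>i\<in>{1..p}. ennreal (?J i \<omega>)))" .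
  qed
  also have "\<dots> = (\<integral>\<^sup>+\<omega>. ennreal (?V - (1 - q) * ?V * accept_floor \<omega>) \<partial>noise)
      + (\<integral>\<^sup>+\<omega>. 1 + (\<Sum>i\<in>{1..p}. ennreal (?J i \<omega>)) \<partial>noise)"
    using Jm by (intro nn_integral_add) auto
  also have "(\<integral>\<^sup>+\<omega>. ennreal (?V - (1 - q) * ?V * accept_floor \<omega>) \<partial>noise) = ennreal (?V - (1 - q) * ?V * accept_rate)"
    by (rule nn_integral_affine_accept_floor[OF R0])
  also have "(\<integral>\<^sup>+\<omega>. 1 + (\<Sum>i\<in>{1..p}. ennreal (?J i \<omega>)) \<partial>noise)
      = 1 + (\<Sum>i\<in>{1..p}. \<integral>\<^sup>+\<omega>. ennreal (?J i \<omega>) \<partial>noise)"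
  proof -
    have "(\<integral>\<^sup>+\<omega>. (\<Sum>i\<in>{1..p}. ennreal (?J i \<omega>)) \<partial>noise) = (\<Sum>i\<in>{1..p}. \<integral>\<^sup>+\<omega>. ennreal (?J i \<omega>) \<partial>noise)"
      by (rule nn_integral_sum) (rule Jm)
    moreover have "(\<lambda>\<omega>. \<Sum>i\<in>{1..p}. ennreal (?J i \<omega>)) \<in> borel_measurable noise"
      by (rule borel_measurable_sum) (rule Jm)
    ultimately show ?thesis
      by (subst nn_integral_add) (simp_all only: nn_integral_const N.emeasure_space_1 mult_1
          measurable_const space_borel UNIV_I)
  qed
  also have "\<dots> = ennreal drift_const"
  proof -
    have "(\<Sum>i\<in>{1..p}. \<integral>\<^sup>+\<omega>. ennreal (?J i \<omega>) \<partial>noise) < top"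
      using \<phi>_moment by (simp add: less_top)
    then show ?thesis by (simp add: drift_const_def ennreal_plus del: ennreal_plus[symmetric])
  qed
  also have "ennreal (?V - (1 - q) * ?V * accept_rate) + ennreal drift_const
      = ennreal (drift_rate * ?V + drift_const)"
    using mult_nonneg_nonneg[OF drift_rate(1) V0] drift_const_ge
    by (subst ennreal_plus[symmetric]) (auto simp: drift_rate_def algebra_simps)
  finally show ?thesis .
qed

end

section \<open>Contraction of the coupling and of the transport cost\<close>

text \<open>Both \<open>1 - exp (- a D)\<close> and \<open>d_eps\<close> are concave, comparable to \<open>D\<close> near \<open>0\<close>, and bounded. For the second bound the
  exponential lies below its chord on \<open>[0, \<epsilon>]\<close>.\<close>

lemma d_eps_bounds:
  assumes "0 < a" "0 < \<epsilon>"
  shows "1 - exp (- a * norm (x - y)) \<le> (1 + a * \<epsilon>) * d_eps \<epsilon> x y"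
    and "(1 - exp (- a * \<epsilon>)) * d_eps \<epsilon> x y \<le> 1 - exp (- a * norm (x - y))"
proof -
  let ?D = "norm (x - y)"
  have le: "1 - exp (- a * ?D) \<le> a * ?D" using exp_ge_add_one_self[of "- a * ?D"] by simp
  show "1 - exp (- a * ?D) \<le> (1 + a * \<epsilon>) * d_eps \<epsilon> x y"
  proof (cases "\<epsilon> \<le> ?D")
    case True
    then have d: "d_eps \<epsilon> x y = 1" using assms by (simp add: d_eps_def field_simps)
    have "0 < exp (- a * ?D)" "0 < a * \<epsilon>" using assms by auto
    then show ?thesis unfolding d mult_1_right by linarith
  next
    case False
    then have d: "d_eps \<epsilon> x y = ?D / \<epsilon>" using assms by (simp add: d_eps_def field_simps)
    have "a * ?D = (a * \<epsilon>) * d_eps \<epsilon> x y" using assms by (simp add: d)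
    also have "\<dots> \<le> (1 + a * \<epsilon>) * d_eps \<epsilon> x y"
      using assms by (intro mult_right_mono) (auto simp: d)
    finally show ?thesis using le by simp
  qed
  show "(1 - exp (- a * \<epsilon>)) * d_eps \<epsilon> x y \<le> 1 - exp (- a * ?D)"
  proof (cases "\<epsilon> \<le> ?D")
    case True
    then have "d_eps \<epsilon> x y = 1" using assms by (simp add: d_eps_def field_simps)
    then show ?thesis using True assms by simp
  next
    case False
    then have d: "d_eps \<epsilon> x y = ?D / \<epsilon>" using assms by (simp add: d_eps_def field_simps)
    have t: "0 \<le> ?D / \<epsilon>" "?D / \<epsilon> \<le> 1" using False assms by (auto simp: field_simps)
    have "convex_on UNIV (exp :: real \<Rightarrow> real)" by (rule exp_convex)
    from convex_onD[OF this t, of 0 "- a * \<epsilon>"]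
    have "exp (?D / \<epsilon> * (- a * \<epsilon>)) \<le> (1 - ?D / \<epsilon>) + ?D / \<epsilon> * exp (- a * \<epsilon>)" by simp
    moreover have "?D / \<epsilon> * (- a * \<epsilon>) = - a * ?D" using assms by simp
    ultimately show ?thesis by (simp add: d algebra_simps)
  qed
qed

lemma d_eps_nonneg: "0 < \<epsilon> \<Longrightarrow> 0 \<le> d_eps \<epsilon> x y"
  by (simp add: d_eps_def)

lemma d_tilde_equivalent:
  fixes V :: "'a::real_normed_vector \<Rightarrow> real"
  assumes "0 < a" "0 < \<beta>" "0 < \<epsilon>" and V: "\<And>x. 0 \<le> V x"
  defines "H \<equiv> \<lambda>x y. sqrt ((1 - exp (- a * norm (x - y))) * (1 + \<beta> * (V x + V y)))"
  obtains c1 c2 where "0 < c1" "0 < c2"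
    "\<And>x y. d_tilde V \<epsilon> x y \<le> c1 * H x y" "\<And>x y. H x y \<le> c2 * d_tilde V \<epsilon> x y"
proof
  let ?u = "1 / (1 - exp (- a * \<epsilon>)) * (1 + 1 / \<beta>)" and ?l = "(1 + a * \<epsilon>) * (1 + \<beta>)"
  have e: "0 < 1 - exp (- a * \<epsilon>)" using assms by simp
  have "0 < ?u"
    using assms(2) e by (intro mult_pos_pos add_pos_pos divide_pos_pos zero_less_one)
  moreover have "0 < ?l"
    using assms(1-3) by (intro mult_pos_pos add_pos_pos zero_less_one)
  ultimately show "0 < sqrt ?u" "0 < sqrt ?l" by (simp_all only: real_sqrt_gt_0_iff)
  fix x y :: 'a
  let ?g = "1 - exp (- a * norm (x - y))" and ?W = "V x + V y"
  have g0: "0 \<le> ?g" and W0: "0 \<le> ?W" using assms V[of x] V[of y] by auto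
  have "d_eps \<epsilon> x y * (1 + ?W) \<le> (1 / (1 - exp (- a * \<epsilon>)) * ?g) * ((1 + 1 / \<beta>) * (1 + \<beta> * ?W))"
  proof (intro mult_mono)
    show "d_eps \<epsilon> x y \<le> 1 / (1 - exp (- a * \<epsilon>)) * ?g"
      using d_eps_bounds(2)[OF assms(1,3), of x y] e by (simp add: field_simps)
    have "(1 + 1 / \<beta>) * (1 + \<beta> * ?W) = 1 + ?W + (\<beta> * ?W + 1 / \<beta>)"
      using assms by (simp add: field_simps)
    then show "1 + ?W \<le> (1 + 1 / \<beta>) * (1 + \<beta> * ?W)" using assms W0 by simp
  qed (use g0 W0 e in auto)
  then have "d_eps \<epsilon> x y * (1 + ?W) \<le> ?u * (?g * (1 + \<beta> * ?W))" by (simp only: mult_ac)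
  from real_sqrt_le_mono[OF this] show "d_tilde V \<epsilon> x y \<le> sqrt ?u * H x y"
    by (simp only: d_tilde_def H_def real_sqrt_mult add.assoc)
  have "?g * (1 + \<beta> * ?W) \<le> ((1 + a * \<epsilon>) * d_eps \<epsilon> x y) * ((1 + \<beta>) * (1 + ?W))"
  proof (intro mult_mono)
    show "?g \<le> (1 + a * \<epsilon>) * d_eps \<epsilon> x y" by (rule d_eps_bounds(1)[OF assms(1,3)])
    have "(1 + \<beta>) * (1 + ?W) = 1 + \<beta> * ?W + (?W + \<beta>)" by (simp add: algebra_simps)
    then show "1 + \<beta> * ?W \<le> (1 + \<beta>) * (1 + ?W)" using assms W0 by simp
    show "0 \<le> (1 + a * \<epsilon>) * d_eps \<epsilon> x y"
      using assms by (intro mult_nonneg_nonneg d_eps_nonneg) auto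
    show "0 \<le> 1 + \<beta> * ?W" using assms W0 by simp
  qed
  then have "?g * (1 + \<beta> * ?W) \<le> ?l * (d_eps \<epsilon> x y * (1 + ?W))" by (simp only: mult_ac)
  from real_sqrt_le_mono[OF this] show "H x y \<le> sqrt ?l * d_tilde V \<epsilon> x y"
    by (simp only: d_tilde_def H_def real_sqrt_mult add.assoc)
qed

context mpcn_lyapunov
begin

abbreviation V :: "'a \<Rightarrow> real" where "V x \<equiv> \<phi> (norm x)"

lemma prob_space_coupled_kernel: "prob_space (coupled_kernel z)"
  unfolding coupled_kernel_def
  by (intro prob_space_mixture prob_space_noise measurable_coupled_weight
        measurable_coupled_proposal coupled_weight_nonneg sum_coupled_weight) auto

lemma coupled_kernel_drift:
  assumes "0 \<le> \<beta>"
  shows "(\<integral>\<^sup>+w. ennreal (1 + \<beta> * (V (fst w) + V (snd w))) \<partial>coupled_kernel (x, y))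
    \<le> ennreal (1 + \<beta> * (drift_rate * (V x + V y) + 2 * drift_const))"
proof -
  let ?K = "coupled_kernel (x, y)"
  interpret K: prob_space ?K by (rule prob_space_coupled_kernel)
  have [measurable_cong]: "sets ?K = sets (borel \<Otimes>\<^sub>M borel)" by (simp add: coupled_kernel_def)
  have V0: "0 \<le> V z" for z by (simp add: \<phi>_nonneg)
  have 1: "(\<integral>\<^sup>+w. ennreal (V (fst w)) \<partial>?K) \<le> ennreal (drift_rate * V x + drift_const)"
    using kernel_drift[of x] unfolding distr_coupled_kernel(1)[of x y, symmetric]
    by (subst (asm) nn_integral_distr) measurable
  have 2: "(\<integral>\<^sup>+w. ennreal (V (snd w)) \<partial>?K) \<le> ennreal (drift_rate * V y + drift_const)"
    using kernel_drift[of y] unfolding distr_coupled_kernel(2)[of x y, symmetric]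
    by (subst (asm) nn_integral_distr) measurable
  have "(\<integral>\<^sup>+w. ennreal (1 + \<beta> * (V (fst w) + V (snd w))) \<partial>?K)
      = (\<integral>\<^sup>+w. 1 + ennreal \<beta> * (ennreal (V (fst w)) + ennreal (V (snd w))) \<partial>?K)"
    using assms V0 by (intro nn_integral_cong) (simp add: ennreal_mult ennreal_plus add_nonneg_nonneg
        flip: ennreal_1)
  also have "\<dots> = 1 + ennreal \<beta> * ((\<integral>\<^sup>+w. ennreal (V (fst w)) \<partial>?K) + (\<integral>\<^sup>+w. ennreal (V (snd w)) \<partial>?K))"
    by (simp add: nn_integral_add nn_integral_cmult K.emeasure_space_1)
  also have "\<dots> \<le> 1 + ennreal \<beta> * (ennreal (drift_rate * V x + drift_const) + ennreal (drift_rate * V y + drift_const))"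
    by (intro add_left_mono mult_left_mono add_mono 1 2) simp
  also have "\<dots> = ennreal (1 + \<beta> * ((drift_rate * V x + drift_const) + (drift_rate * V y + drift_const)))"
  proof -
    have "0 \<le> drift_rate * V z + drift_const" for z
      using mult_nonneg_nonneg[OF drift_rate(1) V0] drift_const_ge by (simp add: add_nonneg_nonneg)
    then show ?thesis
      by (simp only: ennreal_plus[symmetric] ennreal_mult[OF assms, symmetric] ennreal_1[symmetric]
          add_nonneg_nonneg mult_nonneg_nonneg assms zero_le_one)
  qed
  also have "(drift_rate * V x + drift_const) + (drift_rate * V y + drift_const)
      = drift_rate * (V x + V y) + 2 * drift_const" by (simp add: algebra_simps)
  finally show ?thesis .
qed

text \<open>The slope \<open>a\<close> is chosen so that the gain of the distance estimate exceeds its cost by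
  exactly one unit of \<open>exp (- a D) D\<close>.\<close>

theorem coupled_kernel_contracts:
  obtains a \<beta> \<gamma> where "0 < a" "0 < \<beta>" "0 < \<gamma>" "\<gamma> < 1"
    "\<And>x y. (\<integral>\<^sup>+w. ennreal (sqrt ((1 - exp (- a * norm (fst w - snd w)))
        * (1 + \<beta> * (V (fst w) + V (snd w))))) \<partial>coupled_kernel (x, y))
      \<le> ennreal (\<gamma> * sqrt ((1 - exp (- a * norm (x - y))) * (1 + \<beta> * (V x + V y))))"
proof -
  define a where "a = (2 * L + 1) / ((1 - \<rho>\<^sup>2) * accept_rate)"
  have L0: "0 \<le> L" using lip by (rule lipschitz_on_nonneg)
  have a: "0 < a" using L0 \<rho>sq accept_rate_bounds by (simp add: a_def)
  have a_eq: "a * (1 - \<rho>\<^sup>2) * accept_rate - 2 * L = 1"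
    using \<rho>sq accept_rate_bounds by (simp add: a_def)
  obtain R where R: "\<And>t. 0 \<le> t \<Longrightarrow> \<phi> t \<le> 4 * drift_const / (1 - drift_rate) \<Longrightarrow> t \<le> R"
    using \<phi>_levels by blast
  obtain \<beta> \<gamma> where \<beta>: "0 < \<beta>" and \<gamma>: "0 < \<gamma>" "\<gamma> < 1" and main:
    "\<And>D W. \<lbrakk>0 \<le> D; 0 \<le> W; W \<le> 4 * drift_const / (1 - drift_rate) \<Longrightarrow> D \<le> 2 * R\<rbrakk> \<Longrightarrow>
      (1 - exp (- a * D) - exp (- a * D) * D) * (1 + \<beta> * (drift_rate * W + 2 * drift_const))
        \<le> \<gamma>\<^sup>2 * ((1 - exp (- a * D)) * (1 + \<beta> * W))"
    by (rule harris_constants[OF drift_rate drift_const_ge a, where d = "2 * R"]) blast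
  have V0: "0 \<le> V z" for z by (simp add: \<phi>_nonneg)
  show thesis
  proof (rule that[OF a \<beta> \<gamma>])
    fix x y :: 'a
    let ?D = "norm (x - y)" and ?W = "V x + V y" and ?K = "coupled_kernel (x, y)"
    let ?g = "1 - exp (- a * ?D)"
    have [measurable_cong]: "sets ?K = sets (borel \<Otimes>\<^sub>M borel)" by (simp add: coupled_kernel_def)
    have g0: "0 \<le> ?g" using a by simp
    have W0: "0 \<le> ?W" using V0 by (simp add: add_nonneg_nonneg)
    have gW0: "0 \<le> ?g * (1 + \<beta> * ?W)"
      by (rule mult_nonneg_nonneg[OF g0 add_nonneg_nonneg[OF zero_le_one
            mult_nonneg_nonneg[OF less_imp_le[OF \<beta>] W0]]])
    have lev: "?D \<le> 2 * R" if "?W \<le> 4 * drift_const / (1 - drift_rate)"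
    proof -
      have "norm x \<le> R" "norm y \<le> R"
        using that V0[of x] V0[of y] by (auto intro!: R)
      then show ?thesis using norm_triangle_ineq4[of x y] by simp
    qed
    have F: "(\<integral>\<^sup>+w. ennreal (1 - exp (- a * norm (fst w - snd w))) \<partial>?K)
        \<le> ennreal (max 0 (?g - exp (- a * ?D) * ?D))"
      using coupled_distance_contracts[OF a, of x y] unfolding a_eq
      by (rule order_trans) (simp add: ennreal_leI)
    have m: "max 0 (?g - exp (- a * ?D) * ?D) * (1 + \<beta> * (drift_rate * ?W + 2 * drift_const))
        \<le> \<gamma>\<^sup>2 * (?g * (1 + \<beta> * ?W))"
    proof (cases "0 \<le> ?g - exp (- a * ?D) * ?D")
      case True
      then show ?thesis using main[OF _ W0 lev] by (simp add: max_absorb2)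
    next
      case False
      have "0 \<le> \<gamma>\<^sup>2 * (?g * (1 + \<beta> * ?W))"
        using gW0 by (rule mult_nonneg_nonneg[rotated]) simp
      then show ?thesis using False by (simp add: max_absorb1)
    qed
    show "(\<integral>\<^sup>+w. ennreal (sqrt ((1 - exp (- a * norm (fst w - snd w)))
          * (1 + \<beta> * (V (fst w) + V (snd w))))) \<partial>?K)
      \<le> ennreal (\<gamma> * sqrt (?g * (1 + \<beta> * ?W)))"
    proof (rule nn_integral_sqrt_mult_le[OF _ _ _ _ F coupled_kernel_drift])
      show "max 0 (?g - exp (- a * ?D) * ?D) * (1 + \<beta> * (drift_rate * ?W + 2 * drift_const))
          \<le> (\<gamma> * sqrt (?g * (1 + \<beta> * ?W)))\<^sup>2"
        using m gW0 by (simp add: power_mult_distrib)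
      show "0 \<le> \<gamma> * sqrt (?g * (1 + \<beta> * ?W))" 
        using \<gamma> gW0 by simp
      show "0 \<le> 1 + \<beta> * (drift_rate * ?W + 2 * drift_const)"
        using \<beta> mult_nonneg_nonneg[OF drift_rate(1) W0] drift_const_ge by simp
      show "0 \<le> 1 - exp (- a * norm (fst w - snd w))" for w :: "'a \<times> 'a" using a by simp
      show "0 \<le> 1 + \<beta> * (V (fst w) + V (snd w))" for w using \<beta> V0 by (intro add_nonneg_nonneg mult_nonneg_nonneg) auto
    qed (use \<beta> in auto)
  qed
qed

text \<open>The equivalence of semimetrics costs a factor \<open>c1 * c2\<close> once, not in every step, so any rate larger
  than \<open>\<gamma>\<close> is reached eventually.\<close>

theorem wasserstein_contracts:
  assumes \<epsilon>: "0 < \<epsilon>"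
  obtains \<gamma> where "0 < \<gamma>" "\<gamma> < 1"
    "\<And>l. \<gamma> < l \<Longrightarrow> \<exists>n0. \<forall>n\<ge>n0. \<forall>\<nu>1 \<nu>2. sets \<nu>1 = sets borel \<longrightarrow> sets \<nu>2 = sets borel \<longrightarrow>
      wasserstein (d_tilde V \<epsilon>) (\<nu>1 \<bind> kernel_pow kernel n) (\<nu>2 \<bind> kernel_pow kernel n)
        \<le> ennreal (l ^ n) * wasserstein (d_tilde V \<epsilon>) \<nu>1 \<nu>2"
proof -
  obtain a \<beta> \<gamma> where a: "0 < a" and \<beta>: "0 < \<beta>" and \<gamma>: "0 < \<gamma>" "\<gamma> < 1" and contr:
    "\<And>x y. (\<integral>\<^sup>+w. ennreal (sqrt ((1 - exp (- a * norm (fst w - snd w)))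
        * (1 + \<beta> * (V (fst w) + V (snd w))))) \<partial>coupled_kernel (x, y))
      \<le> ennreal (\<gamma> * sqrt ((1 - exp (- a * norm (x - y))) * (1 + \<beta> * (V x + V y))))"
    by (rule coupled_kernel_contracts) blast
  let ?H = "\<lambda>x y. sqrt ((1 - exp (- a * norm (x - y))) * (1 + \<beta> * (V x + V y)))"
  obtain c1 c2 where c: "0 < c1" "0 < c2"
    and c1: "\<And>x y. d_tilde V \<epsilon> x y \<le> c1 * ?H x y" and c2: "\<And>x y. ?H x y \<le> c2 * d_tilde V \<epsilon> x y"
    by (rule d_tilde_equivalent[OF a \<beta> \<epsilon>, of V]) (auto simp: \<phi>_nonneg)
  let ?d = "\<lambda>z. ennreal (d_tilde V \<epsilon> (fst z) (snd z))" and ?h = "\<lambda>z. ennreal (?H (fst z) (snd z))"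
  have hm[measurable]: "?h \<in> borel_measurable (borel \<Otimes>\<^sub>M borel)" by measurable
  have dm[measurable]: "?d \<in> borel_measurable (borel \<Otimes>\<^sub>M borel)"
    unfolding d_tilde_def d_eps_def by measurable
  have geometric: "\<exists>\<pi>'\<in>couplings (\<nu>1 \<bind> kernel_pow kernel n) (\<nu>2 \<bind> kernel_pow kernel n).
      (\<integral>\<^sup>+z. ?d z \<partial>\<pi>') \<le> ennreal (c1 * c2 * \<gamma> ^ n) * (\<integral>\<^sup>+z. ?d z \<partial>\<pi>)"
    if \<nu>: "sets \<nu>1 = sets borel" "sets \<nu>2 = sets borel" and \<pi>: "\<pi> \<in> couplings \<nu>1 \<nu>2" for \<nu>1 \<nu>2 \<pi> n
  proof -
    have contr': "(\<integral>\<^sup>+z. ?h z \<partial>coupled_kernel (x, y)) \<le> ennreal \<gamma> * ?h (x, y)" for x y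
      using contr[of x y] \<gamma> by (simp add: ennreal_mult')
    obtain \<pi>' where \<pi>': "\<pi>' \<in> couplings (\<nu>1 \<bind> kernel_pow kernel n) (\<nu>2 \<bind> kernel_pow kernel n)"
      and le: "(\<integral>\<^sup>+z. ?h z \<partial>\<pi>') \<le> ennreal \<gamma> ^ n * (\<integral>\<^sup>+z. ?h z \<partial>\<pi>)"
      using coupling_iterate[OF measurable_kernel measurable_coupled_kernel distr_coupled_kernel
          hm contr' \<nu> \<pi>] by blast
    have s[measurable_cong]: "sets \<pi> = sets (borel \<Otimes>\<^sub>M borel)" "sets \<pi>' = sets (borel \<Otimes>\<^sub>M borel)"
      using \<pi> \<pi>' by (auto simp: couplings_def)
    have "(\<integral>\<^sup>+z. ?d z \<partial>\<pi>') \<le> (\<integral>\<^sup>+z. ennreal c1 * ?h z \<partial>\<pi>')"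
      using c c1 by (intro nn_integral_mono) (auto simp flip: ennreal_mult' intro!: ennreal_leI)
    also have "\<dots> = ennreal c1 * (\<integral>\<^sup>+z. ?h z \<partial>\<pi>')" by (rule nn_integral_cmult) measurable
    also have "\<dots> \<le> ennreal c1 * (ennreal \<gamma> ^ n * (\<integral>\<^sup>+z. ?h z \<partial>\<pi>))"
      by (intro mult_left_mono le) simp
    also have "\<dots> \<le> ennreal c1 * (ennreal \<gamma> ^ n * (\<integral>\<^sup>+z. ennreal c2 * ?d z \<partial>\<pi>))"
      using c c2 by (intro mult_left_mono nn_integral_mono) (auto simp flip: ennreal_mult' intro!: ennreal_leI)
    also have "(\<integral>\<^sup>+z. ennreal c2 * ?d z \<partial>\<pi>) = ennreal c2 * (\<integral>\<^sup>+z. ?d z \<partial>\<pi>)"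
      by (rule nn_integral_cmult) measurable
    also have "ennreal c1 * (ennreal \<gamma> ^ n * (ennreal c2 * (\<integral>\<^sup>+z. ?d z \<partial>\<pi>)))
        = ennreal (c1 * c2 * \<gamma> ^ n) * (\<integral>\<^sup>+z. ?d z \<partial>\<pi>)"
      using c \<gamma> by (simp add: ennreal_mult ennreal_power mult_ac)
    finally show ?thesis using \<pi>' by blast
  qed
  show thesis
  proof (rule that[OF \<gamma>])
    fix l assume l: "\<gamma> < l"
    have "(\<lambda>n. (\<gamma> / l) ^ n) \<longlonglongrightarrow> 0"
      using l \<gamma> by (intro LIMSEQ_realpow_zero) auto
    then have "eventually (\<lambda>n. (\<gamma> / l) ^ n < 1 / (c1 * c2)) sequentially"
      using c by (intro order_tendstoD) auto
    then obtain n0 where n0: "\<And>n. n0 \<le> n \<Longrightarrow> (\<gamma> / l) ^ n < 1 / (c1 * c2)"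
      by (auto simp: eventually_sequentially)
    have le: "c1 * c2 * \<gamma> ^ n \<le> l ^ n" if "n0 \<le> n" for n
      using n0[OF that] l \<gamma> c by (simp add: power_divide field_simps)
    show "\<exists>n0. \<forall>n\<ge>n0. \<forall>\<nu>1 \<nu>2. sets \<nu>1 = sets borel \<longrightarrow> sets \<nu>2 = sets borel \<longrightarrow>
      wasserstein (d_tilde V \<epsilon>) (\<nu>1 \<bind> kernel_pow kernel n) (\<nu>2 \<bind> kernel_pow kernel n)
        \<le> ennreal (l ^ n) * wasserstein (d_tilde V \<epsilon>) \<nu>1 \<nu>2"
    proof (intro exI[of _ n0] allI impI)
      fix n and \<nu>1 \<nu>2 :: "'a measure"
      assume n: "n0 \<le> n" and \<nu>: "sets \<nu>1 = sets borel" "sets \<nu>2 = sets borel"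
      show "wasserstein (d_tilde V \<epsilon>) (\<nu>1 \<bind> kernel_pow kernel n) (\<nu>2 \<bind> kernel_pow kernel n)
        \<le> ennreal (l ^ n) * wasserstein (d_tilde V \<epsilon>) \<nu>1 \<nu>2"
      proof (rule wasserstein_leI)
        show "0 < l ^ n" using l \<gamma> by simp
        fix \<pi> assume "\<pi> \<in> couplings \<nu>1 \<nu>2"
        from geometric[OF \<nu> this, of n] obtain \<pi>'
          where \<pi>': "\<pi>' \<in> couplings (\<nu>1 \<bind> kernel_pow kernel n) (\<nu>2 \<bind> kernel_pow kernel n)"
            "(\<integral>\<^sup>+z. ?d z \<partial>\<pi>') \<le> ennreal (c1 * c2 * \<gamma> ^ n) * (\<integral>\<^sup>+z. ?d z \<partial>\<pi>)" by blast
        note \<pi>'(2)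
        also have "ennreal (c1 * c2 * \<gamma> ^ n) * (\<integral>\<^sup>+z. ?d z \<partial>\<pi>) \<le> ennreal (l ^ n) * (\<integral>\<^sup>+z. ?d z \<partial>\<pi>)"
          by (intro mult_right_mono ennreal_leI le n) simp
        finally show "\<exists>\<pi>'\<in>couplings (\<nu>1 \<bind> kernel_pow kernel n) (\<nu>2 \<bind> kernel_pow kernel n).
            (\<integral>\<^sup>+z. ?d z \<partial>\<pi>') \<le> ennreal (l ^ n) * (\<integral>\<^sup>+z. ?d z \<partial>\<pi>)"
          using \<pi>'(1) by blast
      qed
    qed
  qed
qed

end

section \<open>Bounds on the potential, Lyapunov functions and the theorem\<close>

text \<open>As \<open>1 < p\<close>, there is a proposal index other than \<open>j\<close> at which an arbitrary point \<open>w\<close> can be put; its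
  weight in the denominator of the acceptance probability at the centre \<open>\<rho>\<^sup>2 x\<close> forces
  \<open>\<Phi> (\<rho>\<^sup>2 x) \<le> \<Phi> w - ln a\<close>. Inside the ball of radius \<open>R\<close> the Lipschitz bound takes over; it also
  covers the trivial space, where no point lies outside the ball.\<close>

lemma acceptance_condition_bounds:
  fixes \<Phi> :: "'a::real_inner \<Rightarrow> real"
  assumes acc: "acceptance_condition \<rho> \<Phi> p" and p: "1 < p"
    and lip: "L-lipschitz_on UNIV \<Phi>" and \<rho>: "0 \<le> \<rho>" "\<rho> < 1"
  obtains lo hi where "\<And>x. lo \<le> \<Phi> x" "\<And>x. \<Phi> (\<rho>\<^sup>2 *\<^sub>R x) \<le> hi"
proof -
  obtain R a r j where R: "0 < R" and a: "0 < a" and r: "\<forall>t>0. 0 < r t" and j: "j \<in> {1..p}"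
    and cond: "\<forall>x. x \<notin> ball 0 R \<longrightarrow> (\<forall>z.
      a < (INF y\<in>ball (\<rho>\<^sup>2 *\<^sub>R x) (r (norm x)). accept_prob \<Phi> p j (z(0 := x, j := y))))"
    using acc unfolding acceptance_condition_def by (elim exE conjE bexE) (rule that; assumption)
  have L0: "0 \<le> L" using lip by (rule lipschitz_on_nonneg)
  have near: "\<bar>\<Phi> x - \<Phi> 0\<bar> \<le> L * norm x" for x
    using lipschitz_onD[OF lip, of x 0] by (simp add: dist_norm)
  have far: "\<Phi> (\<rho>\<^sup>2 *\<^sub>R x) \<le> \<Phi> w - ln a" if x: "x \<notin> ball 0 R" for x w
  proof -
    let ?f = "\<lambda>y. accept_prob \<Phi> p j ((\<lambda>_. w)(0 := x, j := y))"
    let ?xs = "(\<lambda>_. w)(0 := x, j := \<rho>\<^sup>2 *\<^sub>R x)"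
    define l where "l = (if j = 1 then 2 else 1 :: nat)"
    have l: "l \<le> p" "l \<noteq> 0" "l \<noteq> j" using p by (auto simp: l_def)
    have "0 < r (norm x)" using x R by (intro r[rule_format]) auto
    then have "(INF y\<in>ball (\<rho>\<^sup>2 *\<^sub>R x) (r (norm x)). ?f y) \<le> ?f (\<rho>\<^sup>2 *\<^sub>R x)"
      by (intro cINF_lower bdd_belowI2[where m = 0]) (auto simp: accept_prob_nonneg)
    with cond[rule_format, OF x, of "\<lambda>_. w"] have "a < ?f (\<rho>\<^sup>2 *\<^sub>R x)" by simp
    also have "?f (\<rho>\<^sup>2 *\<^sub>R x) = exp (- \<Phi> (\<rho>\<^sup>2 *\<^sub>R x)) / (\<Sum>k\<le>p. exp (- \<Phi> (?xs k)))"
      by (simp add: accept_prob_def)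
    also have "\<dots> \<le> exp (- \<Phi> (\<rho>\<^sup>2 *\<^sub>R x)) / exp (- \<Phi> w)"
    proof (rule divide_left_mono)
      show "exp (- \<Phi> w) \<le> (\<Sum>k\<le>p. exp (- \<Phi> (?xs k)))"
        using member_le_sum[of l "{..p}" "\<lambda>k. exp (- \<Phi> (?xs k))"] l by simp
      show "0 < (\<Sum>k\<le>p. exp (- \<Phi> (?xs k))) * exp (- \<Phi> w)"
        by (intro mult_pos_pos sum_pos) auto
    qed simp
    also have "\<dots> = exp (\<Phi> w - \<Phi> (\<rho>\<^sup>2 *\<^sub>R x))" by (simp flip: exp_diff)
    finally have "ln a < ln (exp (\<Phi> w - \<Phi> (\<rho>\<^sup>2 *\<^sub>R x)))"
      using a by (subst ln_less_cancel_iff) auto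
    then show ?thesis by simp
  qed
  have "\<exists>lo. \<forall>w. lo \<le> \<Phi> w"
  proof (cases "\<exists>x::'a. x \<notin> ball 0 R")
    case True
    then obtain x :: 'a where "x \<notin> ball 0 R" by blast
    then show ?thesis using far by (intro exI[of _ "\<Phi> (\<rho>\<^sup>2 *\<^sub>R x) + ln a"]) (force simp: algebra_simps)
  next
    case False
    have "\<Phi> 0 - L * R \<le> \<Phi> w" for w
    proof -
      have "norm w \<le> R" using False by (auto simp: less_imp_le)
      then show ?thesis using near[of w] mult_left_mono[OF _ L0, of "norm w" R] by linarith
    qed
    then show ?thesis by blast
  qed
  then obtain lo where lo: "\<And>w. lo \<le> \<Phi> w" by blast
  have "\<Phi> (\<rho>\<^sup>2 *\<^sub>R x) \<le> max (\<Phi> 0 - ln a) (\<Phi> 0 + L * R)" for x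
  proof (cases "x \<in> ball 0 R")
    case True
    have "\<rho>\<^sup>2 * norm x \<le> 1 * norm x"
      using \<rho> by (intro mult_right_mono) (auto simp: power_le_one)
    then have "norm (\<rho>\<^sup>2 *\<^sub>R x) \<le> R" using True by simp
    then have "L * norm (\<rho>\<^sup>2 *\<^sub>R x) \<le> L * R" using L0 by (rule mult_left_mono)
    then show ?thesis using near[of "\<rho>\<^sup>2 *\<^sub>R x"] by linarith
  next
    case False
    then show ?thesis using far[of x 0] by simp
  qed
  then show thesis using lo that by blast
qed

text \<open>The increment is a combination of two noise vectors with coefficients at most one, so its square is at most
  four times the larger of their squares.\<close>

lemma (in mpcn) increment_exp_moment:
  assumes b: "0 \<le> b" and moment: "(\<integral>\<^sup>+x. ennreal (exp (b * (norm x)\<^sup>2)) \<partial>\<mu>) < \<infinity>" and i: "i \<in> {1..p}"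
  shows "(\<integral>\<^sup>+\<omega>. ennreal (exp (b / 4 * (norm (increment i \<omega>))\<^sup>2)) \<partial>noise) < \<infinity>"
proof -
  interpret PM: prob_space "\<Pi>\<^sub>M k\<in>{1..p}. \<mu>" by (rule prob_space_PiM_\<mu>)
  interpret PP: product_prob_space "\<lambda>_. \<mu>" "{1..p}"
    by (intro product_prob_spaceI prob_\<mu>)
  let ?e = "\<lambda>x. ennreal (exp (b * (norm x)\<^sup>2))"
  have i': "(\<lambda>\<xi>. \<xi> i) \<in> (\<Pi>\<^sub>M k\<in>{1..p}. \<mu>) \<rightarrow>\<^sub>M \<mu>" using i by measurable
  have snd_i: "(\<lambda>\<omega>. snd \<omega> i) \<in> \<mu> \<Otimes>\<^sub>M (\<Pi>\<^sub>M k\<in>{1..p}. \<mu>) \<rightarrow>\<^sub>M \<mu>"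
    by (rule measurable_compose[OF measurable_snd i'])
  have e: "?e \<in> borel_measurable \<mu>" by measurable
  have 1: "(\<integral>\<^sup>+\<omega>. ?e (fst \<omega>) \<partial>noise) = (\<integral>\<^sup>+x. ?e x \<partial>\<mu>)"
    unfolding noise_def
    by (subst PM.nn_integral_fst[symmetric]) (simp_all add: PM.emeasure_space_1[unfolded One_nat_def])
  have "(\<integral>\<^sup>+\<omega>. ?e (snd \<omega> i) \<partial>noise) = (\<integral>\<^sup>+\<xi>. ?e (\<xi> i) \<partial>(\<Pi>\<^sub>M k\<in>{1..p}. \<mu>))"
    unfolding noise_def using measurable_compose[OF snd_i e]
    by (subst PM.nn_integral_fst[symmetric]) (simp_all add: emeasure_space_1)
  also have "\<dots> = (\<integral>\<^sup>+x. ?e x \<partial>distr (\<Pi>\<^sub>M k\<in>{1..p}. \<mu>) \<mu> (\<lambda>\<xi>. \<xi> i))"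
    by (rule nn_integral_distr[OF i', symmetric]) (use e in simp)
  also have "distr (\<Pi>\<^sub>M k\<in>{1..p}. \<mu>) \<mu> (\<lambda>\<xi>. \<xi> i) = \<mu>"
    by (rule PP.PiM_component[OF i])
  finally have 2: "(\<integral>\<^sup>+\<omega>. ?e (snd \<omega> i) \<partial>noise) = (\<integral>\<^sup>+x. ?e x \<partial>\<mu>)" .
  have pt: "exp (b / 4 * (norm (increment i \<omega>))\<^sup>2) \<le> exp (b * (norm (fst \<omega>))\<^sup>2) + exp (b * (norm (snd \<omega> i))\<^sup>2)" for \<omega>
  proof -
    let ?u = "norm (fst \<omega>)" and ?v = "norm (snd \<omega> i)"
    have \<sigma>: "0 \<le> \<sigma>" "\<sigma> \<le> 1" using \<rho>0 \<rho>1 by (auto simp: \<sigma>_def power_le_one)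
    then have "\<rho> * \<sigma> \<le> 1 * 1" using \<rho>0 \<rho>1 by (intro mult_mono) auto
    then have "norm (increment i \<omega>) \<le> 1 * ?u + 1 * ?v"
      unfolding increment_def using \<sigma> \<rho>0
      by (intro order_trans[OF norm_triangle_ineq] add_mono) (auto simp: mult_left_le_one_le)
    also have "\<dots> \<le> 2 * max ?u ?v" by simp
    finally have "(norm (increment i \<omega>))\<^sup>2 \<le> (2 * max ?u ?v)\<^sup>2" by (intro power_mono) auto
    then have "b / 4 * (norm (increment i \<omega>))\<^sup>2 \<le> b * (max ?u ?v)\<^sup>2"
      using mult_left_mono[of _ _ "b / 4"] b by fastforce
    then have "exp (b / 4 * (norm (increment i \<omega>))\<^sup>2) \<le> exp (b * (max ?u ?v)\<^sup>2)" by simp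
    also have "\<dots> \<le> exp (b * ?u\<^sup>2) + exp (b * ?v\<^sup>2)"
      by (cases "?u \<le> ?v") (auto simp: max_def)
    finally show ?thesis .
  qed
  have "(\<integral>\<^sup>+\<omega>. ennreal (exp (b / 4 * (norm (increment i \<omega>))\<^sup>2)) \<partial>noise)
      \<le> (\<integral>\<^sup>+\<omega>. ?e (fst \<omega>) + ?e (snd \<omega> i) \<partial>noise)"
    by (intro nn_integral_mono) (use pt in \<open>simp flip: ennreal_plus add: ennreal_leI\<close>)
  also have "\<dots> = (\<integral>\<^sup>+\<omega>. ?e (fst \<omega>) \<partial>noise) + (\<integral>\<^sup>+\<omega>. ?e (snd \<omega> i) \<partial>noise)"
    unfolding noise_def using measurable_compose[OF snd_i e] by (intro nn_integral_add) auto
  also have "\<dots> < \<infinity>" unfolding 1 2 using moment by simp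
  finally show ?thesis .
qed

text \<open>The contraction \<open>t \<mapsto> q t\<close> lowers each of the functions by a factor \<open>q\<close> up to a constant: by
  homogeneity for powers, by convexity of \<open>exp\<close> for the others. All are dominated by
  \<open>exp (v0 t\<^sup>2)\<close>, which is where the bound on the parameter of the squared exponential enters.\<close>

lemma lyapunov_choice_radial:
  assumes V: "lyapunov_choice v0 V" and v0: "0 < v0" and q: "0 \<le> q" "q \<le> 1"
  obtains \<phi> C where "V = (\<lambda>x. \<phi> (norm x))" "\<And>s t. 0 \<le> s \<Longrightarrow> s \<le> t \<Longrightarrow> \<phi> s \<le> \<phi> t"
    "\<And>t. 0 \<le> t \<Longrightarrow> 0 \<le> \<phi> t" "\<phi> \<in> borel_measurable borel"
    "\<And>t. 0 \<le> t \<Longrightarrow> \<phi> (q * t) \<le> q * \<phi> t + 1"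
    "\<And>B. \<exists>R. \<forall>t\<ge>0. \<phi> t \<le> B \<longrightarrow> t \<le> R"
    "0 \<le> C" "\<And>t. 0 \<le> t \<Longrightarrow> \<phi> t \<le> C * exp (v0 * t\<^sup>2)"
proof -
  have convex: "exp (q * u) \<le> q * exp u + 1" if "0 \<le> u" for u
  proof -
    have "exp (q * u) \<le> (1 - q) * exp 0 + q * exp u"
      using convex_onD[OF exp_convex q, of 0 u] by simp
    then show ?thesis using q by simp
  qed
  from V consider (power) k :: nat where "1 \<le> k" "V = (\<lambda>x. norm x ^ k)"
    | (exp) v where "0 < v" "V = (\<lambda>x. exp (v * norm x))"
    | (square) v where "0 < v" "v \<le> v0" "V = (\<lambda>x. exp (v * (norm x)\<^sup>2))"
    unfolding lyapunov_choice_def by blast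
  then show thesis
  proof cases
    case power
    show thesis
    proof (rule that[of "\<lambda>t. t ^ k" "1 + (k / v0) ^ k"])
      show "(q * t) ^ k \<le> q * t ^ k + 1" if "0 \<le> t" for t
      proof -
        have "q ^ k \<le> q" using power_decreasing[of 1 k q] q power by simp
        then have "q ^ k * t ^ k \<le> q * t ^ k" using that by (intro mult_right_mono) auto
        then show ?thesis by (simp add: power_mult_distrib)
      qed
      show "\<exists>R. \<forall>t\<ge>0. t ^ k \<le> B \<longrightarrow> t \<le> R" for B :: real
      proof (intro exI allI impI)
        fix t :: real assume t: "0 \<le> t" "t ^ k \<le> B"
        show "t \<le> max 1 B"
          using power_increasing[of 1 k t] t power by (cases "1 \<le> t") auto
      qed
      show "t ^ k \<le> (1 + (k / v0) ^ k) * exp (v0 * t\<^sup>2)" if "0 \<le> t" for t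
      proof -
        let ?u = "v0 * t\<^sup>2"
        have u: "0 \<le> ?u" using v0 by simp
        have "(?u / k) ^ k \<le> (1 + ?u / k) ^ k"
          using u by (intro power_mono) auto
        also have "\<dots> \<le> exp ?u"
          using u power by (intro exp_ge_one_plus_x_over_n_power_n) auto
        finally have "(k / v0) ^ k * (?u / k) ^ k \<le> (k / v0) ^ k * exp ?u"
          using v0 by (intro mult_left_mono) auto
        moreover have "(k / v0) ^ k * (?u / k) ^ k = t ^ (2 * k)"
          using v0 power by (simp add: power_mult flip: power_mult_distrib)
        ultimately have "t ^ (2 * k) \<le> (k / v0) ^ k * exp ?u" by simp
        moreover have "t ^ k \<le> 1 + t ^ (2 * k)"
        proof -
          have "2 * t ^ k \<le> 1 + (t ^ k)\<^sup>2" using sum_squares_bound[of 1 "t ^ k"] by simp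
          moreover have "0 \<le> t ^ k" using that by simp
          ultimately show ?thesis by (simp add: power_mult[symmetric] mult.commute)
        qed
        moreover have "1 \<le> exp (v0 * t\<^sup>2)" using v0 by simp
        ultimately show ?thesis unfolding distrib_right mult_1_left by linarith
      qed
    qed (use power v0 in \<open>auto intro: power_mono\<close>)
  next
    case exp
    show thesis
    proof (rule that[of "\<lambda>t. exp (v * t)" "exp (v\<^sup>2 / (4 * v0))"])
      show "exp (v * (q * t)) \<le> q * exp (v * t) + 1" if "0 \<le> t" for t
        using convex[of "v * t"] that exp by (simp add: mult.left_commute)
      show "\<exists>R. \<forall>t\<ge>0. exp (v * t) \<le> B \<longrightarrow> t \<le> R" for B :: real
      proof (intro exI allI impI)
        fix t :: real assume t: "0 \<le> t" "exp (v * t) \<le> B"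
        then have "v * t \<le> B" using exp_ge_add_one_self[of "v * t"] by linarith
        then show "t \<le> B / v" using exp by (simp add: field_simps)
      qed
      show "exp (v * t) \<le> exp (v\<^sup>2 / (4 * v0)) * exp (v0 * t\<^sup>2)" for t
      proof -
        have "0 \<le> (v - 2 * v0 * t)\<^sup>2 / (4 * v0)" using v0 by simp
        also have "\<dots> = v\<^sup>2 / (4 * v0) + v0 * t\<^sup>2 - v * t"
          using v0 by (simp add: power2_eq_square field_simps)
        finally show ?thesis by (simp flip: exp_add)
      qed
    qed (use exp in auto)
  next
    case square
    show thesis
    proof (rule that[of "\<lambda>t. exp (v * t\<^sup>2)" 1])
      show "exp (v * (q * t)\<^sup>2) \<le> q * exp (v * t\<^sup>2) + 1" if "0 \<le> t" for t
      proof -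
        have "q\<^sup>2 \<le> q" using q by (simp add: power2_eq_square mult_left_le)
        then have "q\<^sup>2 * (v * t\<^sup>2) \<le> q * (v * t\<^sup>2)"
          using square by (intro mult_right_mono) auto
        then have "exp (v * (q * t)\<^sup>2) \<le> exp (q * (v * t\<^sup>2))"
          by (simp add: power_mult_distrib mult_ac)
        also have "\<dots> \<le> q * exp (v * t\<^sup>2) + 1" using square by (intro convex) simp
        finally show ?thesis .
      qed
      show "\<exists>R. \<forall>t\<ge>0. exp (v * t\<^sup>2) \<le> B \<longrightarrow> t \<le> R" for B :: real
      proof (intro exI allI impI)
        fix t :: real assume t: "0 \<le> t" "exp (v * t\<^sup>2) \<le> B"
        then have "v * t\<^sup>2 \<le> B" using exp_ge_add_one_self[of "v * t\<^sup>2"] by linarith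
        then have "t\<^sup>2 \<le> B / v" using square by (simp add: field_simps)
        then show "t \<le> max 1 (B / v)"
          using power_increasing[of 1 2 t] by (cases "1 \<le> t") auto
      qed
    qed (use square in \<open>auto intro!: mult_left_mono mult_right_mono power_mono\<close>)
  qed
qed

theorem theoremA2:
  fixes C :: "'a::{real_inner, banach, second_countable_topology} \<Rightarrow> 'a"
    and \<mu>0 :: "'a measure"
    and Q :: "'a \<Rightarrow> 'a measure"
    and \<Phi> :: "'a \<Rightarrow> real"
    and \<rho> L :: real
  assumes "covariance_operator C"
    and "gaussian_measure 0 C \<mu>0"
    and "0 \<le> \<rho>" and "\<rho> < 1"
    and "\<And>x. gaussian_measure (\<rho> *\<^sub>R x) (\<lambda>h. (1 - \<rho>\<^sup>2) *\<^sub>R C h) (Q x)"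
    and "L-lipschitz_on UNIV \<Phi>"
  shows "\<exists>v0>0. \<forall>V :: 'a \<Rightarrow> real. lyapunov_choice v0 V \<longrightarrow>
    (\<exists>(\<epsilon>star :: nat \<Rightarrow> real) (lam :: nat \<Rightarrow> real \<Rightarrow> real) (n1 :: nat \<Rightarrow> real \<Rightarrow> nat).
       (\<forall>p>1. \<epsilon>star p \<in> {0<..<1}) \<and>
       (\<forall>p>1. \<forall>\<epsilon>\<in>{0<..<\<epsilon>star p}. lam p \<epsilon> \<in> {0<..<1}) \<and>
       (\<forall>p>1. acceptance_condition \<rho> \<Phi> p \<longrightarrow>
         (\<forall>\<epsilon>\<in>{0<..<\<epsilon>star p}. \<forall>\<nu>1 \<nu>2 :: 'a measure.
            prob_space \<nu>1 \<and> sets \<nu>1 = sets borel \<and> prob_space \<nu>2 \<and> sets \<nu>2 = sets borel \<longrightarrow>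
            (\<forall>n\<ge>n1 p \<epsilon>.
               wasserstein (d_tilde V \<epsilon>) (\<nu>1 \<bind> kernel_pow (mpcn_kernel Q \<Phi> p) n)
                                         (\<nu>2 \<bind> kernel_pow (mpcn_kernel Q \<Phi> p) n)
               \<le> ennreal (lam p \<epsilon> ^ n) * wasserstein (d_tilde V \<epsilon>) \<nu>1 \<nu>2))) \<and>
       \<epsilon>star \<longlonglongrightarrow> 0 \<and>
       (\<forall>e :: nat \<Rightarrow> real. (\<forall>p>1. e p \<in> {0<..<\<epsilon>star p}) \<longrightarrow>
          (\<lambda>p. lam p (e p)) \<longlonglongrightarrow> 1 \<and> filterlim (\<lambda>p. n1 p (e p)) at_top sequentially))"
proof -
  obtain b where b: "0 < b" "(\<integral>\<^sup>+x. ennreal (exp (b * (norm x)\<^sup>2)) \<partial>\<mu>0) < \<infinity>"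
    using gaussian_exp_moment[OF assms(1,2)] by blast
  have \<rho>sq: "0 \<le> \<rho>\<^sup>2" "\<rho>\<^sup>2 < 1"
    using assms(3,4) by (auto simp: power_less_one_iff abs_square_less_1)
  define B where "B = (1 + \<rho>\<^sup>2) / (1 - \<rho>\<^sup>2)"
  \<comment> \<open>The factor \<open>B\<close> multiplies the increment in the drift estimate, and passing from one noise vector to
    an increment costs the factor \<open>4\<close>.\<close>
  define v0 where "v0 = b / (4 * B\<^sup>2)"
  have B: "0 < B" using \<rho>sq by (auto simp: B_def intro!: divide_pos_pos add_pos_nonneg)
  then have v0: "0 < v0" using b by (simp add: v0_def)
  have Q: "Q z = distr \<mu>0 borel (\<lambda>\<xi>. \<rho> *\<^sub>R z + sqrt (1 - \<rho>\<^sup>2) *\<^sub>R \<xi>)" for z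
    using gaussian_measure_affine[OF assms(1,2), of "sqrt (1 - \<rho>\<^sup>2)" "\<rho> *\<^sub>R z"] assms(5)[of z] \<rho>sq
    by (intro gaussian_measure_unique) auto
  have main: "\<exists>l n1. 0 < l \<and> l < 1 \<and> 1 - 1 / (real p + 2) \<le> l \<and> p \<le> n1 \<and>
      (1 < p \<longrightarrow> 0 < \<epsilon> \<longrightarrow> acceptance_condition \<rho> \<Phi> p \<longrightarrow>
        (\<forall>n\<ge>n1. \<forall>\<nu>1 \<nu>2. sets \<nu>1 = sets borel \<longrightarrow> sets \<nu>2 = sets borel \<longrightarrow>
          wasserstein (d_tilde V \<epsilon>) (\<nu>1 \<bind> kernel_pow (mpcn_kernel Q \<Phi> p) n)
              (\<nu>2 \<bind> kernel_pow (mpcn_kernel Q \<Phi> p) n)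
            \<le> ennreal (l ^ n) * wasserstein (d_tilde V \<epsilon>) \<nu>1 \<nu>2))"
    if V: "lyapunov_choice v0 V" for V :: "'a \<Rightarrow> real" and p \<epsilon>
  proof (cases "1 < p \<and> 0 < \<epsilon> \<and> acceptance_condition \<rho> \<Phi> p")
    case False
    then show ?thesis
      by (intro exI[of _ "1 - 1 / (real p + 2)"] exI[of _ p]) auto
  next
    case True
    interpret M0: mpcn \<mu>0 \<Phi> \<rho> L p
    proof (rule mpcn.intro)
      show "prob_space \<mu>0" "sets \<mu>0 = sets borel"
        using assms(2) unfolding gaussian_measure_def by blast+
    qed (rule assms)+
    obtain lo hi where lohi: "\<And>x. lo \<le> \<Phi> x" "\<And>x. \<Phi> (\<rho>\<^sup>2 *\<^sub>R x) \<le> hi"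
      using acceptance_condition_bounds[OF _ _ assms(6,3,4)] True by blast
    obtain \<phi> D where V_eq: "V = (\<lambda>x. \<phi> (norm x))" and mono: "\<And>s t. 0 \<le> s \<Longrightarrow> s \<le> t \<Longrightarrow> \<phi> s \<le> \<phi> t"
      and nonneg: "\<And>t. 0 \<le> t \<Longrightarrow> 0 \<le> \<phi> t" and meas: "\<phi> \<in> borel_measurable borel"
      and shrink: "\<And>t. 0 \<le> t \<Longrightarrow> \<phi> ((1 + \<rho>\<^sup>2) / 2 * t) \<le> (1 + \<rho>\<^sup>2) / 2 * \<phi> t + 1"
      and levels: "\<And>B. \<exists>R. \<forall>t\<ge>0. \<phi> t \<le> B \<longrightarrow> t \<le> R"
      and D: "0 \<le> D" "\<And>t. 0 \<le> t \<Longrightarrow> \<phi> t \<le> D * exp (v0 * t\<^sup>2)"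
      by (rule lyapunov_choice_radial[OF V v0, of "(1 + \<rho>\<^sup>2) / 2"]) (use \<rho>sq in auto)
    have moment: "(\<integral>\<^sup>+\<omega>. ennreal (\<phi> (B * norm (M0.increment i \<omega>))) \<partial>M0.noise) < \<infinity>"
      if i: "i \<in> {1..p}" for i
    proof -
      have [measurable]: "M0.increment i \<in> borel_measurable M0.noise"
        by (rule M0.measurable_increment[OF i])
      have "\<phi> (B * norm (M0.increment i \<omega>)) \<le> D * exp (b / 4 * (norm (M0.increment i \<omega>))\<^sup>2)" for \<omega>
        using D(2)[of "B * norm (M0.increment i \<omega>)"] B by (simp add: v0_def power_mult_distrib)
      then have "(\<integral>\<^sup>+\<omega>. ennreal (\<phi> (B * norm (M0.increment i \<omega>))) \<partial>M0.noise)
          \<le> (\<integral>\<^sup>+\<omega>. ennreal D * ennreal (exp (b / 4 * (norm (M0.increment i \<omega>))\<^sup>2)) \<partial>M0.noise)"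
        using D(1) by (intro nn_integral_mono) (simp add: ennreal_leI flip: ennreal_mult')
      also have "\<dots> = ennreal D * (\<integral>\<^sup>+\<omega>. ennreal (exp (b / 4 * (norm (M0.increment i \<omega>))\<^sup>2)) \<partial>M0.noise)"
        by (rule nn_integral_cmult) measurable
      also have "\<dots> < \<infinity>"
        using M0.increment_exp_moment[OF _ b(2) i] b(1) by (simp add: ennreal_mult_less_top)
      finally show ?thesis .
    qed
    interpret M: mpcn_lyapunov \<mu>0 \<Phi> \<rho> L p lo hi \<phi>
      by unfold_locales (use True lohi mono nonneg meas shrink levels moment in \<open>auto simp: B_def\<close>)
    have kernel: "mpcn_kernel Q \<Phi> p = M0.kernel"
      unfolding M0.kernel_def using M0.mpcn_kernel_eq_mixture[of Q] Q by (auto simp: M0.\<sigma>_def)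
    obtain \<gamma> where \<gamma>: "0 < \<gamma>" "\<gamma> < 1" and contr:
      "\<And>l. \<gamma> < l \<Longrightarrow> \<exists>n0. \<forall>n\<ge>n0. \<forall>\<nu>1 \<nu>2. sets \<nu>1 = sets borel \<longrightarrow> sets \<nu>2 = sets borel \<longrightarrow>
        wasserstein (d_tilde V \<epsilon>) (\<nu>1 \<bind> kernel_pow M0.kernel n) (\<nu>2 \<bind> kernel_pow M0.kernel n)
          \<le> ennreal (l ^ n) * wasserstein (d_tilde V \<epsilon>) \<nu>1 \<nu>2"
      unfolding V_eq by (rule M.wasserstein_contracts[of \<epsilon>]) (use True in blast)+
    \<comment> \<open>A rate may be increased and a number of steps enlarged, which yields the limits in \<open>p\<close>.\<close>
    define l where "l = max ((1 + \<gamma>) / 2) (1 - 1 / (real p + 2))"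
    have l: "\<gamma> < l" "0 < l" "l < 1" using \<gamma> by (auto simp: l_def less_max_iff_disj)
    from contr[OF l(1)] obtain n0 where "\<forall>n\<ge>n0. \<forall>\<nu>1 \<nu>2. sets \<nu>1 = sets borel \<longrightarrow> sets \<nu>2 = sets borel \<longrightarrow>
        wasserstein (d_tilde V \<epsilon>) (\<nu>1 \<bind> kernel_pow M0.kernel n) (\<nu>2 \<bind> kernel_pow M0.kernel n)
          \<le> ennreal (l ^ n) * wasserstein (d_tilde V \<epsilon>) \<nu>1 \<nu>2" by blast
    then show ?thesis
      unfolding kernel using l by (intro exI[of _ l] exI[of _ "max n0 p"]) (auto simp: l_def)
  qed
  have inv_lim: "(\<lambda>p. 1 / (real p + 2)) \<longlonglongrightarrow> 0"
    using LIMSEQ_Suc[OF LIMSEQ_inverse_real_of_nat] by (simp add: inverse_eq_divide add.commute)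
  show ?thesis
  proof (intro exI[of _ v0] conjI v0 allI impI)
    fix V :: "'a \<Rightarrow> real" assume V: "lyapunov_choice v0 V"
    obtain lam n1 where lam: "\<And>p \<epsilon>. 0 < lam p \<epsilon>" "\<And>p \<epsilon>. lam p \<epsilon> < 1"
      "\<And>p \<epsilon>. 1 - 1 / (real p + 2) \<le> lam p \<epsilon>" and n1: "\<And>p \<epsilon>. p \<le> n1 p \<epsilon>"
      and W: "\<And>p \<epsilon> n \<nu>1 \<nu>2. \<lbrakk>1 < p; 0 < \<epsilon>; acceptance_condition \<rho> \<Phi> p; n1 p \<epsilon> \<le> n;
          sets \<nu>1 = sets borel; sets \<nu>2 = sets borel\<rbrakk> \<Longrightarrow>
        wasserstein (d_tilde V \<epsilon>) (\<nu>1 \<bind> kernel_pow (mpcn_kernel Q \<Phi> p) n)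
            (\<nu>2 \<bind> kernel_pow (mpcn_kernel Q \<Phi> p) n)
          \<le> ennreal (lam p \<epsilon> ^ n) * wasserstein (d_tilde V \<epsilon>) \<nu>1 \<nu>2"
      using main[OF V] by metis
    have lim1: "(\<lambda>p. lam p (e p)) \<longlonglongrightarrow> 1" for e
    proof (rule tendsto_sandwich)
      show "(\<lambda>p. 1 - 1 / (real p + 2)) \<longlonglongrightarrow> 1"
        using tendsto_diff[OF tendsto_const[of 1] inv_lim] by simp
      show "\<forall>\<^sub>F p in sequentially. 1 - 1 / (real p + 2) \<le> lam p (e p)"
        by (rule always_eventually) (use lam(3) in blast)
      show "\<forall>\<^sub>F p in sequentially. lam p (e p) \<le> 1"
        by (rule always_eventually) (use lam(2) in \<open>auto intro: less_imp_le\<close>)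
    qed simp
    have lim2: "filterlim (\<lambda>p. n1 p (e p)) at_top sequentially" for e
      by (rule filterlim_at_top_mono[OF filterlim_ident]) (simp add: n1)
    show "\<exists>(\<epsilon>star :: nat \<Rightarrow> real) (lam :: nat \<Rightarrow> real \<Rightarrow> real) (n1 :: nat \<Rightarrow> real \<Rightarrow> nat).
       (\<forall>p>1. \<epsilon>star p \<in> {0<..<1}) \<and>
       (\<forall>p>1. \<forall>\<epsilon>\<in>{0<..<\<epsilon>star p}. lam p \<epsilon> \<in> {0<..<1}) \<and>
       (\<forall>p>1. acceptance_condition \<rho> \<Phi> p \<longrightarrow>
         (\<forall>\<epsilon>\<in>{0<..<\<epsilon>star p}. \<forall>\<nu>1 \<nu>2 :: 'a measure.
            prob_space \<nu>1 \<and> sets \<nu>1 = sets borel \<and> prob_space \<nu>2 \<and> sets \<nu>2 = sets borel \<longrightarrow>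
            (\<forall>n\<ge>n1 p \<epsilon>.
               wasserstein (d_tilde V \<epsilon>) (\<nu>1 \<bind> kernel_pow (mpcn_kernel Q \<Phi> p) n)
                                         (\<nu>2 \<bind> kernel_pow (mpcn_kernel Q \<Phi> p) n)
               \<le> ennreal (lam p \<epsilon> ^ n) * wasserstein (d_tilde V \<epsilon>) \<nu>1 \<nu>2))) \<and>
       \<epsilon>star \<longlonglongrightarrow> 0 \<and>
       (\<forall>e :: nat \<Rightarrow> real. (\<forall>p>1. e p \<in> {0<..<\<epsilon>star p}) \<longrightarrow>
          (\<lambda>p. lam p (e p)) \<longlonglongrightarrow> 1 \<and> filterlim (\<lambda>p. n1 p (e p)) at_top sequentially)"
      by (intro exI[of _ "\<lambda>p. 1 / (real p + 2)"] exI[of _ lam] exI[of _ n1] conjI allI ballI impI)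
         (use lam W inv_lim lim1 lim2 in auto)
  qed
qed

end
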